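(* Let $N$ be a six-dimensional, compact, connected manifold endowed with a nearly Kähler $\mathrm{SU}(3)$-structure $(\omega,\psi_+)$ and let $\nu:N\to N$ be a diffeomorphism such that $\nu^*\omega=\omega$. Then the mapping torus $N_\nu$ admits a locally conformal parallel $G_2$-structure.
   Context: Notation: $e^{ij\cdots}=e^i\wedge e^j\wedge\cdots$ and $\omega^2=\omega\wedge\omega$. An $\mathrm{SU}(3)$-structure on a 6-manifold $N$ is given by a pair $(\omega,\psi_+)\in\Lambda^2(N)\times\Lambda^3(N)$ of differential forms which, at each point, can be written as $\omega=e^{12}+e^{34}+e^{56}$, $\psi_+=e^{135}-e^{146}-e^{236}-e^{245}$ with respect to some local coframe $\{e^1,\ldots,e^6\}$. It induces an almost complex structure $J$ (determined by $\psi_+$) and a 3-form $\psi_-=J\psi_+$, which in such a coframe reads $\psi_-=e^{136}+e^{145}+e^{235}-e^{246}$ (so that $\psi_++i\psi_-=(e^1+ie^2)\wedge(e^3+ie^4)\wedge(e^5+ie^6)$). The $\mathrm{SU}(3)$-structure is nearly Kähler if $d\omega=3\psi_+$ and $d\psi_-=-2\omega^2$. A $G_2$-structure on a 7-manifold $M$ is a 3-form $\varphi$ which at each point can be written as $\varphi=e^{127}+e^{347}+e^{567}+e^{135}-e^{146}-e^{236}-e^{245}$ with respect to some local coframe $\{e^1,\ldots,e^7\}$. It induces a Riemannian metric $g_\varphi$ and a volume form $dV_{g_\varphi}$ by $g_\varphi(X,Y)\,dV_{g_\varphi}=\frac16 i_X\varphi\wedge i_Y\varphi\wedge\varphi$;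 $*$ denotes the corresponding Hodge operator. The $G_2$-structure is locally conformal parallel if $d\varphi=-\theta\wedge\varphi$ and $d{*\varphi}=-\frac43\theta\wedge{*\varphi}$, where the 1-form $\theta$ is its Lee form. The mapping torus $N_\nu$ of a diffeomorphism $\nu$ of $N$ is the quotient of $N\times[0,1]$ in which $(p,0)$ is identified with $(\nu(p),1)$; equivalently, the quotient of $N\times\mathbb{R}$ by the infinite cyclic group generated by the diffeomorphism $(p,t)\mapsto(\nu(p),t+1)$. *)

theory Defs
  imports "HOL-Analysis.Analysis" "HOL-Combinatorics.Permutations"
begin

section \<open>Alternating forms on a vector space\<close>

text \<open>A k-form is a function of a sequence of vectors that only looks at the entries
  0, ..., k - 1 of the sequence, so that equality of forms is equality of functions.
  The degree is an argument of the operations below.\<close>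

type_synonym 'e altform = "(nat \<Rightarrow> 'e) \<Rightarrow> real"

definition alternating_form :: "nat \<Rightarrow> ('e::real_vector) altform \<Rightarrow> bool" where
  "alternating_form k \<alpha> \<longleftrightarrow>
     (\<forall>v w. (\<forall>i<k. v i = w i) \<longrightarrow> \<alpha> v = \<alpha> w) \<and>
     (\<forall>v. \<forall>i<k. linear (\<lambda>x. \<alpha> (v(i := x)))) \<and>
     (\<forall>v i j. i < j \<and> j < k \<and> v i = v j \<longrightarrow> \<alpha> v = 0)"

text \<open>Normalised so that the wedge product of the covectors a and b is
  a(x)b(y) - a(y)b(x).\<close>

definition wedge :: "nat \<Rightarrow> nat \<Rightarrow> 'e altform \<Rightarrow> 'e altform \<Rightarrow> 'e altform" where
  "wedge k l \<alpha> \<beta> = (\<lambda>v. (\<Sum>\<sigma> | \<sigma> permutes {..<k + l}.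
     of_int (sign \<sigma>) * \<alpha> (\<lambda>i. v (\<sigma> i)) * \<beta> (\<lambda>i. v (\<sigma> (k + i)))) / (fact k * fact l))"

definition interior_product :: "'e \<Rightarrow> 'e altform \<Rightarrow> 'e altform" where
  "interior_product X \<alpha> = (\<lambda>v. \<alpha> (case_nat X v))"

definition coframe :: "(nat \<Rightarrow> 'e::euclidean_space \<Rightarrow> real) \<Rightarrow> bool" where
  "coframe e \<longleftrightarrow> (\<forall>i\<in>{1..DIM('e)}. linear (e i)) \<and>
     (\<forall>a. (\<forall>x. (\<Sum>i\<in>{1..DIM('e)}. a i * e i x) = 0) \<longrightarrow> (\<forall>i\<in>{1..DIM('e)}. a i = 0))"

primrec monomial :: "(nat \<Rightarrow> 'e \<Rightarrow> real) \<Rightarrow> nat list \<Rightarrow> 'e altform" where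
  "monomial e [] = (\<lambda>v. 1)"
| "monomial e (i # I) = wedge 1 (length I) (\<lambda>v. e i (v 0)) (monomial e I)"

definition inner_product_on_space :: "('e::real_vector \<Rightarrow> 'e \<Rightarrow> real) \<Rightarrow> bool" where
  "inner_product_on_space g \<longleftrightarrow> (\<forall>x. linear (g x)) \<and> (\<forall>x y. g x y = g y x) \<and>
     (\<forall>x. x \<noteq> 0 \<longrightarrow> g x x > 0)"

definition orthonormal_frame ::
  "('e::euclidean_space \<Rightarrow> 'e \<Rightarrow> real) \<Rightarrow> (nat \<Rightarrow> 'e) \<Rightarrow> bool" where
  "orthonormal_frame g b \<longleftrightarrow>
     (\<forall>i<DIM('e). \<forall>j<DIM('e). g (b i) (b j) = (if i = j then 1 else 0))"

text \<open>The volume form of g, for one of the two orientations.\<close>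

definition metric_volume_form ::
  "('e::euclidean_space \<Rightarrow> 'e \<Rightarrow> real) \<Rightarrow> 'e altform \<Rightarrow> bool" where
  "metric_volume_form g vol \<longleftrightarrow> alternating_form DIM('e) vol \<and>
     (\<forall>b. orthonormal_frame g b \<longrightarrow> \<bar>vol b\<bar> = 1)"

text \<open>The inner product of two k-forms, computed in the orthonormal frame b. The sum is over
  all k-tuples of indices rather than the increasing ones, hence the factor 1 / k!.\<close>

definition form_inner :: "(nat \<Rightarrow> 'e::euclidean_space) \<Rightarrow> nat \<Rightarrow> 'e altform \<Rightarrow> 'e altform \<Rightarrow> real"
  where
  "form_inner b k \<alpha> \<beta> = (\<Sum>I\<in>{..<k} \<rightarrow>\<^sub>E {..<DIM('e)}.
     \<alpha> (\<lambda>i. b (I i)) * \<beta> (\<lambda>i. b (I i))) / fact k"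

definition hodge_star ::
  "('e::euclidean_space \<Rightarrow> 'e \<Rightarrow> real) \<Rightarrow> 'e altform \<Rightarrow> nat \<Rightarrow> 'e altform \<Rightarrow> 'e altform" where
  "hodge_star g vol k \<beta> = (THE \<gamma>. alternating_form (DIM('e) - k) \<gamma> \<and>
     (\<forall>\<alpha> b. alternating_form k \<alpha> \<and> orthonormal_frame g b \<longrightarrow>
        wedge k (DIM('e) - k) \<alpha> \<gamma> = (\<lambda>v. form_inner b k \<alpha> \<beta> * vol v)))"


section \<open>Smooth manifolds\<close>

text \<open>Iterated partial derivatives; meant for open S.\<close>

primrec C_k_on :: "nat \<Rightarrow> 'a::euclidean_space set \<Rightarrow> ('a \<Rightarrow> 'b::real_normed_vector) \<Rightarrow> bool" where
  "C_k_on 0 S f \<longleftrightarrow> continuous_on S f"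
| "C_k_on (Suc k) S f \<longleftrightarrow> (\<forall>x\<in>S. f differentiable (at x)) \<and>
     (\<forall>v. C_k_on k S (\<lambda>x. frechet_derivative f (at x) v))"

definition smooth_on :: "'a::euclidean_space set \<Rightarrow> ('a \<Rightarrow> 'b::real_normed_vector) \<Rightarrow> bool" where
  "smooth_on S f \<longleftrightarrow> (\<forall>k. C_k_on k S f)"

text \<open>A chart is a domain together with a coordinate map, whose values outside the domain are
  irrelevant.\<close>

type_synonym ('a, 'e) chart = "'a set \<times> ('a \<Rightarrow> 'e)"

abbreviation chart_image :: "('a, 'e) chart \<Rightarrow> 'e set" where
  "chart_image c \<equiv> snd c ` fst c"

definition coord_map :: "('a, 'e) chart \<Rightarrow> ('b, 'f) chart \<Rightarrow> ('a \<Rightarrow> 'b) \<Rightarrow> 'e \<Rightarrow> 'f" where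
  "coord_map c c' F = snd c' \<circ> F \<circ> inv_into (fst c) (snd c)"

definition coord_domain :: "('a, 'e) chart \<Rightarrow> ('b, 'f) chart \<Rightarrow> ('a \<Rightarrow> 'b) \<Rightarrow> 'e set" where
  "coord_domain c c' F = snd c ` (fst c \<inter> F -` fst c')"

record ('a, 'e) atlas_space =
  mtop :: "'a topology"
  atlas :: "('a, 'e) chart set"

definition is_chart :: "'a topology \<Rightarrow> ('a, 'e::euclidean_space) chart \<Rightarrow> bool" where
  "is_chart X c \<longleftrightarrow> openin X (fst c) \<and> open (chart_image c) \<and>
     homeomorphic_map (subtopology X (fst c)) (top_of_set (chart_image c)) (snd c)"

text \<open>A smooth manifold of dimension DIM('e), without boundary. The atlas need not be maximal.\<close>

definition smooth_manifold :: "('a, 'e::euclidean_space) atlas_space \<Rightarrow> bool" where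
  "smooth_manifold M \<longleftrightarrow> Hausdorff_space (mtop M) \<and> second_countable (mtop M) \<and>
     (\<forall>c\<in>atlas M. is_chart (mtop M) c) \<and>
     (\<Union>c\<in>atlas M. fst c) = topspace (mtop M) \<and>
     (\<forall>c\<in>atlas M. \<forall>c'\<in>atlas M. smooth_on (coord_domain c c' id) (coord_map c c' id))"

definition smooth_map ::
  "('a, 'e::euclidean_space) atlas_space \<Rightarrow> ('b, 'f::euclidean_space) atlas_space \<Rightarrow> ('a \<Rightarrow> 'b) \<Rightarrow> bool"
  where
  "smooth_map M M' F \<longleftrightarrow> continuous_map (mtop M) (mtop M') F \<and>
     (\<forall>c\<in>atlas M. \<forall>c'\<in>atlas M'. smooth_on (coord_domain c c' F) (coord_map c c' F))"

definition diffeomorphism ::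
  "('a, 'e::euclidean_space) atlas_space \<Rightarrow> ('b, 'f::euclidean_space) atlas_space \<Rightarrow> ('a \<Rightarrow> 'b) \<Rightarrow> bool"
  where
  "diffeomorphism M M' F \<longleftrightarrow> bij_betw F (topspace (mtop M)) (topspace (mtop M')) \<and>
     smooth_map M M' F \<and> smooth_map M' M (inv_into (topspace (mtop M)) F)"


section \<open>Differential forms\<close>

text \<open>A differential form is the family of its coordinate expressions: it assigns to each chart
  of the atlas a field of alternating forms on the image of the chart, such that the coordinate
  expressions are pulled back to each other by the coordinate changes. Values at other pairs of
  the type chart, or outside the chart images, are irrelevant.\<close>

type_synonym ('a, 'e) dform = "('a, 'e) chart \<Rightarrow> 'e \<Rightarrow> 'e altform"

definition pullback_field ::
  "('e::real_normed_vector \<Rightarrow> 'f::real_normed_vector) \<Rightarrow> ('f \<Rightarrow> 'f altform) \<Rightarrow> 'e \<Rightarrow> 'e altform" where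
  "pullback_field h a x = (\<lambda>v. a (h x) (\<lambda>i. frechet_derivative h (at x) (v i)))"

text \<open>The pullback of the form \<open>\<alpha>\<close> on M' by the map F from M to M' is the form \<open>\<beta>\<close> on M.\<close>

definition is_pullback ::
  "('a, 'e::euclidean_space) atlas_space \<Rightarrow> ('b, 'f::euclidean_space) atlas_space \<Rightarrow> ('a \<Rightarrow> 'b) \<Rightarrow>
    ('b, 'f) dform \<Rightarrow> ('a, 'e) dform \<Rightarrow> bool" where
  "is_pullback M M' F \<alpha> \<beta> \<longleftrightarrow> (\<forall>c\<in>atlas M. \<forall>c'\<in>atlas M'. \<forall>x\<in>coord_domain c c' F.
     \<beta> c x = pullback_field (coord_map c c' F) (\<alpha> c') x)"

definition diff_form :: "('a, 'e::euclidean_space) atlas_space \<Rightarrow> nat \<Rightarrow> ('a, 'e) dform \<Rightarrow> bool" where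
  "diff_form M k \<alpha> \<longleftrightarrow>
     (\<forall>c\<in>atlas M. (\<forall>x\<in>chart_image c. alternating_form k (\<alpha> c x)) \<and>
        (\<forall>v. smooth_on (chart_image c) (\<lambda>x. \<alpha> c x v))) \<and>
     is_pullback M M id \<alpha> \<alpha>"

definition dform_eq ::
  "('a, 'e::euclidean_space) atlas_space \<Rightarrow> ('a, 'e) dform \<Rightarrow> ('a, 'e) dform \<Rightarrow> bool" where
  "dform_eq M \<alpha> \<beta> \<longleftrightarrow> (\<forall>c\<in>atlas M. \<forall>x\<in>chart_image c. \<alpha> c x = \<beta> c x)"

definition dform_wedge :: "nat \<Rightarrow> nat \<Rightarrow> ('a, 'e) dform \<Rightarrow> ('a, 'e) dform \<Rightarrow> ('a, 'e) dform" where
  "dform_wedge k l \<alpha> \<beta> = (\<lambda>c x. wedge k l (\<alpha> c x) (\<beta> c x))"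

definition dform_scale :: "real \<Rightarrow> ('a, 'e) dform \<Rightarrow> ('a, 'e) dform" where
  "dform_scale r \<alpha> = (\<lambda>c x v. r * \<alpha> c x v)"

text \<open>The exterior derivative of a k-form: the alternating sum, over i = 0, ..., k, of the
  derivatives in the direction of the i-th vector, evaluated at the sequence of vectors from
  which the i-th one is omitted. No factor 1 / (k + 1), in accordance with the normalisation of
  the wedge product.\<close>

definition ext_deriv :: "nat \<Rightarrow> ('a, 'e::euclidean_space) dform \<Rightarrow> ('a, 'e) dform" where
  "ext_deriv k \<alpha> = (\<lambda>c x v. \<Sum>i\<le>k. (- 1) ^ i *
     frechet_derivative (\<lambda>y. \<alpha> c y (\<lambda>j. if j < i then v j else v (Suc j))) (at x) (v i))"


section \<open>SU(3)-structures\<close>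

definition su3_adapted ::
  "(nat \<Rightarrow> 'e::euclidean_space \<Rightarrow> real) \<Rightarrow> 'e altform \<Rightarrow> 'e altform \<Rightarrow> bool" where
  "su3_adapted e \<omega> \<psi> \<longleftrightarrow> DIM('e) = 6 \<and> coframe e \<and>
     \<omega> = (\<lambda>v. monomial e [1,2] v + monomial e [3,4] v + monomial e [5,6] v) \<and>
     \<psi> = (\<lambda>v. monomial e [1,3,5] v - monomial e [1,4,6] v - monomial e [2,3,6] v
             - monomial e [2,4,5] v)"

definition su3_structure ::
  "('a, 'e::euclidean_space) atlas_space \<Rightarrow> ('a, 'e) dform \<Rightarrow> ('a, 'e) dform \<Rightarrow> bool" where
  "su3_structure N \<omega> \<psi> \<longleftrightarrow> smooth_manifold N \<and> DIM('e) = 6 \<and>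
     diff_form N 2 \<omega> \<and> diff_form N 3 \<psi> \<and>
     (\<forall>c\<in>atlas N. \<forall>x\<in>chart_image c. \<exists>e. su3_adapted e (\<omega> c x) (\<psi> c x))"

text \<open>The almost complex structure J for which \<open>e\<^sup>1 + i e\<^sup>2\<close>, \<open>e\<^sup>3 + i e\<^sup>4\<close>, \<open>e\<^sup>5 + i e\<^sup>6\<close> are
  complex linear. The 3-form \<open>\<psi>\<close> alone determines J only up to sign (complex conjugation in the
  three complex coordinates preserves \<open>\<psi>\<close>); the sign is fixed by the orientation \<open>\<omega>\<^sup>3\<close>, so \<open>\<omega>\<close>
  is an argument as well.\<close>

definition su3_J :: "('e::euclidean_space) altform \<Rightarrow> 'e altform \<Rightarrow> 'e \<Rightarrow> 'e" where
  "su3_J \<omega> \<psi> = (THE J. \<forall>e. su3_adapted e \<omega> \<psi> \<longrightarrow> (\<forall>x.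
     e 1 (J x) = - e 2 x \<and> e 2 (J x) = e 1 x \<and>
     e 3 (J x) = - e 4 x \<and> e 4 (J x) = e 3 x \<and>
     e 5 (J x) = - e 6 x \<and> e 6 (J x) = e 5 x))"

text \<open>\<open>\<psi>\<^sub>- = J \<psi>\<^sub>+\<close>, where J acts on all three arguments. As \<open>\<Psi> = \<psi>\<^sub>+ + i \<psi>\<^sub>-\<close> is complex
  trilinear, applying J to all arguments multiplies \<open>\<Psi>\<close> by \<open>i\<^sup>3 = - i\<close>, and the real part of
  \<open>- i \<Psi>\<close> is \<open>\<psi>\<^sub>-\<close>; so this is the form that reads
  \<open>e\<^sup>1\<^sup>3\<^sup>6 + e\<^sup>1\<^sup>4\<^sup>5 + e\<^sup>2\<^sup>3\<^sup>5 - e\<^sup>2\<^sup>4\<^sup>6\<close> in an adapted coframe.\<close>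

definition psi_minus ::
  "('a, 'e::euclidean_space) dform \<Rightarrow> ('a, 'e) dform \<Rightarrow> ('a, 'e) dform" where
  "psi_minus \<omega> \<psi> = (\<lambda>c x v. \<psi> c x (\<lambda>i. su3_J (\<omega> c x) (\<psi> c x) (v i)))"

definition nearly_kaehler ::
  "('a, 'e::euclidean_space) atlas_space \<Rightarrow> ('a, 'e) dform \<Rightarrow> ('a, 'e) dform \<Rightarrow> bool" where
  "nearly_kaehler N \<omega> \<psi> \<longleftrightarrow> su3_structure N \<omega> \<psi> \<and>
     dform_eq N (ext_deriv 2 \<omega>) (dform_scale 3 \<psi>) \<and>
     dform_eq N (ext_deriv 3 (psi_minus \<omega> \<psi>)) (dform_scale (- 2) (dform_wedge 2 2 \<omega> \<omega>))"


section \<open>\<open>G\<^sub>2\<close>-structures\<close>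

definition g2_adapted :: "(nat \<Rightarrow> 'e::euclidean_space \<Rightarrow> real) \<Rightarrow> 'e altform \<Rightarrow> bool" where
  "g2_adapted e \<phi> \<longleftrightarrow> DIM('e) = 7 \<and> coframe e \<and>
     \<phi> = (\<lambda>v. monomial e [1,2,7] v + monomial e [3,4,7] v + monomial e [5,6,7] v
             + monomial e [1,3,5] v - monomial e [1,4,6] v - monomial e [2,3,6] v
             - monomial e [2,4,5] v)"

definition g2_structure :: "('a, 'e::euclidean_space) atlas_space \<Rightarrow> ('a, 'e) dform \<Rightarrow> bool" where
  "g2_structure M \<phi> \<longleftrightarrow> smooth_manifold M \<and> DIM('e) = 7 \<and> diff_form M 3 \<phi> \<and>
     (\<forall>c\<in>atlas M. \<forall>x\<in>chart_image c. \<exists>e. g2_adapted e (\<phi> c x))"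

text \<open>The metric and the volume form (and with it the orientation) induced by \<open>\<phi>\<close> at a point.\<close>

definition g2_compatible ::
  "('e::euclidean_space) altform \<Rightarrow> ('e \<Rightarrow> 'e \<Rightarrow> real) \<Rightarrow> 'e altform \<Rightarrow> bool" where
  "g2_compatible \<phi> g vol \<longleftrightarrow> inner_product_on_space g \<and> metric_volume_form g vol \<and>
     (\<forall>X Y. (\<lambda>v. g X Y * vol v) = (\<lambda>v. 1 / 6 *
        wedge 4 3 (wedge 2 2 (interior_product X \<phi>) (interior_product Y \<phi>)) \<phi> v))"

definition g2_metric :: "('e::euclidean_space) altform \<Rightarrow> 'e \<Rightarrow> 'e \<Rightarrow> real" where
  "g2_metric \<phi> = (THE g. \<exists>vol. g2_compatible \<phi> g vol)"

definition g2_volume :: "('e::euclidean_space) altform \<Rightarrow> 'e altform" where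
  "g2_volume \<phi> = (THE vol. \<exists>g. g2_compatible \<phi> g vol)"

definition g2_star ::
  "('a, 'e::euclidean_space) dform \<Rightarrow> nat \<Rightarrow> ('a, 'e) dform \<Rightarrow> ('a, 'e) dform" where
  "g2_star \<phi> k \<beta> = (\<lambda>c x. hodge_star (g2_metric (\<phi> c x)) (g2_volume (\<phi> c x)) k (\<beta> c x))"

definition locally_conformal_parallel ::
  "('a, 'e::euclidean_space) atlas_space \<Rightarrow> ('a, 'e) dform \<Rightarrow> bool" where
  "locally_conformal_parallel M \<phi> \<longleftrightarrow> g2_structure M \<phi> \<and> (\<exists>\<theta>. diff_form M 1 \<theta> \<and>
     dform_eq M (ext_deriv 3 \<phi>) (dform_scale (- 1) (dform_wedge 1 3 \<theta> \<phi>)) \<and>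
     dform_eq M (ext_deriv 4 (g2_star \<phi> 3 \<phi>))
       (dform_scale (- (4 / 3)) (dform_wedge 1 4 \<theta> (g2_star \<phi> 3 \<phi>))))"


section \<open>The mapping torus\<close>

definition quotient_topology_by :: "'a topology \<Rightarrow> ('a \<Rightarrow> 'b) \<Rightarrow> 'b topology" where
  "quotient_topology_by X q =
     topology (\<lambda>U. U \<subseteq> q ` topspace X \<and> openin X {x \<in> topspace X. q x \<in> U})"

lemma openin_quotient_topology_by:
  "openin (quotient_topology_by X q) U \<longleftrightarrow>
     U \<subseteq> q ` topspace X \<and> openin X {x \<in> topspace X. q x \<in> U}"
proof -
  have "istopology (\<lambda>U. U \<subseteq> q ` topspace X \<and> openin X {x \<in> topspace X. q x \<in> U})"
    unfolding istopology_def
  proof (intro conjI allI impI)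
    fix S T
    assume "S \<subseteq> q ` topspace X \<and> openin X {x \<in> topspace X. q x \<in> S}"
      and "T \<subseteq> q ` topspace X \<and> openin X {x \<in> topspace X. q x \<in> T}"
    moreover have "{x \<in> topspace X. q x \<in> S \<inter> T} =
        {x \<in> topspace X. q x \<in> S} \<inter> {x \<in> topspace X. q x \<in> T}"
      by auto
    ultimately show "S \<inter> T \<subseteq> q ` topspace X" "openin X {x \<in> topspace X. q x \<in> S \<inter> T}"
      by auto
  next
    fix K
    assume K: "\<forall>S\<in>K. S \<subseteq> q ` topspace X \<and> openin X {x \<in> topspace X. q x \<in> S}"
    then show "\<Union> K \<subseteq> q ` topspace X" by blast
    have "{x \<in> topspace X. q x \<in> \<Union> K} = (\<Union>S\<in>K. {x \<in> topspace X. q x \<in> S})"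
      by auto
    with K show "openin X {x \<in> topspace X. q x \<in> \<Union> K}"
      by auto
  qed
  then show ?thesis
    by (simp add: quotient_topology_by_def topology_inverse')
qed

lemma quotient_map_quotient_topology_by: "quotient_map X (quotient_topology_by X q) q"
proof -
  have "{x \<in> topspace X. q x \<in> q ` topspace X} = topspace X"
    by auto
  then have "openin (quotient_topology_by X q) (q ` topspace X)"
    by (simp add: openin_quotient_topology_by)
  then have "topspace (quotient_topology_by X q) = q ` topspace X"
    by (metis openin_quotient_topology_by openin_subset openin_topspace subset_antisym)
  then show ?thesis
    by (auto simp: quotient_map_def openin_quotient_topology_by)
qed

text \<open>The orbit of (p, t) in \<open>N \<times> \<real>\<close> under the group generated by
  \<open>(p, t) \<mapsto> (\<nu> p, t + 1)\<close>.\<close>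

definition torus_class ::
  "('a, 'e) atlas_space \<Rightarrow> ('a \<Rightarrow> 'a) \<Rightarrow> 'a \<times> real \<Rightarrow> ('a \<times> real) set" where
  "torus_class N \<nu> = (\<lambda>(p, t). {(q, s). q \<in> topspace (mtop N) \<and>
     (\<exists>n. q = (\<nu> ^^ n) p \<and> s = t + real n \<or> p = (\<nu> ^^ n) q \<and> t = s + real n)})"

text \<open>A chart c of N and an open interval of length 1 give a chart of the mapping torus: its
  domain is the image of \<open>U \<times> (a, a + 1)\<close>, with U the domain of c, and it sends the class of
  (p, t) in \<open>U \<times> (a, a + 1)\<close> to (c(p), t). Each class has at most one such representative. These
  charts define the smooth structure for which the projection from \<open>N \<times> \<real>\<close> is a local
  diffeomorphism.\<close>

definition torus_chart ::
  "('a, 'e) atlas_space \<Rightarrow> ('a \<Rightarrow> 'a) \<Rightarrow> ('a, 'e) chart \<Rightarrow> real \<Rightarrow> (('a \<times> real) set, 'e \<times> real) chart"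
  where
  "torus_chart N \<nu> c a = (torus_class N \<nu> ` (fst c \<times> {a<..<a + 1}),
     \<lambda>A. let (p, t) = (THE y. y \<in> A \<and> y \<in> fst c \<times> {a<..<a + 1}) in (snd c p, t))"

definition mapping_torus ::
  "('a, 'e) atlas_space \<Rightarrow> ('a \<Rightarrow> 'a) \<Rightarrow> (('a \<times> real) set, 'e \<times> real) atlas_space" where
  "mapping_torus N \<nu> =
     \<lparr> mtop = quotient_topology_by (prod_topology (mtop N) euclideanreal) (torus_class N \<nu>),
       atlas = {torus_chart N \<nu> c a | c a. c \<in> atlas N} \<rparr>"

end

theory Submission
  imports Defs
begin

text \<open>The \<open>G\<^sub>2\<close>-structure is the one of the Riemannian cylinder. On
  \<open>N \<times> \<real>\<close>, with coordinate \<open>t\<close> on the second factor, put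
  \<open>\<phi> = \<psi>\<^sub>+ + \<omega> \<and> dt\<close> and \<open>\<theta> = 3 dt\<close>
  (here \<open>\<and>\<close> is the wedge product). If \<open>e\<close> is a coframe adapted to
  \<open>(\<omega>, \<psi>\<^sub>+)\<close>, then \<open>e\<close> together with
  \<open>e\<^sup>7 = dt\<close> is adapted to \<open>\<phi>\<close>, and
  \<open>*\<phi> = \<omega>\<^sup>2 / 2 + \<psi>\<^sub>- \<and> dt\<close>. Now
  \<open>d\<psi>\<^sub>+ = dd\<omega> / 3 = 0\<close>, hence
  \<open>d\<phi> = d\<omega> \<and> dt = 3 \<psi>\<^sub>+ \<and> dt = - \<theta> \<and> \<phi>\<close>.
  Since \<open>\<omega> \<and> \<psi>\<^sub>+ = 0\<close>, moreover
  \<open>d*\<phi> = 3 \<omega> \<and> \<psi>\<^sub>+ + d\<psi>\<^sub>- \<and> dt = - 2 \<omega>\<^sup>2 \<and> dt = - 4/3 \<theta> \<and> *\<phi>\<close>.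
  So the cylinder is locally conformal parallel; this is lemma
  cylinder_locally_conformal_parallel.

  These forms descend to the mapping torus as soon as they are invariant under the deck
  transformation \<open>(p, t) \<mapsto> (\<nu> p, t + 1)\<close>. For \<open>dt\<close> and
  \<open>\<omega>\<close> this is clear, and for \<open>\<psi>\<^sub>+\<close> it follows from
  \<open>\<nu>\<^sup>* \<omega> = \<omega>\<close>, because
  \<open>\<psi>\<^sub>+ = d\<omega> / 3\<close> (lemma nearly_kaehler_pullback_psi). In the
  charts of the mapping torus, whose coordinate changes have the form
  \<open>(x, t) \<mapsto> (\<nu>\<^sup>n x, t + n)\<close> with a locally constant integer
  \<open>n\<close> (lemma torus_transition), \<open>\<phi>\<close> and \<open>\<theta>\<close>
  are therefore given by the cylinder formulas throughout.

  Three points take more than this calculation. First, the metric, the volume form, the Hodge star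
  and \<open>J\<close> are definite descriptions, so that uniqueness has to be proved along with
  existence. For the metric, \<open>g vol\<close> is determined by \<open>\<phi>\<close>, and
  the rescalings \<open>(g / c, c vol)\<close> are excluded by the norm of the volume form
  (g2_metric_volume); the star is unique because the wedge product is a nondegenerate pairing
  (g2_hodge_star); and \<open>J\<close> is determined by
  \<open>\<xi> \<and> i\<^sub>X \<psi>\<^sub>+ \<and> \<psi>\<^sub>+ = - 2 \<xi>(J X) \<omega>\<^sup>3 / 6\<close>
  for all covectors \<open>\<xi>\<close> (su3_J_identity). Second, adapted coframes are only
  given pointwise, without any continuity; that \<open>\<psi>\<^sub>-\<close> is differentiable
  all the same is read off from the same identity (psi_minus_differentiable). Third, that
  \<open>d\<close> squares to zero on \<open>\<omega>\<close> and commutes with pullbacks of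
  2-forms is the symmetry of second derivatives (second_derivative_symmetric).

  The pointwise identities are checked on the dual frame of an adapted coframe. A wedge product
  evaluated there is expanded by the Leibniz rule for interior products
  (interior_product_wedge), which produces one summand for each shuffle instead of one for each
  permutation.\<close>

section \<open>Alternating forms and their wedge products\<close>

lemma alternating_form_cong:
  assumes "alternating_form k \<alpha>" "\<And>i. i < k \<Longrightarrow> v i = w i"
  shows "\<alpha> v = \<alpha> w"
  using assms unfolding alternating_form_def by blast

lemma alternating_form_linear:
  assumes "alternating_form k \<alpha>" "i < k"
  shows "linear (\<lambda>x. \<alpha> (v(i := x)))"
  using assms unfolding alternating_form_def by blast

lemma alternating_form_repeat:
  assumes "alternating_form k \<alpha>" "i < k" "j < k" "i \<noteq> j" "v i = v j"
  shows "\<alpha> v = 0"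
proof (cases "i < j")
  case True
  then show ?thesis using assms unfolding alternating_form_def by blast
next
  case False
  then have "j < i" using assms by simp
  then show ?thesis using assms unfolding alternating_form_def by metis
qed

text \<open>Polarisation of the vanishing of \<open>\<alpha>\<close> on sequences with
  \<open>v i + v j\<close> in both of the places \<open>i\<close> and \<open>j\<close>.\<close>

lemma alternating_form_transpose:
  assumes a: "alternating_form k \<alpha>" and ij: "i < k" "j < k" "i \<noteq> j"
  shows "\<alpha> (\<lambda>m. v (Transposition.transpose i j m)) = - \<alpha> v"
proof -
  have add: "\<alpha> (u(m := x + y)) = \<alpha> (u(m := x)) + \<alpha> (u(m := y))" if "m < k" for u m x y
    using linear_add[OF alternating_form_linear[OF a that]] by blast
  have zero: "\<alpha> (v(i := x, j := x)) = 0" for x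
    by (rule alternating_form_repeat[OF a ij]) (use ij in auto)
  let ?u = "\<lambda>x y. v(i := x, j := y)"
  have addi: "\<alpha> (?u (x + x') y) = \<alpha> (?u x y) + \<alpha> (?u x' y)" for x x' y
    using add[OF ij(1), of "v(j := y)" x x'] ij by (simp add: fun_upd_twist)
  have addj: "\<alpha> (?u x (y + y')) = \<alpha> (?u x y) + \<alpha> (?u x y')" for x y y'
    by (rule add[OF ij(2)])
  have "\<alpha> (?u (v i) (v i)) + \<alpha> (?u (v i) (v j)) + (\<alpha> (?u (v j) (v i)) + \<alpha> (?u (v j) (v j)))
      = \<alpha> (?u (v i + v j) (v i + v j))"
    by (simp only: addi addj)
  moreover have "?u (v i) (v j) = v" by simp
  ultimately have "\<alpha> (v(i := v j, j := v i)) = - \<alpha> v"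
    unfolding zero by simp
  moreover have "(\<lambda>m. v (Transposition.transpose i j m)) = v(i := v j, j := v i)"
    by (auto simp: fun_eq_iff Transposition.transpose_def)
  ultimately show ?thesis by simp
qed

lemma alternating_form_permute:
  assumes a: "alternating_form k \<alpha>" and s: "\<sigma> permutes {..<k}"
  shows "\<alpha> (\<lambda>i. v (\<sigma> i)) = of_int (sign \<sigma>) * \<alpha> v"
  using finite_lessThan s
proof (induction rule: permutes_rev_induct)
  case id
  then show ?case by simp
next
  case (swap i j p)
  have "\<alpha> (\<lambda>m. v ((p \<circ> Transposition.transpose i j) m)) = - \<alpha> (\<lambda>m. v (p m))"
    using alternating_form_transpose[OF a, of i j "\<lambda>m. v (p m)"] swap by simp
  moreover have "sign (p \<circ> Transposition.transpose i j) = - sign p"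
    using swap permutes_imp_permutation[of "{..<k}" p]
    by (simp add: sign_compose sign_swap_id permutation_swap_id)
  ultimately show ?case using swap by (simp add: o_def)
qed

lemma permutes_lessThan:
  assumes "\<sigma> permutes {..<n}" "i < n"
  shows "\<sigma> i < n"
  using assms permutes_in_image[of \<sigma> "{..<n}" i] by simp

lemma alternating_form_wedge:
  assumes a: "alternating_form k \<alpha>" and b: "alternating_form l \<beta>"
  shows "alternating_form (k + l) (wedge k l \<alpha> \<beta>)"
  unfolding alternating_form_def
proof (intro conjI allI impI)
  fix v w :: "nat \<Rightarrow> 'a"
  assume vw: "\<forall>i<k + l. v i = w i"
  have "v (\<sigma> i) = w (\<sigma> i)" if "\<sigma> permutes {..<k + l}" "i < k + l" for \<sigma> i
    using vw permutes_lessThan[OF that] by blast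
  then have "\<alpha> (\<lambda>i. v (\<sigma> i)) = \<alpha> (\<lambda>i. w (\<sigma> i))"
    and "\<beta> (\<lambda>i. v (\<sigma> (k + i))) = \<beta> (\<lambda>i. w (\<sigma> (k + i)))" if "\<sigma> permutes {..<k + l}" for \<sigma>
    using that by (auto intro!: alternating_form_cong[OF a] alternating_form_cong[OF b])
  then show "wedge k l \<alpha> \<beta> v = wedge k l \<alpha> \<beta> w"
    unfolding wedge_def by (intro arg_cong[where f = "\<lambda>x. x / _"] sum.cong) auto
next
  fix v :: "nat \<Rightarrow> 'a" and p assume p: "p < k + l"
  \<comment> \<open>Multilinearity holds for each summand: the vector in place \<open>p\<close>
    is an argument of just one of the two factors, namely the one that contains the place
    \<open>inv \<sigma> p\<close>.\<close>
  have trm: "linear (\<lambda>x. of_int (sign \<sigma>) * \<alpha> (\<lambda>i. (v(p := x)) (\<sigma> i)) * \<beta> (\<lambda>i. (v(p :=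
        x)) (\<sigma> (k + i))))"
    if s: "\<sigma> permutes {..<k + l}" for \<sigma>
  proof -
    define q where "q = inv \<sigma> p"
    have q: "\<sigma> i = p \<longleftrightarrow> i = q" for i
      using s by (auto simp: q_def permutes_inverses)
    have ql: "q < k + l"
      using permutes_lessThan[OF permutes_inv[OF s] p] by (simp add: q_def)
    show ?thesis
    proof (cases "q < k")
      case True
      have "(\<lambda>i. (v(p := x)) (\<sigma> i)) = (\<lambda>i. v (\<sigma> i))(q := x)" for x
        by (auto simp: fun_eq_iff q)
      moreover have "(\<lambda>i. (v(p := x)) (\<sigma> (k + i))) = (\<lambda>i. v (\<sigma> (k + i)))" for x
        using True by (auto simp: fun_eq_iff q)
      ultimately show ?thesis
        using linear_compose[OF alternating_form_linear[OF a True, of "\<lambda>i. v (\<sigma> i)"],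
            of "\<lambda>y. of_int (sign \<sigma>) * y * \<beta> (\<lambda>i. v (\<sigma> (k + i)))"]
        by (simp add: o_def linear_iff algebra_simps)
    next
      case False
      have "\<beta> (\<lambda>i. (v(p := x)) (\<sigma> (k + i))) = \<beta> ((\<lambda>i. v (\<sigma> (k + i)))(q - k := x))" for x
        using False by (intro arg_cong[where f = \<beta>]) (auto simp: fun_eq_iff q)
      moreover have "\<alpha> (\<lambda>i. (v(p := x)) (\<sigma> i)) = \<alpha> (\<lambda>i. v (\<sigma> i))" for x
        using False by (intro alternating_form_cong[OF a]) (auto simp: q)
      moreover have "q - k < l" using False ql by simp
      ultimately show ?thesis
        using linear_compose[OF alternating_form_linear[OF b, of "q - k" "\<lambda>i. v (\<sigma> (k + i))"],
            of "\<lambda>y. of_int (sign \<sigma>) * \<alpha> (\<lambda>i. v (\<sigma> i)) * y"]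
        by (simp add: o_def linear_iff algebra_simps)
    qed
  qed
  have "linear (\<lambda>x. (1 / (fact k * fact l)) *\<^sub>R (\<Sum>\<sigma> | \<sigma> permutes {..<k + l}.
      of_int (sign \<sigma>) * \<alpha> (\<lambda>i. (v(p := x)) (\<sigma> i)) * \<beta> (\<lambda>i. (v(p := x)) (\<sigma> (k + i)))) :: real)"
    by (intro linear_compose_scale_right linear_compose_sum ballI trm) simp
  then show "linear (\<lambda>x. wedge k l \<alpha> \<beta> (v(p := x)))"
    by (simp add: wedge_def)
next
  fix v :: "nat \<Rightarrow> 'a" and i j assume ij: "i < j \<and> j < k + l \<and> v i = v j"
  \<comment> \<open>Alternation needs the whole sum: composition with the transposition of two
    equal vectors is a bijection of the permutations that changes the sign of every
    summand.\<close>
  define f where "f \<sigma> = of_int (sign \<sigma>) * \<alpha> (\<lambda>i. v (\<sigma> i)) * \<beta> (\<lambda>i. v (\<sigma> (k + i)))"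
        for \<sigma>
  have t: "Transposition.transpose i j permutes {..<k + l}"
    using ij by (intro permutes_swap_id) auto
  have "v (Transposition.transpose i j m) = v m" for m
    using ij by (auto simp: Transposition.transpose_def)
  then have "f (Transposition.transpose i j \<circ> \<sigma>) = - f \<sigma>" if "\<sigma> permutes {..<k + l}" for \<sigma>
    using that ij permutes_imp_permutation[OF _ that]
    by (simp add: f_def sign_compose sign_swap_id permutation_swap_id)
  then have "sum f {\<sigma>. \<sigma> permutes {..<k + l}} = - sum f {\<sigma>. \<sigma> permutes {..<k + l}}"
    using setum_permutations_compose_left[OF t, of f] by (simp add: sum_negf)
  then show "wedge k l \<alpha> \<beta> v = 0"
    by (simp add: wedge_def f_def)
qed

lemma alternating_form_interior_product:
  assumes a: "alternating_form (Suc k) \<alpha>"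
  shows "alternating_form k (interior_product X \<alpha>)"
  unfolding alternating_form_def interior_product_def
proof (intro conjI allI impI)
  fix v w :: "nat \<Rightarrow> 'a"
  assume "\<forall>i<k. v i = w i"
  then show "\<alpha> (case_nat X v) = \<alpha> (case_nat X w)"
    by (intro alternating_form_cong[OF a]) (auto split: nat.split)
next
  fix v :: "nat \<Rightarrow> 'a" and i assume "i < k"
  moreover have "case_nat X (v(i := x)) = (case_nat X v)(Suc i := x)" for x
    by (auto simp: fun_eq_iff split: nat.split)
  ultimately show "linear (\<lambda>x. \<alpha> (case_nat X (v(i := x))))"
    using alternating_form_linear[OF a, of "Suc i"] by simp
next
  fix v :: "nat \<Rightarrow> 'a" and i j assume "i < j \<and> j < k \<and> v i = v j"
  then show "\<alpha> (case_nat X v) = 0"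
    by (intro alternating_form_repeat[OF a, of "Suc i" "Suc j"]) auto
qed

lemma interior_product_linear:
  assumes a: "alternating_form (Suc k) \<alpha>"
  shows "linear (\<lambda>x. interior_product x \<alpha> v)"
proof -
  have "case_nat x v = (case_nat x v)(0 := x)" "(case_nat x v)(0 := y) = case_nat y v" for x y
    by (auto simp: fun_eq_iff split: nat.split)
  then show ?thesis
    using alternating_form_linear[OF a, of 0 "case_nat 0 v"] by (simp add: interior_product_def)
qed

text \<open>The cycle that moves \<open>k\<close> to the front. Composing it with the
  permutations that fix 0 gives the permutations \<open>\<sigma>\<close> with
  \<open>\<sigma> k = 0\<close>, and its sign is the sign in the Leibniz rule for interior
  products.\<close>

definition cycle_down :: "nat \<Rightarrow> nat \<Rightarrow> nat" where
  "cycle_down k i = (if i < k then Suc i else if i = k then 0 else i)"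

lemma cycle_down: "cycle_down k permutes {..k} \<and> sign (cycle_down k) = (- 1) ^ k"
proof (induction k)
  case 0
  have "cycle_down 0 = id" by (rule ext) (simp add: cycle_down_def)
  then show ?case by (simp add: id_def)
next
  case (Suc k)
  have eq: "cycle_down (Suc k) = cycle_down k \<circ> Transposition.transpose k (Suc k)"
    by (auto simp: fun_eq_iff cycle_down_def Transposition.transpose_def)
  have p: "cycle_down k permutes {..Suc k}"
    using Suc permutes_subset[of "cycle_down k" "{..k}"] by auto
  moreover have t: "Transposition.transpose k (Suc k) permutes {..Suc k}"
    by (intro permutes_swap_id) auto
  ultimately show ?case
    using Suc permutes_compose[OF t p] permutes_imp_permutation[OF _ p]
    by (simp add: eq sign_compose sign_swap_id permutation_swap_id del: comp_apply flip: comp_def)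
qed

text \<open>This turns the summands of a wedge product that keep the first vector in front into
  the sum that defines a wedge product of one degree less.\<close>

lemma permutes_fixing_0:
  "bij_betw (\<lambda>\<tau>. case_nat 0 (\<lambda>i. Suc (\<tau> i))) {\<tau>. \<tau> permutes {..<m}}
     {\<sigma>. \<sigma> permutes {..<Suc m} \<and> \<sigma> 0 = 0}"
  (is "bij_betw ?F ?A ?B")
proof -
  have ins: "\<sigma> permutes Suc ` {..<m} \<longleftrightarrow> \<sigma> permutes {..<Suc m} \<and> \<sigma> 0 = 0" for \<sigma>
  proof
    assume "\<sigma> permutes Suc ` {..<m}"
    then show "\<sigma> permutes {..<Suc m} \<and> \<sigma> 0 = 0"
      using permutes_subset[of \<sigma> "Suc ` {..<m}" "{..<Suc m}"] permutes_not_in[of \<sigma> "Suc ` {..<m}" 0]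
      by auto
  next
    assume "\<sigma> permutes {..<Suc m} \<and> \<sigma> 0 = 0"
    then show "\<sigma> permutes Suc ` {..<m}"
      using permutes_superset[of \<sigma> "{..<Suc m}" "Suc ` {..<m}"]
      unfolding lessThan_Suc_eq_insert_0 by blast
  qed
  have F: "?F \<tau> = (\<lambda>x. if x \<in> Suc ` {..<m} then Suc (\<tau> (inv_into {..<m} Suc x)) else x)"
    if "\<tau> \<in> ?A" for \<tau>
  proof
    fix x
    show "?F \<tau> x = (if x \<in> Suc ` {..<m} then Suc (\<tau> (inv_into {..<m} Suc x)) else x)"
      using that permutes_not_in[of \<tau> "{..<m}" "x - 1"]
      by (cases x) (auto simp: inv_into_f_f)
  qed
  have "bij_betw Suc {..<m} (Suc ` {..<m})" by (simp add: bij_betw_def)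
  from bij_betw_permutations[OF this]
  have "bij_betw (\<lambda>\<tau> x. if x \<in> Suc ` {..<m} then Suc (\<tau> (inv_into {..<m} Suc x)) else x) ?A ?B"
    unfolding ins .
  then show ?thesis
    by (subst bij_betw_cong[OF F])
qed

lemma sign_fixing_0:
  assumes "\<tau> permutes {..<m}"
  shows "sign (case_nat 0 (\<lambda>i. Suc (\<tau> i))) = sign \<tau>"
proof -
  have "map_permutation {..<m} Suc \<tau> = case_nat 0 (\<lambda>i. Suc (\<tau> i))"
    using permutes_not_in[OF assms]
    by (force simp: fun_eq_iff map_permutation_def restrict_id_def split: nat.split)
  then show ?thesis
    using sign_map_permutation[of Suc "{..<m}" \<tau>] assms by simp
qed

text \<open>The Leibniz rule
  \<open>i\<^sub>X (\<alpha> \<and> \<beta>) = i\<^sub>X \<alpha> \<and> \<beta> + (-1)\<^sup>k \<alpha> \<and> i\<^sub>X \<beta>\<close>.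
  Applied repeatedly it evaluates a wedge product on explicit vectors as a sum over shuffles: 35
  terms for factors of degrees 4 and 3, in place of the 7! permutations of the
  definition.\<close>

lemma interior_product_wedge:
  assumes a: "alternating_form k \<alpha>" and b: "alternating_form l \<beta>"
    and kl: "k + l > 0"
  shows "wedge k l \<alpha> \<beta> (case_nat X v) =
    (if k = 0 then 0 else wedge (k - 1) l (interior_product X \<alpha>) \<beta> v) +
    (if l = 0 then 0 else (- 1) ^ k * wedge k (l - 1) \<alpha> (interior_product X \<beta>) v)"
    (is "_ = ?A + ?B")
proof -
  define V where "V = case_nat X v"
  define m where "m = k + l - 1"
  have m: "k + l = Suc m" using kl by (simp add: m_def)
  define f where "f \<sigma> = of_int (sign \<sigma>) * \<alpha> (\<lambda>i. V (\<sigma> i)) * \<beta> (\<lambda>i. V (\<sigma> (k + i)))"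
        for \<sigma>
  \<comment> \<open>The permutations are sorted by the place \<open>j\<close> that receives
    \<open>X\<close>. All places in the first factor contribute the same amount, and so do all
    places in the second one; the multiplicities \<open>k\<close> and \<open>l\<close> turn the
    factorials into those of the lower degrees.\<close>
  define P where "P j = {\<sigma>. \<sigma> permutes {..<k + l} \<and> \<sigma> j = 0}" for j
  define up where "up \<tau> = case_nat 0 (\<lambda>i. Suc (\<tau> i))" for \<tau> :: "nat \<Rightarrow> nat"
  have fin: "finite {\<sigma>. \<sigma> permutes {..<k + l}}"
    by (simp add: finite_permutations)
  have split: "sum f {\<sigma>. \<sigma> permutes {..<k + l}} = (\<Sum>j<k + l. sum f (P j))"
  proof -
    have U: "{\<sigma>. \<sigma> permutes {..<k + l}} = (\<Union>j<k + l. P j)"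
    proof (intro equalityI subsetI)
      fix \<sigma> assume s: "\<sigma> \<in> {\<sigma>. \<sigma> permutes {..<k + l}}"
      then have "inv \<sigma> 0 < k + l" "\<sigma> (inv \<sigma> 0) = 0"
        using permutes_lessThan[OF permutes_inv, of \<sigma> "k + l" 0] kl by (auto simp: permutes_inverses)
      then show "\<sigma> \<in> (\<Union>j<k + l. P j)" using s by (auto simp: P_def)
    qed (auto simp: P_def)
    have D: "P i \<inter> P j = {}" if "i \<noteq> j" for i j
    proof -
      have "i = j" if "\<sigma> permutes {..<k + l}" "\<sigma> i = 0" "\<sigma> j = 0" for \<sigma>
        using permutes_inj[OF that(1)] that(2,3) by (metis injD)
      then show ?thesis using that by (auto simp: P_def)
    qed
    have "finite (P j)" for j
      by (rule finite_subset[OF _ fin]) (auto simp: P_def)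
    then show ?thesis
      unfolding U by (intro sum.UNION_disjoint) (use D in auto)
  qed
  have reindex: "sum f (P j) = (\<Sum>\<sigma>\<in>P i. f (\<sigma> \<circ> q))"
    if q: "q permutes {..<k + l}" "q j = i" for i j q
  proof -
    have "bij_betw (\<lambda>\<sigma>. \<sigma> \<circ> q) (P i) (P j)"
    proof (rule bij_betw_byWitness[of _ "\<lambda>\<sigma>. \<sigma> \<circ> inv q"])
      have qi: "inv q permutes {..<k + l}" "inv q i = j"
        using permutes_inv[OF q(1)] permutes_inverses(2)[OF q(1), of j] q(2) by auto
      show "(\<lambda>\<sigma>. \<sigma> \<circ> q) ` P i \<subseteq> P j"
        using q(2) permutes_compose[OF q(1)] by (auto simp: P_def)
      show "(\<lambda>\<sigma>. \<sigma> \<circ> inv q) ` P j \<subseteq> P i"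
        using qi(2) permutes_compose[OF qi(1)] by (auto simp: P_def)
      show "\<forall>\<sigma>\<in>P i. \<sigma> \<circ> q \<circ> inv q = \<sigma>" "\<forall>\<sigma>\<in>P j. \<sigma> \<circ> inv q
            \<circ> q = \<sigma>"
        using permutes_inv_o[OF q(1)] by (simp_all add: comp_assoc)
    qed
    from sum.reindex_bij_betw[OF this, of f] show ?thesis by simp
  qed
  have tr: "Transposition.transpose i j permutes {..<k + l}" if "i < k + l" "j < k + l" for i j
    using that by (intro permutes_swap_id) auto
  have perm: "permutation \<sigma>" if "\<sigma> permutes {..<k + l}" for \<sigma>
    using that permutes_imp_permutation by blast
  have A1: "sum f (P j) = sum f (P 0)" if j: "j < k" for j
  proof (cases "j = 0")
    case False
    have "f (\<sigma> \<circ> Transposition.transpose 0 j) = f \<sigma>" if s: "\<sigma> \<in> P 0" for \<sigma>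
    proof -
      have "\<alpha> (\<lambda>i. V (\<sigma> (Transposition.transpose 0 j i))) = - \<alpha> (\<lambda>i. V (\<sigma> i))"
        using alternating_form_transpose[OF a, of 0 j "\<lambda>i. V (\<sigma> i)"] j False by simp
      moreover have "Transposition.transpose 0 j (k + i) = k + i" for i
        using j by (simp add: Transposition.transpose_def)
      moreover have "sign (\<sigma> \<circ> Transposition.transpose 0 j) = - sign \<sigma>"
        using False s perm[of \<sigma>]
        by (simp add: sign_compose sign_swap_id permutation_swap_id P_def)
      ultimately show ?thesis by (simp add: f_def)
    qed
    then show ?thesis
      using reindex[OF tr, of 0 j j 0] j by simp
  qed simp
  have B1: "sum f (P j) = sum f (P k)" if j: "k \<le> j" "j < k + l" for j
  proof (cases "j = k")
    case False
    have "f (\<sigma> \<circ> Transposition.transpose k j) = f \<sigma>" if s: "\<sigma> \<in> P k" for \<sigma>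
    proof -
      have "\<beta> (\<lambda>i. V (\<sigma> (k + Transposition.transpose 0 (j - k) i))) = - \<beta> (\<lambda>i. V (\<sigma> (k + i)))"
        using alternating_form_transpose[OF b, of 0 "j - k" "\<lambda>i. V (\<sigma> (k + i))"] j False by simp
      moreover have "k + Transposition.transpose 0 (j - k) i = Transposition.transpose k j (k + i)" for i
        using j by (auto simp: Transposition.transpose_def)
      moreover have "\<alpha> (\<lambda>i. V (\<sigma> (Transposition.transpose k j i))) = \<alpha> (\<lambda>i. V (\<sigma> i))"
        by (rule alternating_form_cong[OF a]) (use j in \<open>auto simp: Transposition.transpose_def\<close>)
      moreover have "sign (\<sigma> \<circ> Transposition.transpose k j) = - sign \<sigma>"
        using False s perm[of \<sigma>]
        by (simp add: sign_compose sign_swap_id permutation_swap_id P_def)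
      ultimately show ?thesis by (simp add: f_def)
    qed
    then show ?thesis
      using reindex[OF tr, of k j j k] j by simp
  qed simp
  have up: "sum g (P 0) = (\<Sum>\<tau> | \<tau> permutes {..<m}. g (up \<tau>))" for g :: "(nat \<Rightarrow> nat) \<Rightarrow> real"
    using sum.reindex_bij_betw[OF permutes_fixing_0[of m], of g] by (simp add: P_def m up_def)
  have sgn: "sign (up \<tau>) = sign \<tau>" if "\<tau> permutes {..<m}" for \<tau>
    using sign_fixing_0[OF that] by (simp add: up_def)
  have A2: "real k * sum f (P 0) / (fact k * fact l) = ?A"
  proof (cases k)
    case (Suc k')
    have "f (up \<tau>) = of_int (sign \<tau>) * interior_product X \<alpha> (\<lambda>i. v (\<tau> i)) * \<beta> (\<lambda>i. v (\<tau> (k' + i)))"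
      if "\<tau> permutes {..<m}" for \<tau>
    proof -
      have "(\<lambda>i. V (up \<tau> i)) = case_nat X (\<lambda>i. v (\<tau> i))"
        by (auto simp: V_def up_def fun_eq_iff split: nat.split)
      then show ?thesis
        using sgn[OF that] by (simp add: f_def Suc interior_product_def) (simp add: V_def up_def)
    qed
    moreover have "m = k' + l" using m Suc by simp
    ultimately have "sum f (P 0) / (fact k' * fact l) = ?A"
      by (simp add: up wedge_def Suc)
    then show ?thesis
      by (simp add: Suc field_simps del: of_nat_Suc)
  qed simp
  have B2: "real l * sum f (P k) / (fact k * fact l) = ?B"
  proof (cases l)
    case (Suc l')
    have c: "cycle_down k permutes {..<k + l}"
      by (rule permutes_subset[of _ "{..k}"]) (use cycle_down[of k] Suc in auto)
    have "f (up \<tau> \<circ> cycle_down k) = (- 1) ^ k * (of_int (sign \<tau>) * \<alpha> (\<lambda>i. v (\<tau> i)) *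
        interior_product X \<beta> (\<lambda>i. v (\<tau> (k + i))))"
      if t: "\<tau> permutes {..<m}" for \<tau>
    proof -
      have "up \<tau> permutes {..<k + l}"
        using permutes_fixing_0[of m] t by (auto simp: bij_betw_def up_def m)
      then have "sign (up \<tau> \<circ> cycle_down k) = sign \<tau> * (- 1) ^ k"
        using c cycle_down[of k] sgn[OF t] by (simp add: sign_compose perm)
      moreover have "\<alpha> (\<lambda>i. V (up \<tau> (cycle_down k i))) = \<alpha> (\<lambda>i. v (\<tau> i))"
        by (rule alternating_form_cong[OF a]) (simp add: V_def up_def cycle_down_def)
      moreover have "(\<lambda>i. V (up \<tau> (cycle_down k (k + i)))) = case_nat X (\<lambda>i. v (\<tau> (k + i)))"
      proof
        show "V (up \<tau> (cycle_down k (k + i))) = case_nat X (\<lambda>i. v (\<tau> (k + i))) i" for i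
        proof (cases i)
          case 0
          then show ?thesis by (simp add: V_def up_def cycle_down_def)
        next
          case (Suc i')
          then show ?thesis by (simp add: V_def up_def cycle_down_def)
        qed
      qed
      ultimately show ?thesis by (simp add: f_def interior_product_def)
    qed
    moreover have "m = k + l'" using m Suc by simp
    moreover have "sum f (P k) = (\<Sum>\<tau> | \<tau> permutes {..<m}. f (up \<tau> \<circ> cycle_down k))"
      using reindex[OF c, of k 0] up[of "\<lambda>\<sigma>. f (\<sigma> \<circ> cycle_down k)"]
      by (simp add: cycle_down_def)
    ultimately have "sum f (P k) / (fact k * fact l') = ?B"
      by (simp add: wedge_def Suc flip: sum_distrib_left)
    then show ?thesis
      by (simp add: Suc field_simps del: of_nat_Suc)
  qed simp
  have "(\<Sum>j<k + l. sum f (P j)) = (\<Sum>j<k. sum f (P j)) + (\<Sum>j=k..<k + l. sum f (P j))"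
    by (simp add: lessThan_atLeast0 sum.atLeastLessThan_concat)
  also have "\<dots> = real k * sum f (P 0) + real l * sum f (P k)"
  proof -
    have "(\<Sum>j<k. sum f (P j)) = (\<Sum>j<k. sum f (P 0))"
      by (rule sum.cong[OF refl], rule A1) simp
    moreover have "(\<Sum>j=k..<k + l. sum f (P j)) = (\<Sum>j=k..<k + l. sum f (P k))"
      by (rule sum.cong[OF refl], rule B1) simp_all
    ultimately show ?thesis by simp
  qed
  finally show ?thesis
    using A2 B2 split by (simp add: wedge_def f_def V_def add_divide_distrib)
qed

lemma wedge_0_left:
  assumes a: "alternating_form 0 \<alpha>" and b: "alternating_form l \<beta>"
  shows "wedge 0 l \<alpha> \<beta> v = \<alpha> v * \<beta> v"
proof -
  have "of_int (sign \<sigma>) * \<alpha> (\<lambda>i. v (\<sigma> i)) * \<beta> (\<lambda>i. v (\<sigma> (0 + i))) = \<alpha> v * \<beta> v"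
    if "\<sigma> permutes {..<0 + l}" for \<sigma>
  proof -
    have "\<alpha> (\<lambda>i. v (\<sigma> i)) = \<alpha> v" by (rule alternating_form_cong[OF a]) simp
    moreover have "real_of_int (sign \<sigma>) * of_int (sign \<sigma>) = 1" by (simp flip: of_int_mult)
    ultimately show ?thesis
      using alternating_form_permute[OF b, of \<sigma> v] that by simp
  qed
  then show ?thesis
    by (simp add: wedge_def card_permutations)
qed

lemma wedge_0_right:
  assumes a: "alternating_form k \<alpha>" and b: "alternating_form 0 \<beta>"
  shows "wedge k 0 \<alpha> \<beta> v = \<alpha> v * \<beta> v"
proof -
  have "of_int (sign \<sigma>) * \<alpha> (\<lambda>i. v (\<sigma> i)) * \<beta> (\<lambda>i. v (\<sigma> (k + i))) = \<alpha> v * \<beta> v"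
    if "\<sigma> permutes {..<k + 0}" for \<sigma>
  proof -
    have "\<beta> (\<lambda>i. v (\<sigma> (k + i))) = \<beta> v" by (rule alternating_form_cong[OF b]) simp
    moreover have "real_of_int (sign \<sigma>) * of_int (sign \<sigma>) = 1" by (simp flip: of_int_mult)
    ultimately show ?thesis
      using alternating_form_permute[OF a, of \<sigma> v] that by simp
  qed
  then show ?thesis
    by (simp add: wedge_def card_permutations)
qed

lemma wedge_Suc_Suc:
  assumes "alternating_form (Suc k) \<alpha>" "alternating_form (Suc l) \<beta>"
  shows "wedge (Suc k) (Suc l) \<alpha> \<beta> (case_nat X v) =
    wedge k (Suc l) (interior_product X \<alpha>) \<beta> v
    - (- 1) ^ k * wedge (Suc k) l \<alpha> (interior_product X \<beta>) v"
  using interior_product_wedge[OF assms] by simp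

section \<open>Frames and forms of top degree\<close>

text \<open>A list of vectors as the argument of a form. A form whose degree is at most the
  length of the list does not see the padding by 0, and the padding gives such arguments a
  normal form.\<close>

primrec tup :: "'e::zero list \<Rightarrow> nat \<Rightarrow> 'e" where
  "tup [] = (\<lambda>_. 0)"
| "tup (x # xs) = case_nat x (tup xs)"

lemma tup_nth: "i < length xs \<Longrightarrow> tup xs i = xs ! i"
  by (induction xs arbitrary: i) (auto split: nat.split)

lemma alternating_form_tup:
  assumes "alternating_form k \<alpha>"
  shows "\<alpha> v = \<alpha> (tup (map v [0..<k]))"
  by (rule alternating_form_cong[OF assms]) (simp add: tup_nth)

text \<open>A basis \<open>b\<close> of the space with its dual basis \<open>e\<close>, both
  indexed from 0. The last condition says that \<open>b\<close> spans without naming the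
  dimension of the space.\<close>

definition frame_pair :: "nat \<Rightarrow> (nat \<Rightarrow> 'e::real_vector \<Rightarrow> real) \<Rightarrow> (nat \<Rightarrow> 'e)
      \<Rightarrow> bool" where
  "frame_pair n e b \<longleftrightarrow> (\<forall>i<n. linear (e i)) \<and>
     (\<forall>i<n. \<forall>j<n. e i (b j) = (if i = j then 1 else 0)) \<and>
     (\<forall>x. x = (\<Sum>i<n. e i x *\<^sub>R b i))"

text \<open>The endomorphism \<open>T\<close> with components \<open>e i\<close> is onto, since
  a vector orthogonal to its range would be a linear relation between the covectors. It is
  therefore invertible, and the dual frame is the preimage of the standard basis.\<close>

lemma coframe_dual_frame_exists:
  fixes e :: "nat \<Rightarrow> 'e::euclidean_space \<Rightarrow> real"
  assumes e: "coframe e"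
  shows "\<exists>b. frame_pair DIM('e) (\<lambda>i. e (Suc i)) b"
proof -
  let ?n = "DIM('e)"
  obtain B where B: "bij_betw B {..<?n} (Basis :: 'e set)"
    using ex_bij_betw_nat_finite[OF finite_Basis] by (auto simp: lessThan_atLeast0)
  have lin: "linear (e (Suc i))" if "i < ?n" for i
    using e that by (auto simp: coframe_def)
  have ind: "a i = 0" if "\<And>x. (\<Sum>j<?n. a j * e (Suc j) x) = 0" "i < ?n" for a i
  proof -
    have "{1..?n} = Suc ` {..<?n}"
      by (auto simp: image_iff) (metis Suc_le_D Suc_le_eq lessThan_iff)
    then have "(\<Sum>j\<in>{1..?n}. a (j - 1) * e j x) = 0" for x
      using that(1)[of x] by (simp add: sum.reindex)
    moreover have "(\<forall>x. (\<Sum>j\<in>{1..?n}. a (j - 1) * e j x) = 0) \<longrightarrow> (\<forall>j\<in>{1..?n}. a (j - 1) = 0)"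
      using e unfolding coframe_def by (elim conjE allE[of _ "\<lambda>j. a (j - 1)"]) assumption
    ultimately have "\<forall>j\<in>{1..?n}. a (j - 1) = 0" by blast
    from bspec[OF this, of "Suc i"] that(2) show ?thesis by simp
  qed
  have Bin: "B i \<in> Basis" if "i < ?n" for i
    using B that by (auto simp: bij_betw_def)
  have Bip: "B i \<bullet> B j = (if i = j then 1 else 0)" if "i < ?n" "j < ?n" for i j
    using B that Bin by (auto simp: inner_Basis bij_betw_def inj_on_def)
  define T where "T x = (\<Sum>i<?n. e (Suc i) x *\<^sub>R B i)" for x
  have T: "linear T"
    unfolding T_def by (intro linear_compose_sum ballI linear_compose[OF lin, unfolded o_def, where g = "\<lambda>r. r *\<^sub>R _"])
      (auto simp: linear_iff scaleR_add_left)
  have TB: "T x \<bullet> B j = e (Suc j) x" if "j < ?n" for x j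
    using that by (simp add: T_def inner_sum_left Bip if_distrib sum.delta cong: if_cong)
  have surj: "surj T"
  proof (rule ccontr)
    assume "\<not> surj T"
    then have "span (range T) \<noteq> UNIV"
      using linear_subspace_image[OF T subspace_UNIV] by (simp add: span_eq_iff[THEN iffD2])
    then obtain a where a: "a \<noteq> 0" "\<forall>x\<in>span (range T). a \<bullet> x = 0"
      using span_not_univ_subset_hyperplane[of "range T"] by auto
    have "(\<Sum>j<?n. (a \<bullet> B j) * e (Suc j) x) = 0" for x
    proof -
      have "a \<bullet> T x = 0" using a(2) span_base[of "T x" "range T"] by auto
      then show ?thesis by (simp add: T_def inner_sum_right mult.commute)
    qed
    then have "a \<bullet> B i = 0" if "i < ?n" for i
      using ind[of "\<lambda>j. a \<bullet> B j" i] that by blast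
    moreover have "\<exists>i<?n. u = B i" if "u \<in> Basis" for u
      using bij_betw_imp_surj_on[OF B] that by (auto simp: image_iff)
    ultimately have "a \<bullet> u = 0" if "u \<in> Basis" for u
      using that by metis
    then have "a = 0" by (simp add: euclidean_eq_iff[of a 0])
    then show False using a by simp
  qed
  define b where "b j = inv T (B j)" for j
  have Tb: "T (b j) = B j" for j
    using surj by (simp add: b_def surj_f_inv_f)
  have eb: "e (Suc i) (b j) = (if i = j then 1 else 0)" if "i < ?n" "j < ?n" for i j
    using TB[OF that(1), of "b j"] that by (auto simp: Tb Bip)
  have inj: "inj T" using linear_surjective_imp_injective[OF T surj] by simp
  have sum: "x = (\<Sum>i<?n. e (Suc i) x *\<^sub>R b i)" for x
  proof (rule injD[OF inj])
    show "T x = T (\<Sum>i<?n. e (Suc i) x *\<^sub>R b i)"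
      by (simp add: linear_sum[OF T] linear_scale[OF T] Tb) (simp add: T_def)
  qed
  have "frame_pair ?n (\<lambda>i. e (Suc i)) b"
    unfolding frame_pair_def
    by (intro conjI allI impI lin eb) (assumption | rule sum)+
  then show ?thesis by (intro exI[of _ b])
qed

lemma coframe_frame_pair:
  fixes e :: "nat \<Rightarrow> 'e::euclidean_space \<Rightarrow> real"
  assumes e: "coframe e"
    and eb: "\<And>i j. i < DIM('e) \<Longrightarrow> j < DIM('e) \<Longrightarrow> e (Suc i) (b j) = (if i = j then 1 else 0)"
  shows "frame_pair DIM('e) (\<lambda>i. e (Suc i)) b"
proof -
  obtain c where c: "frame_pair DIM('e) (\<lambda>i. e (Suc i)) c"
    using coframe_dual_frame_exists[OF e] by blast
  have "b j = c j" if "j < DIM('e)" for j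
  proof -
    have "b j = (\<Sum>i<DIM('e). e (Suc i) (b j) *\<^sub>R c i)"
      using c by (simp add: frame_pair_def)
    also have "\<dots> = (\<Sum>i<DIM('e). if i = j then c i else 0)"
      by (rule sum.cong) (use eb that in auto)
    also have "\<dots> = c j" using that by simp
    finally show ?thesis .
  qed
  then show ?thesis
    using c by (simp add: frame_pair_def)
qed

text \<open>Multilinear expansion, one argument at a time by way of the interior
  product.\<close>

lemma alternating_zero_on_frame:
  assumes b: "frame_pair n e b" and a: "alternating_form k \<alpha>"
    and zero: "\<And>I. (\<And>i. i < k \<Longrightarrow> I i < n) \<Longrightarrow> \<alpha> (\<lambda>i. b (I i)) = 0"
  shows "\<alpha> v = 0"
  using a zero
proof (induction k arbitrary: \<alpha> v)
  case 0
  have "\<alpha> v = \<alpha> (\<lambda>i. b 0)" by (rule alternating_form_cong[OF "0.prems"(1)]) simp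
  then show ?case using "0.prems"(2)[of "\<lambda>_. 0"] by simp
next
  case (Suc k)
  note a = Suc.prems(1)
  have z: "interior_product (b j) \<alpha> w = 0" if j: "j < n" for j w
  proof (rule Suc.IH[OF alternating_form_interior_product[OF a]])
    fix I :: "nat \<Rightarrow> nat" assume I: "\<And>i. i < k \<Longrightarrow> I i < n"
    have "case_nat (b j) (\<lambda>i. b (I i)) = (\<lambda>i. b (case_nat j I i))"
      by (auto simp: fun_eq_iff split: nat.split)
    moreover have "\<alpha> (\<lambda>i. b (case_nat j I i)) = 0"
      by (rule Suc.prems(2)) (use I j in \<open>auto split: nat.split\<close>)
    ultimately show "interior_product (b j) \<alpha> (\<lambda>i. b (I i)) = 0"
      by (simp add: interior_product_def)
  qed
  let ?w = "\<lambda>i. v (Suc i)"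
  have lin: "linear (\<lambda>x. interior_product x \<alpha> ?w)"
    by (rule interior_product_linear[OF a])
  have "v = case_nat (v 0) ?w"
    by (auto simp: fun_eq_iff split: nat.split)
  then have "\<alpha> v = interior_product (v 0) \<alpha> ?w"
    by (simp add: interior_product_def)
  also have "v 0 = (\<Sum>i<n. e i (v 0) *\<^sub>R b i)"
    using b by (simp add: frame_pair_def)
  also have "interior_product (\<Sum>i<n. e i (v 0) *\<^sub>R b i) \<alpha> ?w
      = (\<Sum>i<n. e i (v 0) * interior_product (b i) \<alpha> ?w)"
    by (simp add: linear_sum[OF lin] linear_scale[OF lin])
  also have "\<dots> = 0" by (simp add: z)
  finally show ?case .
qed

text \<open>A tuple of distinct frame vectors is the beginning of a reordered frame.\<close>

lemma injection_extends_to_permutation: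
  assumes I: "inj_on I {..<k}" "I ` {..<k} \<subseteq> {..<n}" and k: "k \<le> (n::nat)"
  obtains \<sigma> where "\<sigma> permutes {..<n}" "\<And>i. i < k \<Longrightarrow> \<sigma> i = I i"
proof -
  have "card ({..<n} - {..<k}) = card ({..<n} - I ` {..<k})"
    using I k by (simp add: card_Diff_subset card_image)
  then obtain f where f: "bij_betw f ({..<n} - {..<k}) ({..<n} - I ` {..<k})"
    using finite_same_card_bij[of "{..<n} - {..<k}" "{..<n} - I ` {..<k}"] by auto
  define \<sigma> where "\<sigma> i = (if i < k then I i else if i < n then f i else i)" for i
  have "bij_betw \<sigma> {..<k} (I ` {..<k})"
    using I(1) by (auto simp: \<sigma>_def bij_betw_def inj_on_def)
  moreover have "bij_betw \<sigma> ({..<n} - {..<k}) ({..<n} - I ` {..<k})"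
    using f by (subst bij_betw_cong[of _ _ f]) (auto simp: \<sigma>_def)
  ultimately have "bij_betw \<sigma> ({..<k} \<union> ({..<n} - {..<k})) (I ` {..<k} \<union> ({..<n} - I ` {..<k}))"
    by (rule bij_betw_combine) auto
  moreover have "{..<k} \<union> ({..<n} - {..<k}) = {..<n}" "I ` {..<k} \<union> ({..<n} - I ` {..<k}) = {..<n}"
    using I k by auto
  ultimately have "bij_betw \<sigma> {..<n} {..<n}" by simp
  then have "\<sigma> permutes {..<n}"
    by (rule bij_imp_permutes) (use k in \<open>auto simp: \<sigma>_def\<close>)
  then show thesis
    by (rule that) (simp add: \<sigma>_def)
qed

lemma alternating_form_reindex:
  assumes a: "alternating_form n \<alpha>" and I: "\<And>i. i < n \<Longrightarrow> I i < n"
  shows "\<not> inj_on I {..<n} \<Longrightarrow> \<alpha> (\<lambda>i. b (I i)) = 0"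
    and "inj_on I {..<n} \<Longrightarrow> \<bar>\<alpha> (\<lambda>i. b (I i))\<bar> = \<bar>\<alpha> b\<bar>"
proof -
  assume "\<not> inj_on I {..<n}"
  then obtain i j where "i < n" "j < n" "i \<noteq> j" "I i = I j" by (auto simp: inj_on_def)
  then show "\<alpha> (\<lambda>i. b (I i)) = 0" using alternating_form_repeat[OF a] by metis
next
  assume "inj_on I {..<n}"
  then obtain \<sigma> where s: "\<sigma> permutes {..<n}" "\<And>i. i < n \<Longrightarrow> \<sigma> i = I i"
    using injection_extends_to_permutation[of I n n] I by auto
  have "\<alpha> (\<lambda>i. b (I i)) = \<alpha> (\<lambda>i. b (\<sigma> i))"
    by (rule alternating_form_cong[OF a]) (simp add: s(2))
  also have "\<dots> = of_int (sign \<sigma>) * \<alpha> b"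
    by (rule alternating_form_permute[OF a s(1)])
  finally show "\<bar>\<alpha> (\<lambda>i. b (I i))\<bar> = \<bar>\<alpha> b\<bar>"
    by (simp add: abs_mult flip: of_int_abs)
qed

lemma top_form_zero:
  assumes b: "frame_pair n e b" and a: "alternating_form n \<alpha>" and z: "\<alpha> b = 0"
  shows "\<alpha> v = 0"
proof (rule alternating_zero_on_frame[OF b a])
  fix I :: "nat \<Rightarrow> nat" assume "\<And>i. i < n \<Longrightarrow> I i < n"
  then show "\<alpha> (\<lambda>i. b (I i)) = 0"
    using alternating_form_reindex[OF a, of I b] z by fastforce
qed

lemma alternating_form_diff:
  assumes "alternating_form k \<alpha>" "alternating_form k \<beta>"
  shows "alternating_form k (\<lambda>v. \<alpha> v - \<beta> v)"
  using assms unfolding alternating_form_def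
  by (simp add: linear_compose_sub) (metis)

lemma alternating_form_add:
  assumes "alternating_form k \<alpha>" "alternating_form k \<beta>"
  shows "alternating_form k (\<lambda>v. \<alpha> v + \<beta> v)"
  using assms unfolding alternating_form_def
  by (simp add: linear_compose_add) (metis)

lemma alternating_form_scale:
  assumes "alternating_form k \<alpha>"
  shows "alternating_form k (\<lambda>v. r * \<alpha> v)"
  using assms unfolding alternating_form_def
  by (simp add: linear_iff algebra_simps)

text \<open>Identities in top degree, among them those that determine \<open>J\<close> and the
  metric, need to be checked on a single frame only.\<close>

lemma top_form_eq:
  assumes b: "frame_pair n e b" and a: "alternating_form n \<alpha>" "alternating_form n \<beta>"
    and eq: "\<alpha> b = \<beta> b"
  shows "\<alpha> = \<beta>"
  using top_form_zero[OF b alternating_form_diff[OF a]] eq by (auto simp: fun_eq_iff)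

section \<open>Inner products of forms\<close>

lemma orthonormal_frame_pair:
  fixes g :: "'e::euclidean_space \<Rightarrow> 'e \<Rightarrow> real"
  assumes g: "inner_product_on_space g" and b: "orthonormal_frame g b"
  shows "frame_pair DIM('e) (\<lambda>i. g (b i)) b"
proof -
  have "coframe (\<lambda>i. g (b (i - 1)))"
    unfolding coframe_def
  proof (intro conjI ballI allI impI)
    fix i show "linear (g (b (i - 1)))" using g by (simp add: inner_product_on_space_def)
  next
    fix a :: "nat \<Rightarrow> real" and j
    assume z: "\<forall>x. (\<Sum>i\<in>{1..DIM('e)}. a i * g (b (i - 1)) x) = 0" and j: "j \<in> {1..DIM('e)}"
    have "(\<Sum>i\<in>{1..DIM('e)}. a i * g (b (i - 1)) (b (j - 1))) = (\<Sum>i\<in>{1..DIM('e)}. if i = j then a i else 0)"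
    proof (rule sum.cong)
      fix i assume i: "i \<in> {1..DIM('e)}"
      moreover have "i - 1 < DIM('e)" "j - 1 < DIM('e)" using i j by auto
      ultimately have "g (b (i - 1)) (b (j - 1)) = (if i - 1 = j - 1 then 1 else 0)"
        using b unfolding orthonormal_frame_def by blast
      then show "a i * g (b (i - 1)) (b (j - 1)) = (if i = j then a i else 0)"
        using i j by auto
    qed simp
    then show "a j = 0" using z j by simp
  qed
  from coframe_frame_pair[OF this, of b] show ?thesis
    using b by (simp add: orthonormal_frame_def)
qed

text \<open>The trace of a bilinear form with respect to a metric. The vectors of either frame
  are expanded in the other one; both double sums are the same because
  \<open>g (b i) (c j) = g (c j) (b i)\<close>.\<close>

lemma trace_frame_independent:
  fixes g :: "'e::euclidean_space \<Rightarrow> 'e \<Rightarrow> real" and T :: "'e \<Rightarrow> 'e \<Rightarrow> real"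
  assumes g: "inner_product_on_space g" and b: "orthonormal_frame g b" and c: "orthonormal_frame g c"
    and T: "\<And>x. linear (T x)" "\<And>y. linear (\<lambda>x. T x y)"
  shows "(\<Sum>i<DIM('e). T (b i) (b i)) = (\<Sum>i<DIM('e). T (c i) (c i))"
proof -
  have eb: "x = (\<Sum>i<DIM('e). g (b i) x *\<^sub>R b i)" and ec: "x = (\<Sum>i<DIM('e). g (c i) x *\<^sub>R c i)" for x
    using orthonormal_frame_pair[OF g b] orthonormal_frame_pair[OF g c] by (auto simp: frame_pair_def)
  have "T (b i) (b i) = (\<Sum>j<DIM('e). g (c j) (b i) * T (b i) (c j))" for i
    by (subst (2) ec) (simp add: linear_sum[OF T(1)] linear_scale[OF T(1)])
  then have "(\<Sum>i<DIM('e). T (b i) (b i)) = (\<Sum>i<DIM('e). \<Sum>j<DIM('e). g (c j) (b i) * T (b i) (c j))"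
    by simp
  also have "\<dots> = (\<Sum>j<DIM('e). \<Sum>i<DIM('e). g (b i) (c j) * T (b i) (c j))"
    using g by (subst sum.swap) (simp add: inner_product_on_space_def)
  also have "\<dots> = (\<Sum>j<DIM('e). T (c j) (c j))"
  proof (rule sum.cong[OF refl])
    fix j
    have "T (c j) (c j) = (\<Sum>i<DIM('e). g (b i) (c j) * T (b i) (c j))"
      by (subst (1) eb) (simp add: linear_sum[OF T(2)] linear_scale[OF T(2)])
    then show "(\<Sum>i<DIM('e). g (b i) (c j) * T (b i) (c j)) = T (c j) (c j)" by simp
  qed
  finally show ?thesis .
qed

lemma sum_PiE_Suc:
  fixes A :: "'a set" and f :: "(nat \<Rightarrow> 'a) \<Rightarrow> real"
  shows "(\<Sum>I\<in>{..<Suc k} \<rightarrow>\<^sub>E A. f I) = (\<Sum>i\<in>A. \<Sum>J\<in>{..<k} \<rightarrow>\<^sub>E A. f (case_nat i J))"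
proof -
  have "bij_betw (\<lambda>(i, J). case_nat i J) (A \<times> ({..<k} \<rightarrow>\<^sub>E A)) ({..<Suc k} \<rightarrow>\<^sub>E A)"
  proof (rule bij_betw_byWitness[of _ "\<lambda>I. (I 0, \<lambda>j. I (Suc j))"])
    show "(\<lambda>(i, J). case_nat i J) ` (A \<times> ({..<k} \<rightarrow>\<^sub>E A)) \<subseteq> {..<Suc k} \<rightarrow>\<^sub>E A"
    proof clarify
      fix i J assume "i \<in> A" and J: "J \<in> {..<k} \<rightarrow>\<^sub>E A"
      show "case_nat i J \<in> {..<Suc k} \<rightarrow>\<^sub>E A"
      proof (rule PiE_I)
        show "case_nat i J j \<in> A" if "j \<in> {..<Suc k}" for j
          using that \<open>i \<in> A\<close> PiE_mem[OF J] by (cases j) auto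
        show "case_nat i J j = undefined" if "j \<notin> {..<Suc k}" for j
          using that PiE_arb[OF J] by (cases j) auto
      qed
    qed
    show "(\<lambda>I. (I 0, \<lambda>j. I (Suc j))) ` ({..<Suc k} \<rightarrow>\<^sub>E A) \<subseteq> A \<times> ({..<k} \<rightarrow>\<^sub>E A)"
    proof clarify
      fix I assume I: "I \<in> {..<Suc k} \<rightarrow>\<^sub>E A"
      show "I 0 \<in> A \<and> (\<lambda>j. I (Suc j)) \<in> {..<k} \<rightarrow>\<^sub>E A"
        using PiE_mem[OF I] PiE_arb[OF I] by (auto intro!: PiE_I)
    qed
    show "\<forall>I\<in>{..<Suc k} \<rightarrow>\<^sub>E A. (\<lambda>(i, J). case_nat i J) (I 0, \<lambda>j. I (Suc j)) = I"
      by (auto simp: fun_eq_iff split: nat.split)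
  qed auto
  from sum.reindex_bij_betw[OF this, of f] show ?thesis
    by (simp add: sum.cartesian_product split_def)
qed

lemma form_inner_Suc:
  fixes b :: "nat \<Rightarrow> 'e::euclidean_space"
  shows "(\<Sum>I\<in>{..<Suc k} \<rightarrow>\<^sub>E {..<n}. \<alpha> (\<lambda>i. b (I i)) * \<beta> (\<lambda>i. b (I i))) =
    (\<Sum>i<n. \<Sum>J\<in>{..<k} \<rightarrow>\<^sub>E {..<n}. interior_product (b i) \<alpha> (\<lambda>j. b (J j)) * interior_product
          (b i) \<beta> (\<lambda>j. b (J j)) :: real)"
proof -
  have "(\<lambda>m. b (case_nat i J m)) = case_nat (b i) (\<lambda>j. b (J j))" for i J
    by (auto simp: fun_eq_iff split: nat.split)
  then show ?thesis
    by (simp add: sum_PiE_Suc interior_product_def)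
qed

text \<open>By induction on the degree: the inner product of \<open>\<alpha>\<close> and
  \<open>\<beta>\<close> is the trace of the bilinear form that maps \<open>x\<close> and
  \<open>y\<close> to the inner product of \<open>i\<^sub>x \<alpha>\<close> and
  \<open>i\<^sub>y \<beta>\<close>.\<close>

lemma form_inner_frame_independent:
  fixes g :: "'e::euclidean_space \<Rightarrow> 'e \<Rightarrow> real"
  assumes g: "inner_product_on_space g" and b: "orthonormal_frame g b" and c: "orthonormal_frame g c"
    and "alternating_form k \<alpha>" "alternating_form k \<beta>"
  shows "form_inner b k \<alpha> \<beta> = form_inner c k \<alpha> \<beta>"
proof -
  have "(\<Sum>I\<in>{..<k} \<rightarrow>\<^sub>E {..<DIM('e)}. \<alpha> (\<lambda>i. b (I i)) * \<beta> (\<lambda>i. b (I i))) =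
        (\<Sum>I\<in>{..<k} \<rightarrow>\<^sub>E {..<DIM('e)}. \<alpha> (\<lambda>i. c (I i)) * \<beta> (\<lambda>i. c (I i)))"
    using assms(4,5)
  proof (induction k arbitrary: \<alpha> \<beta>)
    case 0
    have "\<alpha> (\<lambda>i. b (I i)) = \<alpha> (\<lambda>i. c (I i))" "\<beta> (\<lambda>i. b (I i)) = \<beta> (\<lambda>i. c (I i))"
          for I :: "nat \<Rightarrow> nat"
      by (rule alternating_form_cong[OF 0(1)] alternating_form_cong[OF 0(2)]; simp)+
    then show ?case by simp
  next
    case (Suc k)
    note lin = interior_product_linear[OF Suc.prems(1)] interior_product_linear[OF Suc.prems(2)]
    note alt = alternating_form_interior_product[OF Suc.prems(1)] alternating_form_interior_product[OF Suc.prems(2)]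
    define T where "T x y = (\<Sum>J\<in>{..<k} \<rightarrow>\<^sub>E {..<DIM('e)}.
        interior_product x \<alpha> (\<lambda>j. c (J j)) * interior_product y \<beta> (\<lambda>j. c (J j)))" for x y
    have "linear (T x)" for x
      unfolding T_def
      by (intro linear_compose_sum ballI linear_compose[OF lin(2), unfolded o_def])
        (auto simp: linear_iff algebra_simps)
    moreover have "linear (\<lambda>x. T x y)" for y
      unfolding T_def
      by (intro linear_compose_sum ballI linear_compose[OF lin(1), unfolded o_def, where g = "\<lambda>r. r * _"])
        (auto simp: linear_iff algebra_simps)
    ultimately have "(\<Sum>i<DIM('e). T (b i) (b i)) = (\<Sum>i<DIM('e). T (c i) (c i))"
      by (rule trace_frame_independent[OF g b c])
    then show ?case
      unfolding form_inner_Suc T_def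
      using Suc.IH[OF alt, of "b _" "b _"] by simp
  qed
  then show ?thesis by (simp add: form_inner_def)
qed

text \<open>Only tuples without repetition contribute. They are permutations of the frame, and
  each contributes the same square.\<close>

lemma top_form_norm:
  fixes vol :: "'e::euclidean_space altform"
  assumes a: "alternating_form DIM('e) vol"
  shows "\<exists>N>0. \<forall>b. form_inner b DIM('e) vol vol = N * (vol b)\<^sup>2"
proof -
  let ?P = "{..<DIM('e)} \<rightarrow>\<^sub>E {..<DIM('e)}"
  let ?Q = "{I \<in> ?P. inj_on I {..<DIM('e)}}"
  have fin: "finite ?P" by (intro finite_PiE) auto
  have "form_inner b DIM('e) vol vol = real (card ?Q) / fact DIM('e) * (vol b)\<^sup>2" for b
  proof -
    have "(\<Sum>I\<in>?P. vol (\<lambda>i. b (I i)) * vol (\<lambda>i. b (I i))) =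
        (\<Sum>I\<in>?P. if inj_on I {..<DIM('e)} then (vol b)\<^sup>2 else 0)"
    proof (rule sum.cong[OF refl])
      fix I assume "I \<in> ?P"
      then have "\<And>i. i < DIM('e) \<Longrightarrow> I i < DIM('e)" by (auto simp: PiE_iff)
      note r = alternating_form_reindex[where I = I and b = b, OF a this]
      have "x * x = (vol b)\<^sup>2" if "\<bar>x\<bar> = \<bar>vol b\<bar>" for x
        using that by (metis power2_abs power2_eq_square)
      then show "vol (\<lambda>i. b (I i)) * vol (\<lambda>i. b (I i)) = (if inj_on I {..<DIM('e)} then (vol b)\<^sup>2 else 0)"
        using r by auto
    qed
    also have "\<dots> = real (card ?Q) * (vol b)\<^sup>2"
      using fin by (simp add: sum.If_cases Int_def)
    finally show ?thesis by (simp add: form_inner_def)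
  qed
  moreover have "card ?Q > 0"
  proof -
    have "restrict id {..<DIM('e)} \<in> ?Q" by (auto simp: inj_on_def)
    then have "?Q \<noteq> {}" by blast
    moreover have "finite ?Q" by (rule finite_subset[OF _ fin]) auto
    ultimately show ?thesis by (simp add: card_gt_0_iff)
  qed
  ultimately show ?thesis
    by (intro exI[of _ "real (card ?Q) / fact DIM('e)"]) simp
qed

text \<open>By the preceding lemma \<open>(vol b)\<^sup>2\<close> is a fixed multiple of the
  inner product of \<open>vol\<close> with itself, which is the same in all orthonormal frames.
  This takes the place of the fact that orthogonal matrices have determinant 1 or -1.\<close>

lemma metric_volume_formI:
  fixes g :: "'e::euclidean_space \<Rightarrow> 'e \<Rightarrow> real"
  assumes g: "inner_product_on_space g" and c: "orthonormal_frame g c"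
    and a: "alternating_form DIM('e) vol" and v: "\<bar>vol c\<bar> = 1"
  shows "metric_volume_form g vol"
  unfolding metric_volume_form_def
proof (intro conjI allI impI a)
  fix b assume b: "orthonormal_frame g b"
  obtain N where N: "N > 0" "\<And>b. form_inner b DIM('e) vol vol = N * (vol b)\<^sup>2"
    using top_form_norm[OF a] by blast
  have "(vol b)\<^sup>2 = (vol c)\<^sup>2"
    using form_inner_frame_independent[OF g b c a a] N by simp
  then show "\<bar>vol b\<bar> = 1"
    using v by (metis abs_1 power2_abs power2_eq_iff_nonneg abs_ge_zero)
qed

section \<open>Monomials in covectors\<close>

lemma interior_product_apply: "interior_product X \<alpha> v = \<alpha> (case_nat X v)"
  by (simp add: interior_product_def)

text \<open>Rewriting with these rules moves explicit vectors, from the left, out of a wedge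
  product into its factors, until products of values remain. Degrees have to be successors or 0,
  so numerals are unfolded wherever these rules are used.\<close>

lemmas wedge_expand = wedge_Suc_Suc wedge_0_left wedge_0_right alternating_form_interior_product
  interior_product_apply

lemma alternating_form_covector:
  assumes "linear a"
  shows "alternating_form (Suc 0) (\<lambda>v. a (v 0))"
  using assms by (auto simp: alternating_form_def)

lemma alternating_form_monomial:
  assumes "\<And>i. i \<in> set I \<Longrightarrow> linear (e i)"
  shows "alternating_form (length I) (monomial e I)"
  using assms
proof (induction I)
  case Nil
  show ?case by (simp add: alternating_form_def)
next
  case (Cons i I)
  have "alternating_form (1 + length I) (wedge 1 (length I) (\<lambda>v. e i (v 0)) (monomial e I))"
    by (rule alternating_form_wedge) (use Cons alternating_form_covector in auto)
  then show ?case by simp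
qed

lemma monomial_1:
  assumes "linear (e i)"
  shows "monomial e [i] v = e i (v 0)"
  using wedge_0_right[OF alternating_form_covector[OF assms], of "\<lambda>_. 1" v]
  by (simp add: alternating_form_def)

lemma monomial_Cons:
  assumes "linear (e i)" "alternating_form (Suc l) (monomial e J)" "length J = Suc l"
  shows "monomial e (i # J) (case_nat x v) =
    e i x * monomial e J v - wedge 1 l (\<lambda>v. e i (v 0)) (interior_product x (monomial e J)) v"
proof -
  have "alternating_form 0 (interior_product x (\<lambda>v. e i (v 0)))"
    using alternating_form_interior_product[OF alternating_form_covector[OF assms(1)]] .
  then show ?thesis
    using wedge_Suc_Suc[OF alternating_form_covector[OF assms(1)] assms(2), of x v] assms(2,3)
    by (simp add: wedge_0_left interior_product_apply)
qed

lemma monomial_2: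
  assumes e: "linear (e i)" "linear (e j)"
  shows "monomial e [i, j] v = e i (v 0) * e j (v 1) - e i (v 1) * e j (v 0)"
proof -
  have a: "alternating_form (Suc 0) (monomial e [j])" "alternating_form 2 (monomial e [i, j])"
    using alternating_form_monomial[of "[j]" e] alternating_form_monomial[of "[i, j]" e] e
    by (auto simp: numeral_eq_Suc)
  have "monomial e [i, j] v = monomial e [i, j] (case_nat (v 0) (case_nat (v 1) (\<lambda>_. 0)))"
    by (rule alternating_form_cong[OF a(2)]) (auto simp: less_Suc_eq numeral_eq_Suc split: nat.split)
  also have "\<dots> = e i (v 0) * e j (v 1) - e i (v 1) * e j (v 0)"
    using e a(1) alternating_form_covector[of "e i"]
    by (simp add: wedge_expand monomial_Cons monomial_1 del: monomial.simps)
  finally show ?thesis .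
qed

lemma monomial_3:
  assumes e: "linear (e i)" "linear (e j)" "linear (e k)"
  shows "monomial e [i, j, k] v = e i (v 0) * (e j (v 1) * e k (v 2) - e j (v 2) * e k (v 1))
    - e i (v 1) * (e j (v 0) * e k (v 2) - e j (v 2) * e k (v 0))
    + e i (v 2) * (e j (v 0) * e k (v 1) - e j (v 1) * e k (v 0))"
proof -
  have a: "alternating_form (Suc (Suc 0)) (monomial e [j, k])" "alternating_form 3 (monomial e [i, j, k])"
    using alternating_form_monomial[of "[j, k]" e] alternating_form_monomial[of "[i, j, k]" e] e
    by (auto simp: numeral_eq_Suc)
  have "monomial e [i, j, k] v = monomial e [i, j, k] (case_nat (v 0) (case_nat (v 1) (case_nat (v 2) (\<lambda>_. 0))))"
    by (rule alternating_form_cong[OF a(2)]) (auto simp: less_Suc_eq numeral_eq_Suc split: nat.split)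
  also have "\<dots> = e i (v 0) * (e j (v 1) * e k (v 2) - e j (v 2) * e k (v 1))
    - e i (v 1) * (e j (v 0) * e k (v 2) - e j (v 2) * e k (v 0))
    + e i (v 2) * (e j (v 0) * e k (v 1) - e j (v 1) * e k (v 0))"
    using e a(1) alternating_form_covector[of "e i"]
    by (simp add: wedge_expand monomial_Cons monomial_2 del: monomial.simps)
  finally show ?thesis .
qed

lemma monomial_4:
  assumes e: "linear (e i)" "linear (e j)" "linear (e k)" "linear (e l)"
  shows "monomial e [i, j, k, l] (tup [x, y, z, w]) = e i x * monomial e [j, k, l] (tup [y, z, w])
    - e i y * monomial e [j, k, l] (tup [x, z, w]) + e i z * monomial e [j, k, l] (tup [x, y, w])
    - e i w * monomial e [j, k, l] (tup [x, y, z])"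
proof -
  have a: "alternating_form (Suc (Suc (Suc 0))) (monomial e [j, k, l])"
    using alternating_form_monomial[of "[j, k, l]" e] e by auto
  then show ?thesis
    using e a(1) alternating_form_covector[of "e i"]
    by (simp add: wedge_expand monomial_Cons monomial_3[of e j k l] del: monomial.simps)
qed

lemma alternating_form_swap_3:
  assumes a: "alternating_form 3 \<alpha>"
  shows "\<alpha> (tup [y, x, z]) = - \<alpha> (tup [x, y, z])" "\<alpha> (tup [x, z, y]) = - \<alpha> (tup [x, y, z])"
proof -
  have "\<alpha> (\<lambda>m. tup [x, y, z] (Transposition.transpose 0 1 m)) = \<alpha> (tup [y, x, z])"
    "\<alpha> (\<lambda>m. tup [x, y, z] (Transposition.transpose 1 2 m)) = \<alpha> (tup [x, z, y])"
    by (rule alternating_form_cong[OF a]; auto simp: less_Suc_eq numeral_eq_Suc Transposition.transpose_def)+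
  then show "\<alpha> (tup [y, x, z]) = - \<alpha> (tup [x, y, z])" "\<alpha> (tup [x, z, y]) = - \<alpha> (tup [x, y, z])"
    using alternating_form_transpose[OF a, of 0 1 "tup [x, y, z]"]
      alternating_form_transpose[OF a, of 1 2 "tup [x, y, z]"] by (simp_all del: tup.simps)
qed

lemma sum_if_const: "(\<Sum>x\<in>A. if P then f x else 0) = (if P then sum f A else 0)"
  by simp

lemma sum_lessThan_7: "(\<Sum>i<7. f i) = f 0 + f 1 + f 2 + f 3 + f 4 + f 5 + (f 6 :: real)" for f :: "nat \<Rightarrow> real"
  by (simp add: numeral_eq_Suc)

text \<open>Pairing with a monomial reads off a coefficient. The sum over all triples meets each
  of the six orderings of the frame vectors once, with matching signs, and the factor 1/3!
  compensates for this.\<close>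

lemma form_inner_monomial_3:
  fixes b :: "nat \<Rightarrow> 'e::euclidean_space"
  assumes E: "\<And>i. i < DIM('e) \<Longrightarrow> linear (e (Suc i))"
    and b: "\<And>i j. i < DIM('e) \<Longrightarrow> j < DIM('e) \<Longrightarrow> e (Suc i) (b j) = (if i = j then 1 else 0)"
    and a: "alternating_form 3 \<alpha>" and ijk: "i < DIM('e)" "j < DIM('e)" "k < DIM('e)"
  shows "form_inner b 3 \<alpha> (monomial e [Suc i, Suc j, Suc k]) = \<alpha> (tup [b i, b j, b k])"
proof -
  let ?A = "\<lambda>p q r. \<alpha> (tup [b p, b q, b r])"
  let ?M = "monomial e [Suc i, Suc j, Suc k]"
  \<comment> \<open>Kronecker's delta as a function, so that the double and triple sums collapse
    by rewriting.\<close>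
  define d where "d i p = (if i = p then 1 else 0 :: real)" for i p :: nat
  have ed: "e (Suc i) (b p) = d i p" if "i < DIM('e)" "p < DIM('e)" for i p
    using b that by (simp add: d_def)
  have collapse: "(\<Sum>p<DIM('e). \<Sum>q<DIM('e). \<Sum>r<DIM('e). ?A p q r * (d i p * (d j q * d k r))) = ?A i j k"
    if "i < DIM('e)" "j < DIM('e)" "k < DIM('e)" for i j k
  proof -
    have "?A p q r * (d i p * (d j q * d k r)) =
        (if i = p then if j = q then if k = r then ?A p q r else 0 else 0 else 0)" for p q r
      by (simp add: d_def)
    then show ?thesis
      using that by (simp add: sum_if_const del: tup.simps)
  qed
  let ?X = "\<lambda>p q r. case_nat (b p) (case_nat (b q) (case_nat (b r) (\<lambda>_. b undefined)))"
  have tup_vals: "tup [x, y, z] 0 = x" "tup [x, y, z] 1 = y" "tup [x, y, z] (Suc 0) = y"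
    "tup [x, y, z] 2 = z" for x y z :: 'e
    by simp_all
  have M: "alternating_form 3 ?M"
    using alternating_form_monomial[of "[Suc i, Suc j, Suc k]" e] E ijk by (auto simp: numeral_eq_Suc)
  have X: "?X p q r m = tup [b p, b q, b r] m" if "m < 3" for p q r m
    using that by (auto simp: less_Suc_eq numeral_eq_Suc)
  have eq: "\<alpha> (?X p q r) = ?A p q r" "?M (?X p q r) = ?M (tup [b p, b q, b r])" for p q r
    by (rule alternating_form_cong[OF a] alternating_form_cong[OF M], erule X)+
  have "form_inner b 3 \<alpha> ?M =
    (\<Sum>p<DIM('e). \<Sum>q<DIM('e). \<Sum>r<DIM('e). ?A p q r * ?M (tup [b p, b q, b r])) / 6"
    unfolding form_inner_def numeral_3_eq_3 form_inner_Suc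
    by (simp add: interior_product_apply eq fact_numeral del: monomial.simps tup.simps)
  also have "\<dots> = (\<Sum>p<DIM('e). \<Sum>q<DIM('e). \<Sum>r<DIM('e).
      ?A p q r * (d i p * (d j q * d k r)) - ?A p q r * (d i p * (d k q * d j r)) - ?A p q r * (d j p * (d i q * d k r))
    + ?A p q r * (d j p * (d k q * d i r)) + ?A p q r * (d k p * (d i q * d j r)) - ?A p q r * (d k p * (d j q * d i r))) / 6"
    by (intro arg_cong[where f = "\<lambda>x. x / 6"] sum.cong refl)
      (simp add: tup_vals monomial_3 E ed ijk algebra_simps del: monomial.simps tup.simps)
  also have "\<dots> = (?A i j k - ?A i k j - ?A j i k + ?A j k i + ?A k i j - ?A k j i) / 6"
    by (simp only: sum.distrib sum_subtractf collapse ijk)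
  also have "\<dots> = ?A i j k"
  proof -
    note swap = alternating_form_swap_3[OF a]
    have "?A i k j = - ?A i j k" "?A j i k = - ?A i j k" by (rule swap)+
    moreover have "?A k i j = ?A i j k" using swap(1)[of "b k" "b i" "b j"] swap(2)[of "b i" "b k" "b j"] by simp
    moreover have "?A j k i = ?A i j k" using swap(2)[of "b j" "b k" "b i"] swap(1)[of "b j" "b i" "b k"] by simp
    moreover have "?A k j i = - ?A j k i" by (rule swap)
    ultimately show ?thesis by (simp del: tup.simps)
  qed
  finally show ?thesis .
qed

section \<open>The almost complex structure of an SU(3)-structure at a point\<close>

lemma frame_pair_dual:
  assumes "frame_pair n (\<lambda>i. e (Suc i)) b" "1 \<le> i" "i \<le> n" "j < n"
  shows "e i (b j) = (if i = Suc j then 1 else 0)"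
  using assms by (cases i) (auto simp: frame_pair_def)

lemma su3_adapted_expand:
  assumes "su3_adapted e \<omega> (\<psi> :: 'e::euclidean_space altform)"
  shows "DIM('e) = 6"
    and "\<And>i. 1 \<le> i \<Longrightarrow> i \<le> 6 \<Longrightarrow> linear (e i)"
    and "alternating_form 2 \<omega>" "alternating_form 3 \<psi>"
    and "\<omega> = (\<lambda>v. monomial e [1,2] v + monomial e [3,4] v + monomial e [5,6] v)"
    and "\<psi> = (\<lambda>v. monomial e [1,3,5] v - monomial e [1,4,6] v - monomial e [2,3,6] v
             - monomial e [2,4,5] v)"
proof -
  show D: "DIM('e) = 6" and w: "\<omega> = (\<lambda>v. monomial e [1,2] v + monomial e [3,4] v + monomial e [5,6] v)"
    and p: "\<psi> = (\<lambda>v. monomial e [1,3,5] v - monomial e [1,4,6] v - monomial e [2,3,6] v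
             - monomial e [2,4,5] v)"
    using assms by (simp_all add: su3_adapted_def)
  show lin: "\<And>i. 1 \<le> i \<Longrightarrow> i \<le> 6 \<Longrightarrow> linear (e i)"
    using assms by (simp add: su3_adapted_def coframe_def D)
  have "alternating_form (length [i, j]) (monomial e [i, j])" if "i \<in> {1..6}" "j \<in> {1..6}" for i j
    using that lin by (intro alternating_form_monomial) auto
  then show "alternating_form 2 \<omega>"
    unfolding w by (intro alternating_form_add) (auto simp: numeral_2_eq_2 simp del: monomial.simps)
  have "alternating_form (length [i, j, k]) (monomial e [i, j, k])"
    if "i \<in> {1..6}" "j \<in> {1..6}" "k \<in> {1..6}" for i j k
    using that lin by (intro alternating_form_monomial) auto
  then show "alternating_form 3 \<psi>"
    unfolding p by (intro alternating_form_add alternating_form_diff) (auto simp: numeral_3_eq_3 simp del: monomial.simps)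
qed

lemma su3_adapted_frame:
  assumes "su3_adapted e \<omega> (\<psi> :: 'e::euclidean_space altform)"
  obtains b where "frame_pair 6 (\<lambda>i. e (Suc i)) b"
  using assms coframe_dual_frame_exists[of e] by (auto simp: su3_adapted_def)

text \<open>The form \<open>\<omega>\<^sup>3 / 6\<close>, which is
  \<open>e\<^sup>1\<^sup>2\<^sup>3\<^sup>4\<^sup>5\<^sup>6\<close> in every adapted coframe and
  so fixes the orientation without reference to one.\<close>

definition su3_volume :: "'e altform \<Rightarrow> 'e altform" where
  "su3_volume \<omega> = (\<lambda>v. wedge 2 4 \<omega> (wedge 2 2 \<omega> \<omega>) v / 6)"

lemma alternating_su3_volume:
  assumes "alternating_form 2 \<omega>"
  shows "alternating_form 6 (su3_volume \<omega>)"
  using alternating_form_scale[OF alternating_form_wedge[OF assms alternating_form_wedge[OF assms assms]], of "1/6"]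
  by (simp add: su3_volume_def)

lemma su3_volume_frame:
  assumes a: "su3_adapted e \<omega> \<psi>" and b: "frame_pair 6 (\<lambda>i. e (Suc i)) b"
  shows "su3_volume \<omega> b = 1"
proof -
  note eb = frame_pair_dual[OF b]
  note E = su3_adapted_expand[OF a]
  have alt: "alternating_form (Suc (Suc 0)) \<omega>" "alternating_form (Suc (Suc (Suc (Suc 0)))) (wedge (Suc (Suc 0)) (Suc (Suc 0))
        \<omega> \<omega>)"
    using E(3) alternating_form_wedge[OF E(3) E(3)] by (auto simp: numeral_eq_Suc)
  have w: "\<omega> v = (e 1 (v 0) * e 2 (v 1) - e 1 (v 1) * e 2 (v 0)) + (e 3 (v 0) * e 4 (v 1) - e 3 (v 1) * e 4 (v 0))
     + (e 5 (v 0) * e 6 (v 1) - e 5 (v 1) * e 6 (v 0))" for v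
    by (simp add: E(5) monomial_2 E(2) del: monomial.simps)
  have ev: "\<omega> (case_nat (b i) (case_nat (b j) v)) =
      (if i = 0 \<and> j = 1 \<or> i = 2 \<and> j = 3 \<or> i = 4 \<and> j = 5 then 1 else
       if i = 1 \<and> j = 0 \<or> i = 3 \<and> j = 2 \<or> i = 5 \<and> j = 4 then - 1 else 0)" if "i < 6" "j < 6" for i j v
    using that by (auto simp: w eb)
  have "su3_volume \<omega> b = su3_volume \<omega> (tup [b 0, b 1, b 2, b 3, b 4, b 5])"
    using alternating_form_tup[OF alternating_su3_volume[OF E(3)], of b] by (simp add: numeral_eq_Suc)
  also have "\<dots> = 1"
    by (simp add: su3_volume_def numeral_eq_Suc wedge_expand alt ev)
  finally show ?thesis .
qed

text \<open>This expresses \<open>J X\<close>, here called \<open>Y\<close>, by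
  \<open>\<omega>\<close> and \<open>\<psi>\<close> alone. Therefore \<open>J\<close> is the
  same for all adapted coframes, and it varies differentiably with the point if
  \<open>\<omega>\<close> and \<open>\<psi>\<close> do. Both sides are forms of degree 6, so
  their values on the dual frame decide.\<close>

lemma su3_J_identity:
  fixes \<psi> :: "'e::euclidean_space altform" and \<xi> :: "'e \<Rightarrow> real"
  assumes a: "su3_adapted e \<omega> \<psi>" and \<xi>: "linear \<xi>"
    and J: "e 1 Y = - e 2 X" "e 2 Y = e 1 X" "e 3 Y = - e 4 X" "e 4 Y = e 3 X" "e 5 Y = - e 6 X" "e 6 Y = e 5 X"
  shows "wedge 1 5 (\<lambda>v. \<xi> (v 0)) (wedge 2 3 (interior_product X \<psi>) \<psi>) v = - 2 * \<xi> Y * su3_volume \<omega> v"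
proof -
  note E = su3_adapted_expand[OF a]
  obtain b where b: "frame_pair 6 (\<lambda>i. e (Suc i)) b"
    using su3_adapted_frame[OF a] by blast
  note eb = frame_pair_dual[OF b]
  let ?L = "wedge 1 5 (\<lambda>v. \<xi> (v 0)) (wedge 2 3 (interior_product X \<psi>) \<psi>)"
  have alt: "alternating_form 1 (\<lambda>v. \<xi> (v 0))" "alternating_form 2 (interior_product X \<psi>)"
     "alternating_form 5 (wedge 2 3 (interior_product X \<psi>) \<psi>)" "alternating_form 6 ?L"
  proof -
    show 1: "alternating_form 1 (\<lambda>v. \<xi> (v 0))" using alternating_form_covector[OF \<xi>] by simp
    show 2: "alternating_form 2 (interior_product X \<psi>)"
      by (rule alternating_form_interior_product) (use E(4) in \<open>simp add: numeral_eq_Suc\<close>)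
    show 5: "alternating_form 5 (wedge 2 3 (interior_product X \<psi>) \<psi>)"
      using alternating_form_wedge[OF 2 E(4)] by simp
    show "alternating_form 6 ?L"
      using alternating_form_wedge[OF 1 5] by simp
  qed
  have p: "\<psi> (case_nat x (case_nat y (case_nat z v))) = monomial e [1,3,5] (tup [x,y,z]) - monomial e [1,4,6] (tup [x,y,z]) - monomial
        e [2,3,6] (tup [x,y,z])
             - monomial e [2,4,5] (tup [x,y,z])" for x y z v
    unfolding E(6) by (simp add: monomial_3 E(2) del: monomial.simps)
  have \<xi>Y: "\<xi> Y = - e 2 X * \<xi> (b 0) + e 1 X * \<xi> (b 1) - e 4 X * \<xi> (b 2) + e 3 X * \<xi> (b 3) - e 6 X * \<xi> (b 4) + e
        5 X * \<xi> (b 5)"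
  proof -
    have "Y = (\<Sum>i<6. e (Suc i) Y *\<^sub>R b i)" using b by (simp add: frame_pair_def)
    then have "\<xi> Y = \<xi> (\<Sum>i<6. e (Suc i) Y *\<^sub>R b i)" by (rule arg_cong)
    also have "\<dots> = (\<Sum>i<6. e (Suc i) Y * \<xi> (b i))"
      by (simp add: linear_sum[OF \<xi>] linear_scale[OF \<xi>])
    also have "\<dots> = e 1 Y * \<xi> (b 0) + e 2 Y * \<xi> (b 1) + e 3 Y * \<xi> (b 2) + e 4 Y * \<xi> (b 3) + e 5 Y * \<xi> (b 4) + e 6
          Y * \<xi> (b 5)"
      by (simp add: numeral_eq_Suc)
    finally show ?thesis by (simp add: J J(1)[simplified])
  qed
  have "?L b = ?L (tup [b 0, b 1, b 2, b 3, b 4, b 5])"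
    using alternating_form_tup[OF alt(4), of b] by (simp add: numeral_eq_Suc)
  also have "\<dots> = - 2 * \<xi> Y"
    unfolding \<xi>Y
    using alt E(4)
    by (simp add: wedge_expand p monomial_3 E(2) eb numeral_eq_Suc algebra_simps del: monomial.simps)
  also have "\<dots> = - 2 * \<xi> Y * su3_volume \<omega> b"
    by (simp add: su3_volume_frame[OF a b])
  finally have "?L b = - 2 * \<xi> Y * su3_volume \<omega> b" .
  then have "?L = (\<lambda>v. - 2 * \<xi> Y * su3_volume \<omega> v)"
    by (intro top_form_eq[OF b alt(4)] alternating_form_scale alternating_su3_volume E(3))
  then show ?thesis by (rule fun_cong)
qed

text \<open>In the complex coordinates \<open>e\<^sup>1 + i e\<^sup>2\<close>,
  \<open>e\<^sup>3 + i e\<^sup>4\<close>, \<open>e\<^sup>5 + i e\<^sup>6\<close>, the map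
  \<open>J\<close> is multiplication by \<open>i\<close>.\<close>

definition complex_rotation :: "(nat \<Rightarrow> 'e \<Rightarrow> real) \<Rightarrow> ('e \<Rightarrow> 'e) \<Rightarrow> bool" where
  "complex_rotation e J \<longleftrightarrow> (\<forall>x. e 1 (J x) = - e 2 x \<and> e 2 (J x) = e 1 x \<and>
     e 3 (J x) = - e 4 x \<and> e 4 (J x) = e 3 x \<and> e 5 (J x) = - e 6 x \<and> e 6 (J x) = e 5 x)"

lemma complex_rotation_exists:
  assumes a: "su3_adapted e \<omega> (\<psi> :: 'e::euclidean_space altform)"
  shows "\<exists>J. complex_rotation e J"
proof -
  obtain b where b: "frame_pair 6 (\<lambda>i. e (Suc i)) b"
    using su3_adapted_frame[OF a] by blast
  note eb = frame_pair_dual[OF b]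
  note lin = su3_adapted_expand(2)[OF a]
  have "e i (- e 2 x *\<^sub>R b 0 + e 1 x *\<^sub>R b 1 - e 4 x *\<^sub>R b 2 + e 3 x *\<^sub>R b 3 - e 6 x *\<^sub>R b 4 + e 5 x *\<^sub>R b 5) =
     (if i = 1 then - e 2 x else if i = 2 then e 1 x else if i = 3 then - e 4 x else if i = 4 then e 3 x
      else if i = 5 then - e 6 x else e 5 x)" if "1 \<le> i" "i \<le> 6" for i x
    using that
    by (simp add: linear_add[OF lin] linear_diff[OF lin] linear_neg[OF lin] linear_scale[OF lin] eb)
  then show ?thesis
    unfolding complex_rotation_def
    by (intro exI[of _ "\<lambda>x. - e 2 x *\<^sub>R b 0 + e 1 x *\<^sub>R b 1 - e 4 x *\<^sub>R b 2 + e 3 x *\<^sub>R b 3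
      - e 6 x *\<^sub>R b 4 + e 5 x *\<^sub>R b 5"]) simp
qed

text \<open>The left side of the identity above does not involve the coframe, and
  \<open>\<omega>\<^sup>3\<close> does not vanish. So \<open>\<xi> (J X) = \<xi> (J' X)\<close>
  for all covectors \<open>\<xi>\<close>.\<close>

lemma complex_rotation_unique:
  fixes \<psi> :: "'e::euclidean_space altform"
  assumes a: "su3_adapted e \<omega> \<psi>" "su3_adapted e' \<omega> \<psi>"
    and J: "complex_rotation e J" "complex_rotation e' J'"
  shows "J = J'"
proof
  fix X
  obtain b where b: "frame_pair 6 (\<lambda>i. e (Suc i)) b"
    using su3_adapted_frame[OF a(1)] by blast
  note eb = frame_pair_dual[OF b]
  have "\<xi> (J X) = \<xi> (J' X)" if \<xi>: "linear \<xi>" for \<xi> :: "'e \<Rightarrow> real"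
  proof -
    let ?W = "wedge 1 5 (\<lambda>v. \<xi> (v 0)) (wedge 2 3 (interior_product X \<psi>) \<psi>) b"
    have "?W = - 2 * \<xi> (J X) * su3_volume \<omega> b"
      by (rule su3_J_identity[OF a(1) \<xi>]) (use J(1) in \<open>simp_all add: complex_rotation_def\<close>)
    moreover have "?W = - 2 * \<xi> (J' X) * su3_volume \<omega> b"
      by (rule su3_J_identity[OF a(2) \<xi>]) (use J(2) in \<open>simp_all add: complex_rotation_def\<close>)
    ultimately have "- 2 * \<xi> (J X) * su3_volume \<omega> b = - 2 * \<xi> (J' X) * su3_volume \<omega> b"
      by simp
    then show ?thesis
      using su3_volume_frame[OF a(1) b] by simp
  qed
  from this[of "\<lambda>x. x \<bullet> (J X - J' X)"] have "(J X - J' X) \<bullet> (J X - J' X) = 0"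
    by (simp add: inner_diff_left linear_iff inner_add_left)
  then show "J X = J' X" by simp
qed

lemma su3_J_rotation:
  fixes \<psi> :: "'e::euclidean_space altform"
  assumes a: "su3_adapted e \<omega> \<psi>"
  shows "complex_rotation e (su3_J \<omega> \<psi>)"
proof -
  obtain J where J: "complex_rotation e J"
    using complex_rotation_exists[OF a] by blast
  have all: "complex_rotation e' J" if a': "su3_adapted e' \<omega> \<psi>" for e'
    using complex_rotation_exists[OF a'] complex_rotation_unique[OF a a' J] by auto
  have "su3_J \<omega> \<psi> = (THE J. \<forall>e. su3_adapted e \<omega> \<psi> \<longrightarrow> complex_rotation e J)"
    by (simp add: su3_J_def complex_rotation_def)
  also have "\<dots> = J"
    using all a complex_rotation_unique[OF a a _ J] by (intro the_equality) blast+
  finally show ?thesis using J by simp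
qed

text \<open>The second equation comes from the complex trilinearity of
  \<open>\<Psi> = \<psi>\<^sub>+ + i \<psi>\<^sub>-\<close>: applying \<open>J\<close> to one
  argument multiplies \<open>\<Psi>\<close> by \<open>i\<close>, applying it to all three
  multiplies by \<open>i\<^sup>3 = - i\<close>. It makes \<open>\<psi>\<^sub>-\<close> depend
  linearly on \<open>J\<close>.\<close>

lemma psi_minus_adapted:
  fixes \<psi> :: "'e::euclidean_space altform"
  assumes a: "su3_adapted e \<omega> \<psi>"
  shows "\<psi> (\<lambda>i. su3_J \<omega> \<psi> (v i)) = monomial e [1,3,6] v + monomial e [1,4,5] v + monomial e [2,3,5] v
      - monomial e [2,4,6] v"
    and "\<psi> (\<lambda>i. su3_J \<omega> \<psi> (v i)) = - \<psi> (tup [su3_J \<omega> \<psi> (v 0), v 1, v 2])"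
proof -
  note lin = su3_adapted_expand(2)[OF a] and p = su3_adapted_expand(6)[OF a]
  define J where "J = su3_J \<omega> \<psi>"
  have J: "e 1 (J x) = - e 2 x" "e 2 (J x) = e 1 x" "e 3 (J x) = - e 4 x" "e 4 (J x) = e 3 x"
     "e 5 (J x) = - e 6 x" "e 6 (J x) = e 5 x" "e (Suc 0) (J x) = - e 2 x" for x
    using su3_J_rotation[OF a] by (simp_all add: complex_rotation_def J_def)
  have 1: "\<psi> (\<lambda>i. J (v i)) = monomial e [1,3,6] v + monomial e [1,4,5] v + monomial e [2,3,5] v
      - monomial e [2,4,6] v"
    unfolding p by (simp add: monomial_3 lin J algebra_simps del: monomial.simps)
  then show "\<psi> (\<lambda>i. su3_J \<omega> \<psi> (v i)) = monomial e [1,3,6] v + monomial e [1,4,5] v + monomial e [2,3,5] v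
      - monomial e [2,4,6] v" by (simp add: J_def)
  have "- \<psi> (tup [J (v 0), v 1, v 2]) = monomial e [1,3,6] v + monomial e [1,4,5] v + monomial e [2,3,5] v
      - monomial e [2,4,6] v"
    unfolding p by (simp add: monomial_3 lin J algebra_simps del: monomial.simps)
  with 1 show "\<psi> (\<lambda>i. su3_J \<omega> \<psi> (v i)) = - \<psi> (tup [su3_J \<omega> \<psi> (v 0), v 1, v 2])"
    by (simp add: J_def)
qed

text \<open>Minors of the matrix of values of covectors (the rows) on vectors (the columns).
  They are the values of monomials, and turn identities between forms into polynomial
  identities.\<close>

definition det2 :: "(nat \<Rightarrow> real) \<Rightarrow> (nat \<Rightarrow> real) \<Rightarrow> nat \<Rightarrow> nat \<Rightarrow> real" where
  "det2 a b i j = a i * b j - a j * b i"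

definition det3 :: "(nat \<Rightarrow> real) \<Rightarrow> (nat \<Rightarrow> real) \<Rightarrow> (nat \<Rightarrow> real) \<Rightarrow>
      nat \<Rightarrow> nat \<Rightarrow> nat \<Rightarrow> real" where
  "det3 a b c i j k = a i * (b j * c k - b k * c j) - a j * (b i * c k - b k * c i)
     + a k * (b i * c j - b j * c i)"

text \<open>The value of the wedge product of a 2-form and a 3-form on five vectors, in terms of
  their values \<open>F\<close> and \<open>G\<close> on subsets of the vectors.\<close>

definition shuffle_2_3 :: "(nat \<Rightarrow> nat \<Rightarrow> real) \<Rightarrow> (nat \<Rightarrow> nat \<Rightarrow> nat \<Rightarrow>
      real) \<Rightarrow> real" where
  "shuffle_2_3 F G = F 0 1 * G 2 3 4 - F 0 2 * G 1 3 4 + F 0 3 * G 1 2 4 - F 0 4 * G 1 2 3 + F 1 2 * G 0 3 4 - F 1 3 * G 0 2 4 + F 1 4 * G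
        0 2 3 + F 2 3 * G 0 1 4 - F 2 4 * G 0 1 3 + F 3 4 * G 0 1 2"

text \<open>A wedge product of covectors with a repeated factor vanishes. One case is a
  polynomial identity, and the other positions of the repeated factor follow by
  reordering.\<close>

lemma shuffle_2_3_repeated_factor:
  "shuffle_2_3 (det2 a b) (det3 a c d) = 0" "shuffle_2_3 (det2 a b) (det3 c a d) = 0"
  "shuffle_2_3 (det2 a b) (det3 c d a) = 0" "shuffle_2_3 (det2 b a) (det3 a c d) = 0"
  "shuffle_2_3 (det2 b a) (det3 c a d) = 0" "shuffle_2_3 (det2 b a) (det3 c d a) = 0"
proof -
  have 1: "shuffle_2_3 (det2 a b) (det3 a c d) = 0" for a b c d
    unfolding shuffle_2_3_def det2_def det3_def by algebra
  have 2: "det2 b a = (\<lambda>i j. - det2 a b i j)" for a b by (simp add: det2_def fun_eq_iff)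
  have 3: "det3 c a d = (\<lambda>i j k. - det3 a c d i j k)" "det3 c d a = det3 a c d" for a c d
    by (simp_all add: det3_def fun_eq_iff algebra_simps)
  have 4: "shuffle_2_3 (\<lambda>i j. - F i j) G = - shuffle_2_3 F G" "shuffle_2_3 F (\<lambda>i j k. - G i j k) = - shuffle_2_3 F G" for F G
    by (simp_all add: shuffle_2_3_def)
  show "shuffle_2_3 (det2 a b) (det3 a c d) = 0" by (rule 1)
  show "shuffle_2_3 (det2 a b) (det3 c a d) = 0" unfolding 3(1)[of c a d] 4 1 by simp
  show "shuffle_2_3 (det2 a b) (det3 c d a) = 0" unfolding 3(2) 1 by simp
  show "shuffle_2_3 (det2 b a) (det3 a c d) = 0" unfolding 2[of b a] 4 1 by simp
  show "shuffle_2_3 (det2 b a) (det3 c a d) = 0" unfolding 2[of b a] 3(1)[of c a d] 4 1 by simp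
  show "shuffle_2_3 (det2 b a) (det3 c d a) = 0" unfolding 2[of b a] 3(2) 4 1 by simp
qed

text \<open>\<open>\<omega> \<and> \<psi>\<^sub>+ = 0\<close>, because each of the monomials of
  \<open>\<omega>\<close> has a factor in common with each of those of
  \<open>\<psi>\<^sub>+\<close>.\<close>

lemma su3_omega_wedge_psi:
  fixes \<psi> :: "'e::euclidean_space altform" and v :: "nat \<Rightarrow> 'e"
  assumes a: "su3_adapted e \<omega> \<psi>"
  shows "shuffle_2_3 (\<lambda>i j. \<omega> (tup [v i, v j])) (\<lambda>i j k. \<psi> (tup [v i, v j, v k])) = 0"
proof -
  note E = su3_adapted_expand[OF a]
  define x where "x i j = e i (v j)" for i j :: nat
  have w: "(\<lambda>i j. \<omega> (tup [v i, v j])) = (\<lambda>i j. det2 (x 1) (x 2) i j + det2 (x 3) (x 4) i j + det2 (x 5) (x 6) i j)"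
    by (simp add: E(5) monomial_2 E(2) det2_def x_def fun_eq_iff del: monomial.simps)
  have p: "(\<lambda>i j k. \<psi> (tup [v i, v j, v k])) = (\<lambda>i j k. det3 (x 1) (x 3) (x 5) i j k - det3 (x 1) (x 4) (x 6) i j k
     - det3 (x 2) (x 3) (x 6) i j k - det3 (x 2) (x 4) (x 5) i j k)"
    unfolding E(6) by (simp add: monomial_3 E(2) det3_def x_def fun_eq_iff del: monomial.simps)
  have add: "shuffle_2_3 (\<lambda>i j. F i j + F' i j) G = shuffle_2_3 F G + shuffle_2_3 F' G"
    and diff: "shuffle_2_3 F (\<lambda>i j k. G i j k - G' i j k) = shuffle_2_3 F G - shuffle_2_3 F G'" for F F' G G'
    by (simp_all add: shuffle_2_3_def algebra_simps)
  show ?thesis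
    unfolding w p add diff shuffle_2_3_repeated_factor by simp
qed

section \<open>Metric and Hodge star of a \<open>G\<^sub>2\<close>-form\<close>

lemma g2_adapted_expand:
  assumes "g2_adapted e (\<phi> :: 'e::euclidean_space altform)"
  shows "DIM('e) = 7"
    and "\<And>i. 1 \<le> i \<Longrightarrow> i \<le> 7 \<Longrightarrow> linear (e i)"
    and "alternating_form 3 \<phi>"
    and "\<phi> = (\<lambda>v. monomial e [1,2,7] v + monomial e [3,4,7] v + monomial e [5,6,7] v
             + monomial e [1,3,5] v - monomial e [1,4,6] v - monomial e [2,3,6] v
             - monomial e [2,4,5] v)"
proof -
  show D: "DIM('e) = 7" and p: "\<phi> = (\<lambda>v. monomial e [1,2,7] v + monomial e [3,4,7] v + monomial e [5,6,7] v
             + monomial e [1,3,5] v - monomial e [1,4,6] v - monomial e [2,3,6] v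
             - monomial e [2,4,5] v)"
    using assms by (simp_all add: g2_adapted_def)
  show lin: "\<And>i. 1 \<le> i \<Longrightarrow> i \<le> 7 \<Longrightarrow> linear (e i)"
    using assms by (simp add: g2_adapted_def coframe_def D)
  have "alternating_form (length [i, j, k]) (monomial e [i, j, k])"
    if "i \<in> {1..7}" "j \<in> {1..7}" "k \<in> {1..7}" for i j k
    using that lin by (intro alternating_form_monomial) auto
  then show "alternating_form 3 \<phi>"
    unfolding p by (intro alternating_form_add alternating_form_diff) (auto simp: numeral_3_eq_3 simp del: monomial.simps)
qed

lemma g2_adapted_frame:
  assumes "g2_adapted e (\<phi> :: 'e::euclidean_space altform)"
  obtains b where "frame_pair 7 (\<lambda>i. e (Suc i)) b"
  using assms coframe_dual_frame_exists[of e] by (auto simp: g2_adapted_def)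

definition coframe_metric :: "(nat \<Rightarrow> 'e \<Rightarrow> real) \<Rightarrow> nat \<Rightarrow> 'e \<Rightarrow> 'e \<Rightarrow> real" where
  "coframe_metric e n X Y = (\<Sum>i<n. e (Suc i) X * e (Suc i) Y)"

lemma coframe_metric_inner_product:
  assumes b: "frame_pair n (\<lambda>i. e (Suc i)) (b :: nat \<Rightarrow> 'e::real_vector)"
  shows "inner_product_on_space (coframe_metric e n)"
  unfolding inner_product_on_space_def
proof (intro conjI allI impI)
  have lin: "linear (e (Suc i))" if "i < n" for i using b that by (simp add: frame_pair_def)
  show "linear (coframe_metric e n x)" for x
    unfolding coframe_metric_def
    by (intro linear_compose_sum ballI linear_compose[OF lin, unfolded o_def]) (auto simp: linear_iff algebra_simps)
  show "coframe_metric e n x y = coframe_metric e n y x" for x y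
    by (simp add: coframe_metric_def mult.commute)
  fix x :: 'e assume "x \<noteq> 0"
  have "x = (\<Sum>i<n. e (Suc i) x *\<^sub>R b i)" using b by (simp add: frame_pair_def)
  then have "\<exists>i<n. e (Suc i) x \<noteq> 0"
    using \<open>x \<noteq> 0\<close> by (metis (no_types, lifting) lessThan_iff scale_zero_left sum.neutral)
  then obtain i where "i < n" "e (Suc i) x \<noteq> 0" by blast
  then show "coframe_metric e n x x > 0"
    unfolding coframe_metric_def by (intro sum_pos2[of _ i]) (auto simp: zero_less_mult_iff)
qed

lemma coframe_metric_orthonormal:
  assumes b: "frame_pair DIM('e) (\<lambda>i. e (Suc i)) (b :: nat \<Rightarrow> 'e::euclidean_space)"
  shows "orthonormal_frame (coframe_metric e DIM('e)) b"
proof -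
  have "e (Suc k) (b i) * e (Suc k) (b j) = (if k = i then if i = j then 1 else 0 else 0)"
    if "i < DIM('e)" "j < DIM('e)" "k < DIM('e)" for i j k
    using b that by (simp add: frame_pair_def)
  then have "coframe_metric e DIM('e) (b i) (b j) = (if i = j then 1 else 0)"
    if "i < DIM('e)" "j < DIM('e)" for i j
    using that by (simp add: coframe_metric_def)
  then show ?thesis by (simp add: orthonormal_frame_def)
qed

lemma monomial_3_increasing:
  assumes b: "frame_pair n (\<lambda>i. e (Suc i)) b"
    and "i < j" "j < k" "k < n" "p < q" "q < r" "r < n"
  shows "monomial e [Suc p, Suc q, Suc r] (tup [b i, b j, b k]) = (if i = p \<and> j = q \<and> k = r then 1 else 0)"
proof -
  have "linear (e (Suc m))" if "m < n" for m using b that by (simp add: frame_pair_def)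
  then have "monomial e [Suc p, Suc q, Suc r] (tup [b i, b j, b k]) =
      e (Suc p) (b i) * (e (Suc q) (b j) * e (Suc r) (b k) - e (Suc q) (b k) * e (Suc r) (b j))
    - e (Suc p) (b j) * (e (Suc q) (b i) * e (Suc r) (b k) - e (Suc q) (b k) * e (Suc r) (b i))
    + e (Suc p) (b k) * (e (Suc q) (b i) * e (Suc r) (b j) - e (Suc q) (b j) * e (Suc r) (b i))"
    using assms by (subst monomial_3) auto
  moreover have "e (Suc m) (b l) = (if m = l then 1 else 0)" if "m < n" "l < n" for m l
    using b that by (simp add: frame_pair_def)
  ultimately show ?thesis using assms by (auto simp del: monomial.simps)
qed

lemma monomial_4_increasing:
  assumes b: "frame_pair n (\<lambda>i. e (Suc i)) b"
    and "i < j" "j < k" "k < l" "l < n" "p < q" "q < r" "r < s" "s < n"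
  shows "monomial e [Suc p, Suc q, Suc r, Suc s] (tup [b i, b j, b k, b l]) =
    (if i = p \<and> j = q \<and> k = r \<and> l = s then 1 else 0)"
proof -
  have "linear (e (Suc m))" if "m < n" for m using b that by (simp add: frame_pair_def)
  moreover have "e (Suc m) (b l) = (if m = l then 1 else 0)" if "m < n" "l < n" for m l
    using b that by (simp add: frame_pair_def)
  ultimately show ?thesis
    using assms(2-) monomial_3_increasing[OF b]
    by (auto simp: monomial_4 simp del: monomial.simps tup.simps)
qed

lemma monomial_3_contract_increasing:
  assumes b: "frame_pair n (\<lambda>i. e (Suc i)) b"
    and "i < j" "j < n" "p < q" "q < r" "r < n"
  shows "monomial e [Suc p, Suc q, Suc r] (tup [x, b i, b j]) = e (Suc p) x * (if i = q \<and> j = r then 1 else 0)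
    - e (Suc q) x * (if i = p \<and> j = r then 1 else 0) + e (Suc r) x * (if i = p \<and> j = q then 1 else 0)"
proof -
  have lin: "linear (e (Suc m))" if "m < n" for m using b that by (simp add: frame_pair_def)
  have D: "e (Suc k) (b i) * e (Suc l) (b j) - e (Suc k) (b j) * e (Suc l) (b i) =
      (if i = k \<and> j = l then 1 else 0)" if "k < l" "l < n" for k l
    using b that assms(2,3) by (auto simp: frame_pair_def)
  have "monomial e [Suc p, Suc q, Suc r] (tup [x, b i, b j]) =
      e (Suc p) x * (e (Suc q) (b i) * e (Suc r) (b j) - e (Suc q) (b j) * e (Suc r) (b i))
    - e (Suc q) x * (e (Suc p) (b i) * e (Suc r) (b j) - e (Suc p) (b j) * e (Suc r) (b i))
    + e (Suc r) x * (e (Suc p) (b i) * e (Suc q) (b j) - e (Suc p) (b j) * e (Suc q) (b i))"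
    using assms lin by (subst monomial_3) (auto simp: algebra_simps)
  also have "\<dots> = e (Suc p) x * (if i = q \<and> j = r then 1 else 0)
    - e (Suc q) x * (if i = p \<and> j = r then 1 else 0) + e (Suc r) x * (if i = p \<and> j = q then 1 else 0)"
    unfolding D[OF \<open>q < r\<close> \<open>r < n\<close>] D[OF less_trans[OF \<open>p < q\<close> \<open>q < r\<close>] \<open>r < n\<close>]
      D[OF \<open>p < q\<close> less_trans[OF \<open>q < r\<close> \<open>r < n\<close>]] ..
  finally show ?thesis .
qed

text \<open>Each of the seven monomials of \<open>\<phi>\<close> leaves four frame vectors to
  \<open>P\<close>, with the sign of the shuffle.\<close>

lemma g2_wedge_4_3_frame:
  fixes \<phi> :: "'e::euclidean_space altform"
  assumes a: "g2_adapted e \<phi>" and P: "alternating_form 4 P"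
    and b: "frame_pair 7 (\<lambda>i. e (Suc i)) b"
  shows "wedge 4 3 P \<phi> b = P (tup [b 2, b 3, b 4, b 5]) + P (tup [b 0, b 1, b 4, b 5])
    + P (tup [b 0, b 1, b 2, b 3]) - P (tup [b 1, b 3, b 5, b 6]) + P (tup [b 1, b 2, b 4, b 6])
    + P (tup [b 0, b 3, b 4, b 6]) + P (tup [b 0, b 2, b 5, b 6])"
proof -
  note eb = frame_pair_dual[OF b]
  note E = g2_adapted_expand[OF a]
  \<comment> \<open>The expansion keeps the frame vectors in increasing order, so this table
    covers all values of \<open>\<phi>\<close> that occur.\<close>
  have ev: "\<phi> (case_nat (b i) (case_nat (b j) (case_nat (b k) v))) =
      (if i = 0 \<and> j = 1 \<and> k = 6 then 1 else 0) + (if i = 2 \<and> j = 3 \<and> k = 6 then 1 else 0) + (if i = 4 \<and> j = 5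
            \<and> k = 6 then 1 else 0) + (if i = 0 \<and> j = 2 \<and> k = 4 then 1 else 0) - (if i = 0 \<and> j = 3 \<and> k = 5 then 1
            else 0) - (if i = 1 \<and> j = 2 \<and> k = 5 then 1 else 0) - (if i = 1 \<and> j = 3 \<and> k = 4 then 1 else 0)"
    if "i < j" "j < k" "k < 7" for i j k v
  proof -
    have "\<phi> (case_nat (b i) (case_nat (b j) (case_nat (b k) v))) = \<phi> (tup [b i, b j, b k])"
      by (rule alternating_form_cong[OF E(3)]) (auto simp: less_Suc_eq numeral_eq_Suc)
    also have "\<dots> = (if i = 0 \<and> j = 1 \<and> k = 6 then 1 else 0) + (if i = 2 \<and> j = 3 \<and> k = 6 then 1 else 0) + (if i =
          4 \<and> j = 5 \<and> k = 6 then 1 else 0) + (if i = 0 \<and> j = 2 \<and> k = 4 then 1 else 0) - (if i = 0 \<and> j = 3 \<and> k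
          = 5 then 1 else 0) - (if i = 1 \<and> j = 2 \<and> k = 5 then 1 else 0) - (if i = 1 \<and> j = 3 \<and> k = 4 then 1 else 0)"
      using that monomial_3_increasing[OF b that, of 0 1 6] monomial_3_increasing[OF b that, of 2 3 6] monomial_3_increasing[OF b that, of
            4 5 6] monomial_3_increasing[OF b that, of 0 2 4] monomial_3_increasing[OF b that, of 0 3 5] monomial_3_increasing[OF b that,
            of 1 2 5] monomial_3_increasing[OF b that, of 1 3 4]
      by (simp add: E(4) numeral_eq_Suc del: monomial.simps tup.simps split del: if_split)
    finally show ?thesis .
  qed
  have trunc: "P (case_nat x (case_nat y (case_nat z (case_nat w (case_nat u r))))) = P (tup [x, y, z, w])"
    for x y z w u r
    by (rule alternating_form_cong[OF P]) (auto simp: less_Suc_eq numeral_eq_Suc)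
  have "alternating_form 7 (wedge 4 3 P \<phi>)"
    using alternating_form_wedge[OF P E(3)] by simp
  then have "wedge 4 3 P \<phi> b = wedge 4 3 P \<phi> (tup [b 0, b 1, b 2, b 3, b 4, b 5, b 6])"
    using alternating_form_tup[of 7 _ b] by (simp add: numeral_eq_Suc)
  also have "\<dots> = P (tup [b 2, b 3, b 4, b 5]) + P (tup [b 0, b 1, b 4, b 5])
    + P (tup [b 0, b 1, b 2, b 3]) - P (tup [b 1, b 3, b 5, b 6]) + P (tup [b 1, b 2, b 4, b 6])
    + P (tup [b 0, b 3, b 4, b 6]) + P (tup [b 0, b 2, b 5, b 6])"
    using P E(3) by (simp add: numeral_eq_Suc wedge_expand ev trunc[simplified])
  finally show ?thesis .
qed

text \<open>The left side is the bilinear form that defines the metric. On the dual frame it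
  turns out to be the standard inner product, so an adapted coframe is orthonormal.\<close>

lemma g2_metric_identity:
  fixes \<phi> :: "'e::euclidean_space altform"
  assumes a: "g2_adapted e \<phi>" and b: "frame_pair 7 (\<lambda>i. e (Suc i)) b"
  shows "wedge 4 3 (wedge 2 2 (interior_product X \<phi>) (interior_product Y \<phi>)) \<phi> b = 6 * coframe_metric e 7 X Y"
proof -
  note eb = frame_pair_dual[OF b]
  note E = g2_adapted_expand[OF a]
  have i2: "alternating_form 2 (interior_product X \<phi>)" for X
    by (rule alternating_form_interior_product) (use E(3) in \<open>simp add: numeral_eq_Suc\<close>)
  then have i2': "alternating_form (Suc (Suc 0)) (interior_product X \<phi>)" for X by (simp add: numeral_eq_Suc)
  have P: "alternating_form 4 (wedge 2 2 (interior_product X \<phi>) (interior_product Y \<phi>))"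
    using alternating_form_wedge[OF i2 i2] by simp
  \<comment> \<open>The table of the contraction \<open>i\<^sub>x \<phi>\<close>: the
    coefficient of each component of \<open>x\<close> is a 2-form with three monomials.\<close>
  let ?r = "\<lambda>x (i::nat) (j::nat). e 1 x * ((if i = 1 \<and> j = 6 then 1 else 0) + (if i = 2 \<and> j = 4 then 1 else 0) - (if i =
        3 \<and> j = 5 then 1 else 0)) +
     e 2 x * (- (if i = 0 \<and> j = 6 then 1 else 0) - (if i = 2 \<and> j = 5 then 1 else 0) - (if i = 3 \<and> j = 4 then 1 else 0)) +
     e 3 x * ((if i = 3 \<and> j = 6 then 1 else 0) - (if i = 0 \<and> j = 4 then 1 else 0) + (if i = 1 \<and> j = 5 then 1 else 0)) +
     e 4 x * (- (if i = 2 \<and> j = 6 then 1 else 0) + (if i = 0 \<and> j = 5 then 1 else 0) + (if i = 1 \<and> j = 4 then 1 else 0)) +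
     e 5 x * ((if i = 5 \<and> j = 6 then 1 else 0) + (if i = 0 \<and> j = 2 then 1 else 0) - (if i = 1 \<and> j = 3 then 1 else 0)) +
     e 6 x * (- (if i = 4 \<and> j = 6 then 1 else 0) - (if i = 0 \<and> j = 3 then 1 else 0) - (if i = 1 \<and> j = 2 then 1 else 0)) +
     e 7 x * ((if i = 0 \<and> j = 1 then 1 else 0) + (if i = 2 \<and> j = 3 then 1 else 0) + (if i = 4 \<and> j = 5 then 1 else 0))"
  have p: "\<phi> (case_nat x (case_nat (b i) (case_nat (b j) v))) = ?r x i j"
    if "i < j" "j < 7" for x i j v
  proof -
    have "\<phi> (case_nat x (case_nat (b i) (case_nat (b j) v))) = \<phi> (tup [x, b i, b j])"
      by (rule alternating_form_cong[OF E(3)]) (auto simp: less_Suc_eq numeral_eq_Suc)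
    also have "\<dots> = ?r x i j"
      using that monomial_3_contract_increasing[OF b that, of 0 1 6 x] monomial_3_contract_increasing[OF b that, of 2 3 6 x]
            monomial_3_contract_increasing[OF b that, of 4 5 6 x] monomial_3_contract_increasing[OF b that, of 0 2 4 x]
            monomial_3_contract_increasing[OF b that, of 0 3 5 x] monomial_3_contract_increasing[OF b that, of 1 2 5 x]
            monomial_3_contract_increasing[OF b that, of 1 3 4 x]
      by (simp add: E(4) numeral_eq_Suc del: monomial.simps tup.simps split del: if_split)
        (simp add: algebra_simps split del: if_split)
    finally show ?thesis .
  qed
  \<comment> \<open>The table stays folded until the indices of its entries are numerals;
    otherwise the six products in each value of the 4-form would be multiplied out in
    full.\<close>
  define r where "r = ?r"
  have Pv: "wedge 2 2 (interior_product X \<phi>) (interior_product Y \<phi>) (tup [b i, b j, b k, b l]) =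
      r X i j * r Y k l - r X i k * r Y j l + r X i l * r Y j k
    + r X j k * r Y i l - r X j l * r Y i k + r X k l * r Y i j"
    if "i < j" "j < k" "k < l" "l < 7" for i j k l
  proof -
    have q: "\<phi> (case_nat x (case_nat (b i) (case_nat (b j) v))) = r x i j" if "i < j" "j < 7" for x i j v
      unfolding r_def by (rule p[OF that])
    show ?thesis
      using that by (simp add: numeral_2_eq_2 wedge_expand i2' q)
  qed
  have "wedge 4 3 (wedge 2 2 (interior_product X \<phi>) (interior_product Y \<phi>)) \<phi> b = 6 *
      (e 1 X * e 1 Y + e 2 X * e 2 Y + e 3 X * e 3 Y + e 4 X * e 4 Y + e 5 X * e 5 Y + e 6 X * e 6 Y + e 7 X * e 7 Y)"
    unfolding g2_wedge_4_3_frame[OF a P b]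
    by (simp add: Pv del: tup.simps One_nat_def, simp add: r_def)
  then show ?thesis
    by (simp add: coframe_metric_def sum_lessThan_7 numeral_eq_Suc)
qed

lemma alternating_form_homogeneous:
  assumes "alternating_form k \<alpha>"
  shows "\<alpha> (\<lambda>i. r *\<^sub>R v i) = r ^ k * \<alpha> v"
  using assms
proof (induction k arbitrary: \<alpha> v)
  case 0
  then show ?case using alternating_form_cong[OF 0, of "\<lambda>i. r *\<^sub>R v i" v] by simp
next
  case (Suc k)
  have eq: "w = case_nat (w 0) (\<lambda>i. w (Suc i))" for w :: "nat \<Rightarrow> 'a"
    by (auto simp: fun_eq_iff split: nat.split)
  have "\<alpha> (\<lambda>i. r *\<^sub>R v i) = interior_product (r *\<^sub>R v 0) \<alpha> (\<lambda>i. r *\<^sub>R v (Suc i))"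
    unfolding interior_product_def by (rule arg_cong[where f = \<alpha>], rule eq)
  also have "\<dots> = r * interior_product (v 0) \<alpha> (\<lambda>i. r *\<^sub>R v (Suc i))"
    by (simp add: linear_scale[OF interior_product_linear[OF Suc.prems]])
  also have "\<dots> = r * (r ^ k * interior_product (v 0) \<alpha> (\<lambda>i. v (Suc i)))"
    by (simp add: Suc.IH[OF alternating_form_interior_product[OF Suc.prems]])
  also have "interior_product (v 0) \<alpha> (\<lambda>i. v (Suc i)) = \<alpha> v"
    unfolding interior_product_def eq[symmetric] ..
  finally show ?case by simp
qed

text \<open>Existence is the identity above, with \<open>vol\<close> the form that is 1 on the
  dual frame. As for uniqueness, the equation determines the product of \<open>g\<close> and
  \<open>vol\<close>, so any other solution is \<open>(g / c, c vol)\<close> with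
  \<open>c > 0\<close>. The frame scaled by \<open>sqrt c\<close> is orthonormal for
  \<open>g / c\<close>, and the value 1 of the volume form on it gives
  \<open>c (sqrt c)\<^sup>7 = 1\<close>.\<close>

lemma g2_metric_volume:
  fixes \<phi> :: "'e::euclidean_space altform"
  assumes a: "g2_adapted e \<phi>" and b: "frame_pair 7 (\<lambda>i. e (Suc i)) b"
  shows "g2_metric \<phi> = coframe_metric e 7"
    and "alternating_form 7 (g2_volume \<phi>)" "g2_volume \<phi> b = 1"
proof -
  note eb = frame_pair_dual[OF b]
  note E = g2_adapted_expand[OF a]
  define W where "W X Y = wedge 4 3 (wedge 2 2 (interior_product X \<phi>) (interior_product Y \<phi>)) \<phi>" for X Y
  have W: "alternating_form 7 (W X Y)" for X Y
  proof -
    have i2: "alternating_form 2 (interior_product X \<phi>)" for X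
      by (rule alternating_form_interior_product) (use E(3) in \<open>simp add: numeral_eq_Suc\<close>)
    show ?thesis
      unfolding W_def
      using alternating_form_wedge[OF alternating_form_wedge[OF i2 i2] E(3)] by simp
  qed
  let ?g = "coframe_metric e 7"
  have Wb: "W X Y b = 6 * ?g X Y" for X Y
    unfolding W_def by (rule g2_metric_identity[OF a b])
  \<comment> \<open>Any frame vector would do; the last one corresponds to \<open>dt\<close> on
    the cylinder.\<close>
  define vol where "vol v = 1 / 6 * W (b 6) (b 6) v" for v
  have vol: "alternating_form 7 vol"
    unfolding vol_def by (rule alternating_form_scale[OF W])
  have volb: "vol b = 1"
    by (simp add: vol_def Wb coframe_metric_def sum_lessThan_7 eb)
  have ip: "inner_product_on_space ?g"
    by (rule coframe_metric_inner_product[OF b])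
  have on: "orthonormal_frame ?g b"
    using coframe_metric_orthonormal[of e b] b by (simp add: E(1))
  have WV: "W X Y v = 6 * ?g X Y * vol v" for X Y v
  proof -
    have "W X Y = (\<lambda>v. 6 * ?g X Y * vol v)"
      by (rule top_form_eq[OF b W]) (simp_all add: alternating_form_scale vol Wb volb)
    then show ?thesis by simp
  qed
  have comp: "g2_compatible \<phi> ?g vol"
    unfolding g2_compatible_def
    using ip metric_volume_formI[OF ip on, of vol] vol volb WV by (simp add: E(1) W_def)
  have uniq: "g = ?g \<and> vol' = vol" if c: "g2_compatible \<phi> g vol'" for g vol'
  proof -
    have "g X Y * vol' v = ?g X Y * vol v" for X Y v
    proof -
      have "(\<lambda>v. g X Y * vol' v) = (\<lambda>v. 1 / 6 * W X Y v)"
        using c unfolding g2_compatible_def W_def by blast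
      from fun_cong[OF this, of v] show ?thesis using WV[of X Y v] by simp
    qed
    note eq = this
    define c where "c = vol' b"
    have ipg: "inner_product_on_space g" and mv: "metric_volume_form g vol'"
      using \<open>g2_compatible \<phi> g vol'\<close> by (auto simp: g2_compatible_def)
    have gb: "?g (b 0) (b 0) = 1"
      by (simp add: coframe_metric_def sum_lessThan_7 eb)
    then have "g (b 0) (b 0) * c = 1"
      using eq[of "b 0" "b 0" b] volb by (simp add: c_def)
    moreover have "b 0 \<noteq> 0"
    proof
      assume "b 0 = 0"
      then have "e 1 (b 0) = 0" using linear_0[OF E(2)[of 1]] by simp
      then show False by (simp add: eb)
    qed
    then have "g (b 0) (b 0) > 0" using ipg by (simp add: inner_product_on_space_def)
    ultimately have cpos: "c > 0" using zero_less_mult_pos[of "g (b 0) (b 0)" c] by simp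
    have g: "g X Y = ?g X Y / c" for X Y
      using eq[of X Y b] volb cpos by (simp add: c_def field_simps)
    have v: "vol' v = c * vol v" for v
      using eq[of "b 0" "b 0" v] gb cpos by (simp add: g field_simps)
    define r where "r = sqrt c"
    have r2: "r * r = c" and r0: "r \<ge> 0" using cpos by (auto simp: r_def)
    have "orthonormal_frame g (\<lambda>i. r *\<^sub>R b i)"
    proof -
      have sc: "?g (r *\<^sub>R x) (r *\<^sub>R y) = r * r * ?g x y" for r x y
        by (simp add: coframe_metric_def linear_scale[OF E(2)] sum_distrib_left algebra_simps)
      show ?thesis
        using on cpos unfolding orthonormal_frame_def g sc r2 by simp
    qed
    then have "\<bar>vol' (\<lambda>i. r *\<^sub>R b i)\<bar> = 1"
      using mv by (simp add: metric_volume_form_def)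
    then have "c * r ^ 7 = 1"
      using cpos r0 by (simp add: v alternating_form_homogeneous[OF vol] volb abs_mult)
    moreover have "r ^ 9 = (r * r) * r ^ 7" by (simp add: eval_nat_numeral)
    ultimately have "r ^ 9 = 1 ^ 9" unfolding r2 by simp
    then have "r = 1"
      by (rule power_eq_imp_eq_base) (use r0 in auto)
    then have "c = 1" using r2 by simp
    then show ?thesis using g v by (auto simp: fun_eq_iff)
  qed
  show "g2_metric \<phi> = ?g"
    unfolding g2_metric_def by (rule the_equality) (use comp uniq in blast)+
  have "g2_volume \<phi> = vol"
    unfolding g2_volume_def by (rule the_equality) (use comp uniq in blast)+
  then show "alternating_form 7 (g2_volume \<phi>)" "g2_volume \<phi> b = 1"
    using vol volb by simp_all
qed

lemma form_inner_add:
  "form_inner b k \<alpha> (\<lambda>v. \<beta> v + \<gamma> v) = form_inner b k \<alpha> \<beta> + form_inner b k \<alpha> \<gamma>"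
  "form_inner b k \<alpha> (\<lambda>v. \<beta> v - \<gamma> v) = form_inner b k \<alpha> \<beta> - form_inner b k \<alpha> \<gamma>"
  by (simp_all add: form_inner_def algebra_simps sum.distrib sum_subtractf add_divide_distrib diff_divide_distrib)

lemma wedge_diff_right:
  "wedge k l \<alpha> (\<lambda>v. \<beta> v - \<gamma> v) v = wedge k l \<alpha> \<beta> v - wedge k l \<alpha> \<gamma> v"
  by (simp add: wedge_def algebra_simps sum_subtractf diff_divide_distrib)

text \<open>The form \<open>*\<phi>\<close> in an adapted coframe: its monomials are
  complementary to those of \<open>\<phi>\<close>, with the signs that make the wedge product of
  each pair positive.\<close>

definition g2_dual :: "(nat \<Rightarrow> 'e \<Rightarrow> real) \<Rightarrow> 'e altform" where
  "g2_dual e = (\<lambda>v. monomial e [1,2,3,4] v + monomial e [1,2,5,6] v + monomial e [3,4,5,6] v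
     + monomial e [1,3,6,7] v + monomial e [1,4,5,7] v + monomial e [2,3,5,7] v - monomial e [2,4,6,7] v)"

lemma alternating_g2_dual:
  assumes "\<And>i. 1 \<le> i \<Longrightarrow> i \<le> 7 \<Longrightarrow> linear (e i)"
  shows "alternating_form 4 (g2_dual e)"
proof -
  have "alternating_form (length [i, j, k, l]) (monomial e [i, j, k, l])"
    if "i \<in> {1..7}" "j \<in> {1..7}" "k \<in> {1..7}" "l \<in> {1..7}" for i j k l
    using that assms by (intro alternating_form_monomial) auto
  then show ?thesis
    unfolding g2_dual_def
    by (intro alternating_form_add alternating_form_diff) (auto simp: eval_nat_numeral simp del: monomial.simps)
qed

text \<open>Both sides are the sum of the values of \<open>\<alpha>\<close> on the seven triples
  of frame vectors that occur in \<open>\<phi>\<close>, with the signs of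
  \<open>\<phi>\<close>.\<close>

lemma g2_dual_wedge_frame:
  fixes \<phi> :: "'e::euclidean_space altform"
  assumes a: "g2_adapted e \<phi>" and \<alpha>: "alternating_form 3 \<alpha>"
    and b: "frame_pair 7 (\<lambda>i. e (Suc i)) b"
  shows "wedge 3 4 \<alpha> (g2_dual e) b = form_inner b 3 \<alpha> \<phi>"
proof -
  note eb = frame_pair_dual[OF b]
  note E = g2_adapted_expand[OF a]
  have dual: "alternating_form 4 (g2_dual e)" by (rule alternating_g2_dual[OF E(2)])
  have ev: "g2_dual e (case_nat (b i) (case_nat (b j) (case_nat (b k) (case_nat (b l) v)))) =
      (if i = 0 \<and> j = 1 \<and> k = 2 \<and> l = 3 then 1 else 0) + (if i = 0 \<and> j = 1 \<and> k = 4 \<and> l = 5 then 1 else 0) +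
            (if i = 2 \<and> j = 3 \<and> k = 4 \<and> l = 5 then 1 else 0) + (if i = 0 \<and> j = 2 \<and> k = 5 \<and> l = 6 then 1 else
            0) + (if i = 0 \<and> j = 3 \<and> k = 4 \<and> l = 6 then 1 else 0) + (if i = 1 \<and> j = 2 \<and> k = 4 \<and> l = 6 then 1
            else 0) - (if i = 1 \<and> j = 3 \<and> k = 5 \<and> l = 6 then 1 else 0)"
    if "i < j" "j < k" "k < l" "l < 7" for i j k l v
  proof -
    have "g2_dual e (case_nat (b i) (case_nat (b j) (case_nat (b k) (case_nat (b l) v)))) = g2_dual e (tup [b i, b j, b k, b l])"
      by (rule alternating_form_cong[OF dual]) (auto simp: less_Suc_eq numeral_eq_Suc)
    also have "\<dots> = (if i = 0 \<and> j = 1 \<and> k = 2 \<and> l = 3 then 1 else 0) + (if i = 0 \<and> j = 1 \<and> k = 4 \<and> l = 5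
          then 1 else 0) + (if i = 2 \<and> j = 3 \<and> k = 4 \<and> l = 5 then 1 else 0) + (if i = 0 \<and> j = 2 \<and> k = 5 \<and> l =
          6 then 1 else 0) + (if i = 0 \<and> j = 3 \<and> k = 4 \<and> l = 6 then 1 else 0) + (if i = 1 \<and> j = 2 \<and> k = 4 \<and> l
          = 6 then 1 else 0) - (if i = 1 \<and> j = 3 \<and> k = 5 \<and> l = 6 then 1 else 0)"
      using that monomial_4_increasing[OF b that, of 0 1 2 3] monomial_4_increasing[OF b that, of 0 1 4 5] monomial_4_increasing[OF b that,
            of 2 3 4 5] monomial_4_increasing[OF b that, of 0 2 5 6] monomial_4_increasing[OF b that, of 0 3 4 6] monomial_4_increasing[OF
            b that, of 1 2 4 6] monomial_4_increasing[OF b that, of 1 3 5 6]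
      by (simp add: g2_dual_def numeral_eq_Suc del: monomial.simps tup.simps split del: if_split)
    finally show ?thesis .
  qed
  have trunc: "\<alpha> (case_nat x (case_nat y (case_nat z (case_nat u r)))) = \<alpha> (tup [x, y, z])"
    for x y z u r
    by (rule alternating_form_cong[OF \<alpha>]) (auto simp: less_Suc_eq numeral_eq_Suc)
  have "alternating_form 7 (wedge 3 4 \<alpha> (g2_dual e))"
    using alternating_form_wedge[OF \<alpha> dual] by simp
  then have "wedge 3 4 \<alpha> (g2_dual e) b = wedge 3 4 \<alpha> (g2_dual e) (tup [b 0, b 1, b 2, b 3, b 4, b 5, b 6])"
    using alternating_form_tup[of 7 _ b] by (simp add: numeral_eq_Suc)
  also have "\<dots> = \<alpha> (tup [b 0, b 1, b 6]) + \<alpha> (tup [b 2, b 3, b 6]) + \<alpha> (tup [b 4, b 5, b 6])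
      + \<alpha> (tup [b 0, b 2, b 4]) - \<alpha> (tup [b 0, b 3, b 5]) - \<alpha> (tup [b 1, b 2, b 5]) - \<alpha> (tup [b 1, b 3, b 4])"
    using \<alpha> dual by (simp add: numeral_eq_Suc wedge_expand ev trunc[simplified])
  also have "\<dots> = form_inner b 3 \<alpha> \<phi>"
  proof -
    have m: "form_inner b 3 \<alpha> (monomial e [i, j, k]) = \<alpha> (tup [b (i - 1), b (j - 1), b (k - 1)])"
      if "i \<in> {1..7}" "j \<in> {1..7}" "k \<in> {1..7}" for i j k
    proof -
      have "i - 1 < 7" "j - 1 < 7" "k - 1 < 7" "Suc (i - 1) = i" "Suc (j - 1) = j" "Suc (k - 1) = k"
        using that by auto
      then show ?thesis
        using form_inner_monomial_3[of e b \<alpha> "i - 1" "j - 1" "k - 1"] \<alpha> E(1,2) eb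
        by (simp del: monomial.simps tup.simps)
    qed
    show ?thesis
      unfolding E(4) form_inner_add by (simp add: m del: monomial.simps tup.simps)
  qed
  finally show ?thesis .
qed

text \<open>The value of \<open>\<gamma>\<close> on four distinct frame vectors is recovered by
  wedging with the monomial of the other three: all other summands vanish.\<close>

lemma wedge_3_4_nondegenerate:
  fixes \<gamma> :: "'e::real_vector altform" and b :: "nat \<Rightarrow> 'e"
  assumes b: "frame_pair 7 e b" and \<gamma>: "alternating_form 4 \<gamma>"
    and z: "\<And>\<alpha> v. alternating_form 3 \<alpha> \<Longrightarrow> wedge 3 4 \<alpha> \<gamma> v = 0"
  shows "\<gamma> v = 0"
proof (rule alternating_zero_on_frame[OF b \<gamma>])
  fix I :: "nat \<Rightarrow> nat" assume I: "\<And>i. i < 4 \<Longrightarrow> I i < 7"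
  show "\<gamma> (\<lambda>i. b (I i)) = 0"
  proof (cases "inj_on I {..<4}")
    case False
    then obtain i j where "i < 4" "j < 4" "i \<noteq> j" "I i = I j" by (auto simp: inj_on_def)
    then show ?thesis by (intro alternating_form_repeat[OF \<gamma>, of i j]) auto
  next
    case True
    then obtain \<sigma> where s: "\<sigma> permutes {..<7}" "\<And>i. i < 4 \<Longrightarrow> \<sigma> i = I i"
      using injection_extends_to_permutation[of I 4 7] I by auto
    \<comment> \<open>In the reordered frame the four vectors in question come first.\<close>
    define e' where "e' i = e (\<sigma> i)" for i
    define b' where "b' i = b (\<sigma> i)" for i
    have lin: "linear (e' i)" if "i < 7" for i
      using b[unfolded frame_pair_def] permutes_lessThan[OF s(1) that] unfolding e'_def by blast
    have eb: "e' i (b' j) = (if i = j then 1 else 0)" if "i < 7" "j < 7" for i j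
    proof -
      have "e (\<sigma> i) (b (\<sigma> j)) = (if \<sigma> i = \<sigma> j then 1 else 0)"
        using b[unfolded frame_pair_def] permutes_lessThan[OF s(1) that(1)] permutes_lessThan[OF s(1) that(2)]
        by blast
      then show ?thesis
        unfolding e'_def b'_def inj_eq[OF permutes_inj[OF s(1)]] .
    qed
    have m: "alternating_form 3 (monomial e' [4, 5, 6])"
    proof -
      have "alternating_form (length [4, 5, 6 :: nat]) (monomial e' [4, 5, 6])"
        by (rule alternating_form_monomial) (use lin in auto)
      then show ?thesis by (simp add: numeral_3_eq_3 del: monomial.simps)
    qed
    have m3: "monomial e' [4, 5, 6] v = e' 4 (v 0) * (e' 5 (v 1) * e' 6 (v 2) - e' 5 (v 2) * e' 6 (v 1))
    - e' 4 (v 1) * (e' 5 (v 0) * e' 6 (v 2) - e' 5 (v 2) * e' 6 (v 0))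
    + e' 4 (v 2) * (e' 5 (v 0) * e' 6 (v 1) - e' 5 (v 1) * e' 6 (v 0))" for v
      using lin by (intro monomial_3) auto
    define M where "M = monomial e' [4, 5, 6]"
    have ev: "M (case_nat (b' i) (case_nat (b' j) (case_nat (b' k) v))) =
       0" if "i < 7" "j < 7" "k < 7" "i < 4 \<or> j < 4 \<or> k < 4" for i j k v
      using that by (auto simp: m3 eb M_def simp del: monomial.simps)
    have M1: "M (case_nat (b' 4) (case_nat (b' 5) (case_nat (b' 6) v))) = 1" for v
      by (simp add: m3 eb M_def del: monomial.simps)
    \<comment> \<open>The vectors of the monomial are listed first, so that the one surviving
      shuffle is the identity.\<close>
    have "0 = wedge 3 4 M \<gamma> (tup [b' 4, b' 5, b' 6, b' 0, b' 1, b' 2, b' 3])"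
      using z[OF m] by (simp add: M_def)
    also have "\<dots> = \<gamma> (tup [b' 0, b' 1, b' 2, b' 3])"
      using \<gamma> m[folded M_def] M1 by (simp add: numeral_eq_Suc wedge_expand ev)
    also have "\<dots> = \<gamma> (\<lambda>i. b (I i))"
      by (rule alternating_form_cong[OF \<gamma>]) (auto simp: less_Suc_eq numeral_eq_Suc b'_def s(2))
    finally show ?thesis by simp
  qed
qed

lemma g2_hodge_star:
  fixes \<phi> :: "'e::euclidean_space altform"
  assumes a: "g2_adapted e \<phi>"
  shows "hodge_star (g2_metric \<phi>) (g2_volume \<phi>) 3 \<phi> = g2_dual e"
proof -
  note E = g2_adapted_expand[OF a]
  obtain b where b: "frame_pair 7 (\<lambda>i. e (Suc i)) b"
    using g2_adapted_frame[OF a] by blast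
  note eb = frame_pair_dual[OF b]
  note gv = g2_metric_volume[OF a b]
  have dual: "alternating_form 4 (g2_dual e)" by (rule alternating_g2_dual[OF E(2)])
  have ip: "inner_product_on_space (coframe_metric e 7)"
    by (rule coframe_metric_inner_product[OF b])
  have on: "orthonormal_frame (coframe_metric e 7) b"
    using coframe_metric_orthonormal[of e b] b by (simp add: E(1))
  define Q where "Q \<gamma> \<longleftrightarrow> alternating_form 4 \<gamma> \<and> (\<forall>\<alpha> c. alternating_form 3 \<alpha>
        \<and> orthonormal_frame (coframe_metric e 7) c \<longrightarrow>
        wedge 3 4 \<alpha> \<gamma> = (\<lambda>v. form_inner c 3 \<alpha> \<phi> * g2_volume \<phi> v))" for \<gamma>
  have "Q (g2_dual e)"
    unfolding Q_def
  proof (intro conjI allI impI dual)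
    fix \<alpha> :: "'e altform" and c assume "alternating_form 3 \<alpha> \<and> orthonormal_frame (coframe_metric e 7) c"
    then have \<alpha>: "alternating_form 3 \<alpha>" and c: "orthonormal_frame (coframe_metric e 7) c" by auto
    have f: "form_inner c 3 \<alpha> \<phi> = form_inner b 3 \<alpha> \<phi>"
      by (rule form_inner_frame_independent[OF ip c on \<alpha> E(3)])
    have w: "alternating_form 7 (wedge 3 4 \<alpha> (g2_dual e))"
      using alternating_form_wedge[OF \<alpha> dual] by simp
    have "wedge 3 4 \<alpha> (g2_dual e) b = form_inner b 3 \<alpha> \<phi>"
      by (rule g2_dual_wedge_frame[OF a \<alpha> b])
    then show "wedge 3 4 \<alpha> (g2_dual e) = (\<lambda>v. form_inner c 3 \<alpha> \<phi> * g2_volume \<phi> v)"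
      unfolding f by (intro top_form_eq[OF b w] alternating_form_scale gv(2)) (simp add: gv(3))
  qed
  moreover have "\<gamma> = g2_dual e" if "Q \<gamma>" for \<gamma>
  proof -
    have \<gamma>: "alternating_form 4 \<gamma>" using that by (simp add: Q_def)
    have "wedge 3 4 \<alpha> (\<lambda>v. \<gamma> v - g2_dual e v) v = 0" if \<alpha>: "alternating_form 3 \<alpha>" for \<alpha> v
    proof -
      have "wedge 3 4 \<alpha> \<beta> v = form_inner b 3 \<alpha> \<phi> * g2_volume \<phi> v" if "Q \<beta>" for \<beta>
      proof -
        have "wedge 3 4 \<alpha> \<beta> = (\<lambda>v. form_inner b 3 \<alpha> \<phi> * g2_volume \<phi> v)"
          using that \<alpha> on unfolding Q_def by blast
        then show ?thesis by simp
      qed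
      then show ?thesis
        using \<open>Q \<gamma>\<close> \<open>Q (g2_dual e)\<close> by (simp add: wedge_diff_right)
    qed
    from wedge_3_4_nondegenerate[OF b alternating_form_diff[OF \<gamma> dual] this]
    show ?thesis by (simp add: fun_eq_iff)
  qed
  ultimately have "(THE \<gamma>. Q \<gamma>) = g2_dual e" by (rule the_equality)
  then show ?thesis
    by (simp add: hodge_star_def gv(1) E(1) Q_def)
qed

section \<open>Smooth functions and the symmetry of second derivatives\<close>

abbreviation dir_deriv :: "('a::real_normed_vector \<Rightarrow> 'b::real_normed_vector) \<Rightarrow> 'a \<Rightarrow> 'a \<Rightarrow> 'b" where
  "dir_deriv f x v \<equiv> frechet_derivative f (at x) v"

lemma has_derivative_dir_deriv:
  assumes "f differentiable (at x)"
  shows "(f has_derivative dir_deriv f x) (at x)"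
  using assms by (simp add: frechet_derivative_works[symmetric])

lemma dir_deriv_eq:
  assumes "(f has_derivative f') (at x)"
  shows "dir_deriv f x v = f' v"
  using frechet_derivative_at[OF assms] by simp

lemma dir_deriv_cong_open:
  assumes "open S" "x \<in> S" "\<And>y. y \<in> S \<Longrightarrow> f y = g y"
  shows "dir_deriv f x v = dir_deriv g x v"
proof -
  have "(f has_derivative f') (at x) \<longleftrightarrow> (g has_derivative f') (at x)" for f'
    using assms has_derivative_transform_within_open[of f f' x UNIV S g]
      has_derivative_transform_within_open[of g f' x UNIV S f] by auto
  then show ?thesis by (simp add: frechet_derivative_def)
qed

lemma differentiable_cong_open:
  assumes "f differentiable (at x)" "open S" "x \<in> S" "\<And>y. y \<in> S \<Longrightarrow> f y = g y"
  shows "g differentiable (at x)"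
  using assms has_derivative_transform_within_open[of f _ x UNIV S g] unfolding differentiable_def by blast

lemma C_k_on_subset:
  assumes "C_k_on k S f" "T \<subseteq> S"
  shows "C_k_on k T f"
  using assms
proof (induction k arbitrary: f)
  case 0
  then show ?case using continuous_on_subset[of S f T] by simp
next
  case (Suc k)
  then show ?case by auto
qed

lemma C_k_on_local:
  assumes "\<And>x. x \<in> S \<Longrightarrow> \<exists>T. open T \<and> x \<in> T \<and> C_k_on k T f"
  shows "C_k_on k S f"
  using assms
proof (induction k arbitrary: f)
  case 0
  have "isCont f x" if "x \<in> S" for x
    using 0[OF that] continuous_on_eq_continuous_at by (auto simp: continuous_on_eq_continuous_at)
  then show ?case by (simp add: continuous_at_imp_continuous_on)
next
  case (Suc k)
  have "f differentiable (at x)" if "x \<in> S" for x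
    using Suc.prems[OF that] by auto
  moreover have "C_k_on k S (\<lambda>x. dir_deriv f x v)" for v
    by (rule Suc.IH) (use Suc.prems in fastforce)
  ultimately show ?case by simp
qed

lemma C_k_on_cong:
  assumes "open S" "\<And>x. x \<in> S \<Longrightarrow> f x = g x" "C_k_on k S f"
  shows "C_k_on k S g"
  using assms(2,3)
proof (induction k arbitrary: f g)
  case 0
  then show ?case using continuous_on_cong[of S S f g] by simp
next
  case (Suc k)
  have "g differentiable (at x)" if "x \<in> S" for x
    by (rule differentiable_cong_open[of f x S]) (use Suc.prems assms(1) that in auto)
  moreover have "C_k_on k S (\<lambda>x. dir_deriv g x v)" for v
  proof (rule Suc.IH)
    show "dir_deriv f x v = dir_deriv g x v" if "x \<in> S" for x
      by (rule dir_deriv_cong_open[OF assms(1) that]) (rule Suc.prems(1))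
    show "C_k_on k S (\<lambda>x. dir_deriv f x v)" using Suc.prems(2) by simp
  qed
  ultimately show ?case by simp
qed

lemma C_k_on_Suc_imp:
  "C_k_on (Suc k) S f \<Longrightarrow> C_k_on k S f"
proof (induction k arbitrary: f)
  case 0
  then show ?case
    by (auto intro!: continuous_at_imp_continuous_on differentiable_imp_continuous_within)
next
  case (Suc k)
  have "C_k_on k S (\<lambda>x. dir_deriv f x v)" for v
    by (rule Suc.IH) (use Suc.prems in simp)
  then show ?case using Suc.prems by simp
qed

lemma C_k_on_const: "C_k_on k S (\<lambda>_. c)"
proof (induction k arbitrary: c)
  case (Suc k)
  have "dir_deriv (\<lambda>_. c) x v = 0" for x v :: 'a
    by (rule dir_deriv_eq[where f' = "\<lambda>_. 0"]) simp
  then show ?case using Suc by simp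
qed simp

lemma C_k_on_bounded_linear:
  assumes "bounded_linear L"
  shows "C_k_on k S L"
proof (cases k)
  case 0
  then show ?thesis using linear_continuous_on[OF assms] by simp
next
  case (Suc k)
  have "dir_deriv L x v = L v" for x v
    by (rule dir_deriv_eq) (rule bounded_linear_imp_has_derivative[OF assms])
  then show ?thesis
    using Suc assms by (simp add: C_k_on_const bounded_linear_imp_differentiable)
qed

lemma C_k_on_add:
  assumes "open S" "C_k_on k S f" "C_k_on k S g"
  shows "C_k_on k S (\<lambda>x. f x + g x)"
  using assms(2,3)
proof (induction k arbitrary: f g)
  case 0
  then show ?case by (simp add: continuous_on_add)
next
  case (Suc k)
  have "C_k_on k S (\<lambda>x. dir_deriv (\<lambda>x. f x + g x) x v)" for v
  proof (rule C_k_on_cong[OF assms(1)])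
    show "C_k_on k S (\<lambda>x. dir_deriv f x v + dir_deriv g x v)"
      by (rule Suc.IH) (use Suc.prems in simp_all)
    show "dir_deriv f x v + dir_deriv g x v = dir_deriv (\<lambda>x. f x + g x) x v" if "x \<in> S" for x
      using Suc.prems that
      by (intro dir_deriv_eq[symmetric] has_derivative_add has_derivative_dir_deriv) auto
  qed
  then show ?case using Suc.prems by simp
qed

lemma C_k_on_sum:
  assumes "open S" "finite A" "\<And>i. i \<in> A \<Longrightarrow> C_k_on k S (f i)"
  shows "C_k_on k S (\<lambda>x. \<Sum>i\<in>A. f i x)"
  using assms(2,3) by (induction A rule: finite_induct) (auto simp: C_k_on_const C_k_on_add[OF assms(1)])

lemma C_k_on_linear_compose:
  assumes "open S" "bounded_linear L" "C_k_on k S f"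
  shows "C_k_on k S (\<lambda>x. L (f x))"
  using assms(3)
proof (induction k arbitrary: f)
  case 0
  then show ?case using bounded_linear.continuous_on[OF assms(2)] by simp
next
  case (Suc k)
  have d: "((\<lambda>x. L (f x)) has_derivative (\<lambda>v. L (dir_deriv f x v))) (at x)" if "x \<in> S" for x
    using Suc.prems that by (intro bounded_linear.has_derivative[OF assms(2)] has_derivative_dir_deriv) auto
  have "C_k_on k S (\<lambda>x. dir_deriv (\<lambda>x. L (f x)) x v)" for v
    by (rule C_k_on_cong[OF assms(1), of "\<lambda>x. L (dir_deriv f x v)"])
      (use Suc dir_deriv_eq[OF d] in auto)
  then show ?case using d by (auto simp: differentiable_def)
qed

lemma C_k_on_scaleR:
  assumes "open S" "C_k_on k S f" "C_k_on k S g"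
  shows "C_k_on k S (\<lambda>x. f x *\<^sub>R g x)"
  using assms(2,3)
proof (induction k arbitrary: f g)
  case 0
  then show ?case by (simp add: continuous_on_scaleR)
next
  case (Suc k)
  have d: "((\<lambda>x. f x *\<^sub>R g x) has_derivative (\<lambda>v. f x *\<^sub>R dir_deriv g x v + dir_deriv f x v *\<^sub>R g x)) (at x)"
    if "x \<in> S" for x
    using Suc.prems that by (intro has_derivative_scaleR has_derivative_dir_deriv) auto
  have "C_k_on k S (\<lambda>x. dir_deriv (\<lambda>x. f x *\<^sub>R g x) x v)" for v
  proof (rule C_k_on_cong[OF assms(1)])
    show "C_k_on k S (\<lambda>x. f x *\<^sub>R dir_deriv g x v + dir_deriv f x v *\<^sub>R g x)"
      by (intro C_k_on_add[OF assms(1)] Suc.IH C_k_on_Suc_imp[OF Suc.prems(1)] C_k_on_Suc_imp[OF Suc.prems(2)])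
        (use Suc.prems in simp_all)
    show "f x *\<^sub>R dir_deriv g x v + dir_deriv f x v *\<^sub>R g x = dir_deriv (\<lambda>x. f x *\<^sub>R g x) x v" if "x \<in> S" for x
      by (rule dir_deriv_eq[OF d[OF that], symmetric])
  qed
  then show ?case using d by (auto simp: differentiable_def)
qed

text \<open>By the chain rule \<open>D(g \<circ> f) v = Dg (Df v)\<close>, where the direction
  \<open>Df v\<close> moves with the point, whereas the class \<open>C\<^sup>k\<close> is
  defined with fixed directions. Expanding the moving direction in the standard basis leaves
  sums of products to which the induction hypothesis applies.\<close>

lemma C_k_on_compose:
  fixes f :: "'a::euclidean_space \<Rightarrow> 'b::euclidean_space" and g :: "'b \<Rightarrow> 'c::real_normed_vector"
  assumes "open S" "C_k_on k T g" "C_k_on k S f" "f ` S \<subseteq> T"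
  shows "C_k_on k S (\<lambda>x. g (f x))"
  using assms(2,3)
proof (induction k arbitrary: g)
  case 0
  then show ?case using continuous_on_compose2[of T g S f] assms(4) by simp
next
  case (Suc k)
  have d: "((\<lambda>x. g (f x)) has_derivative (\<lambda>v. dir_deriv g (f x) (dir_deriv f x v))) (at x)" if "x \<in> S" for x
    using Suc.prems that assms(4) by (intro has_derivative_compose[of f _ x UNIV g] has_derivative_dir_deriv) auto
  have "C_k_on k S (\<lambda>x. dir_deriv (\<lambda>x. g (f x)) x v)" for v
  proof (rule C_k_on_cong[OF assms(1)])
    show "C_k_on k S (\<lambda>x. \<Sum>b\<in>Basis. (dir_deriv f x v \<bullet> b) *\<^sub>R dir_deriv g (f x) b)"
    proof (intro C_k_on_sum[OF assms(1)] C_k_on_scaleR[OF assms(1)])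
      show "C_k_on k S (\<lambda>x. dir_deriv f x v \<bullet> b)" for b
        by (rule C_k_on_linear_compose[OF assms(1) bounded_linear_inner_left]) (use Suc.prems in simp)
      show "C_k_on k S (\<lambda>x. dir_deriv g (f x) b)" for b
        by (rule Suc.IH) (use Suc.prems C_k_on_Suc_imp[OF Suc.prems(2)] in simp_all)
    qed simp
    show "(\<Sum>b\<in>Basis. (dir_deriv f x v \<bullet> b) *\<^sub>R dir_deriv g (f x) b) = dir_deriv (\<lambda>x. g (f x)) x v"
      if x: "x \<in> S" for x
    proof -
      have "g differentiable (at (f x))" using Suc.prems(1) assms(4) x by auto
      then have lin: "linear (dir_deriv g (f x))" by (rule linear_frechet_derivative)
      have "dir_deriv (\<lambda>x. g (f x)) x v = dir_deriv g (f x) (\<Sum>b\<in>Basis. (dir_deriv f x v \<bullet> b) *\<^sub>R b)"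
        by (simp add: dir_deriv_eq[OF d[OF x]] euclidean_representation)
      also have "\<dots> = (\<Sum>b\<in>Basis. (dir_deriv f x v \<bullet> b) *\<^sub>R dir_deriv g (f x) b)"
        by (simp add: linear_sum[OF lin] linear_scale[OF lin])
      finally show ?thesis by simp
    qed
  qed
  then show ?case using d by (auto simp: differentiable_def)
qed

lemma smooth_on_subset: "smooth_on S f \<Longrightarrow> T \<subseteq> S \<Longrightarrow> smooth_on T f"
  unfolding smooth_on_def using C_k_on_subset by blast

lemma smooth_on_local:
  assumes "\<And>x. x \<in> S \<Longrightarrow> \<exists>T. open T \<and> x \<in> T \<and> smooth_on T f"
  shows "smooth_on S f"
  unfolding smooth_on_def
proof
  fix k show "C_k_on k S f"
    by (rule C_k_on_local) (use assms in \<open>force simp: smooth_on_def\<close>)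
qed

lemma smooth_on_cong:
  assumes "open S" "\<And>x. x \<in> S \<Longrightarrow> f x = g x" "smooth_on S f"
  shows "smooth_on S g"
  using assms C_k_on_cong[of S f g] unfolding smooth_on_def by blast

lemma smooth_on_const: "smooth_on S (\<lambda>_. c)"
  by (simp add: smooth_on_def C_k_on_const)

lemma smooth_on_bounded_linear: "bounded_linear L \<Longrightarrow> smooth_on S L"
  by (simp add: smooth_on_def C_k_on_bounded_linear)

lemma smooth_on_add: "open S \<Longrightarrow> smooth_on S f \<Longrightarrow> smooth_on S g \<Longrightarrow> smooth_on S (\<lambda>x. f x + g x)"
  by (simp add: smooth_on_def C_k_on_add)

lemma smooth_on_linear_compose:
  "open S \<Longrightarrow> bounded_linear L \<Longrightarrow> smooth_on S f \<Longrightarrow> smooth_on S (\<lambda>x. L (f x))"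
  by (simp add: smooth_on_def C_k_on_linear_compose)

lemma smooth_on_compose:
  fixes f :: "'a::euclidean_space \<Rightarrow> 'b::euclidean_space" and g :: "'b \<Rightarrow> 'c::real_normed_vector"
  assumes "open S" "smooth_on T g" "smooth_on S f" "f ` S \<subseteq> T"
  shows "smooth_on S (\<lambda>x. g (f x))"
  using assms by (simp add: smooth_on_def C_k_on_compose[of S _ T])

text \<open>A pair is a sum of two linear images of its components.\<close>

lemma smooth_on_Pair:
  assumes "open S" "smooth_on S f" "smooth_on S g"
  shows "smooth_on S (\<lambda>x. (f x, g x))"
proof -
  have "bounded_linear (\<lambda>x. (x, 0))" "bounded_linear (\<lambda>x. (0, x))"
    by (auto intro!: bounded_linear_Pair bounded_linear_ident bounded_linear_zero)
  from smooth_on_add[OF assms(1) smooth_on_linear_compose[OF assms(1) this(1) assms(2)]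
      smooth_on_linear_compose[OF assms(1) this(2) assms(3)]]
  show ?thesis by simp
qed

lemma smooth_on_differentiable: "smooth_on S f \<Longrightarrow> x \<in> S \<Longrightarrow> f differentiable (at x)"
  unfolding smooth_on_def using C_k_on.simps(2)[of 0 S f] by blast

lemma smooth_on_dir_deriv: "smooth_on S f \<Longrightarrow> smooth_on S (\<lambda>x. dir_deriv f x v)"
  unfolding smooth_on_def using C_k_on.simps(2)[of _ S f] by blast

lemma smooth_on_continuous: "smooth_on S f \<Longrightarrow> continuous_on S f"
  unfolding smooth_on_def using C_k_on.simps(1)[of S f] by blast

text \<open>The mean value theorem, first for the difference \<open>f (y + h v) - f y\<close>
  along \<open>u\<close> and then, along \<open>v\<close>, for the derivative in the direction
  \<open>u\<close>.\<close>

lemma second_difference: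
  fixes f :: "'a::real_normed_vector \<Rightarrow> real"
  assumes h: "h > 0"
    and f: "\<And>s t. 0 \<le> s \<Longrightarrow> s \<le> h \<Longrightarrow> 0 \<le> t \<Longrightarrow> t \<le> h \<Longrightarrow> f
          differentiable (at (x + s *\<^sub>R u + t *\<^sub>R v))"
    and df: "\<And>s t. 0 \<le> s \<Longrightarrow> s \<le> h \<Longrightarrow> 0 \<le> t \<Longrightarrow> t \<le> h \<Longrightarrow>
      (\<lambda>y. dir_deriv f y u) differentiable (at (x + s *\<^sub>R u + t *\<^sub>R v))"
  shows "\<exists>s t. 0 < s \<and> s < h \<and> 0 < t \<and> t < h \<and>
    f (x + h *\<^sub>R u + h *\<^sub>R v) - f (x + h *\<^sub>R u) - f (x + h *\<^sub>R v) + f x =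
    h * h * dir_deriv (\<lambda>y. dir_deriv f y u) (x + s *\<^sub>R u + t *\<^sub>R v) v"
proof -
  have line: "((\<lambda>r. g (p + r *\<^sub>R w)) has_real_derivative dir_deriv g (p + r *\<^sub>R w) w) (at r)"
    if "g differentiable (at (p + r *\<^sub>R w))" for g :: "'a \<Rightarrow> real" and p w r
  proof -
    have "((\<lambda>r. p + r *\<^sub>R w) has_derivative (\<lambda>r. r *\<^sub>R w)) (at r)"
      by (auto intro!: derivative_eq_intros)
    from has_derivative_compose[OF this has_derivative_dir_deriv[OF that]]
    show ?thesis
      using linear_scale[OF linear_frechet_derivative[OF that]]
      by (simp add: has_field_derivative_def mult.commute[of _ "dir_deriv _ _ _"])
  qed
  define g where "g s = f (x + s *\<^sub>R u + h *\<^sub>R v) - f (x + s *\<^sub>R u)" for s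
  define g' where "g' s = dir_deriv f (x + s *\<^sub>R u + h *\<^sub>R v) u - dir_deriv f (x + s *\<^sub>R u) u" for s
  have "(g has_real_derivative g' s) (at s)" if "0 \<le> s" "s \<le> h" for s
  proof -
    have "((\<lambda>s. f ((x + h *\<^sub>R v) + s *\<^sub>R u)) has_real_derivative dir_deriv f ((x + h *\<^sub>R v) + s *\<^sub>R u) u) (at s)"
      using f[of s h] that h by (intro line) (simp add: algebra_simps)
    moreover have "((\<lambda>s. f (x + s *\<^sub>R u)) has_real_derivative dir_deriv f (x + s *\<^sub>R u) u) (at s)"
      using f[of s 0] that h by (intro line) simp
    ultimately have "((\<lambda>s. f ((x + h *\<^sub>R v) + s *\<^sub>R u) - f (x + s *\<^sub>R u)) has_real_derivative
        dir_deriv f ((x + h *\<^sub>R v) + s *\<^sub>R u) u - dir_deriv f (x + s *\<^sub>R u) u) (at s)"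
      by (rule DERIV_diff)
    then show ?thesis by (simp add: g_def[abs_def] g'_def add.assoc add.left_commute add.commute[of "h *\<^sub>R v"])
  qed
  then obtain s where s: "0 < s" "s < h" "g h - g 0 = (h - 0) * g' s"
    using MVT2[OF h, of g g'] by blast
  have "((\<lambda>t. dir_deriv f (x + s *\<^sub>R u + t *\<^sub>R v) u) has_real_derivative
      dir_deriv (\<lambda>y. dir_deriv f y u) (x + s *\<^sub>R u + t *\<^sub>R v) v) (at t)" if "0 \<le> t" "t \<le> h" for t
    using df[of s t] that s by (intro line[of "\<lambda>y. dir_deriv f y u"]) simp
  then obtain t where t: "0 < t" "t < h"
    "dir_deriv f (x + s *\<^sub>R u + h *\<^sub>R v) u - dir_deriv f (x + s *\<^sub>R u + 0 *\<^sub>R v) u =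
      (h - 0) * dir_deriv (\<lambda>y. dir_deriv f y u) (x + s *\<^sub>R u + t *\<^sub>R v) v"
    using MVT2[OF h, of "\<lambda>t. dir_deriv f (x + s *\<^sub>R u + t *\<^sub>R v) u"
      "\<lambda>t. dir_deriv (\<lambda>y. dir_deriv f y u) (x + s *\<^sub>R u + t *\<^sub>R v) v"] by blast
  have "f (x + h *\<^sub>R u + h *\<^sub>R v) - f (x + h *\<^sub>R u) - f (x + h *\<^sub>R v) + f x = g h - g 0"
    by (simp add: g_def)
  also have "\<dots> = h * h * dir_deriv (\<lambda>y. dir_deriv f y u) (x + s *\<^sub>R u + t *\<^sub>R v) v"
    using s(3) t(3) by (simp add: g'_def)
  finally show ?thesis using s t by blast
qed

text \<open>The second difference over the parallelogram spanned by \<open>h u\<close> and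
  \<open>h v\<close> is symmetric in \<open>u\<close> and \<open>v\<close>. It is
  \<open>h\<^sup>2\<close> times either mixed derivative, taken at points that approach
  \<open>x\<close> as \<open>h\<close> tends to 0.\<close>

lemma second_derivative_symmetric_real:
  fixes f :: "'a::euclidean_space \<Rightarrow> real"
  assumes S: "open S" "x \<in> S" and f: "smooth_on S f"
  shows "dir_deriv (\<lambda>y. dir_deriv f y u) x v = dir_deriv (\<lambda>y. dir_deriv f y v) x u"
proof -
  define F where "F u v y = dir_deriv (\<lambda>y. dir_deriv f y u) y v" for u v y
  have cont: "isCont (F u v) x" for u v
    using smooth_on_continuous[OF smooth_on_dir_deriv[OF smooth_on_dir_deriv[OF f]], of u v] S
    by (simp add: F_def[abs_def] continuous_on_eq_continuous_at)
  have "\<bar>F u v x - F v u x\<bar> \<le> 2 * \<epsilon>" if e: "\<epsilon> > 0" for \<epsilon>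
  proof -
    obtain d1 where d1: "d1 > 0" "\<And>y. dist y x < d1 \<Longrightarrow> dist (F u v y) (F u v x) < \<epsilon>"
      using cont[of u v] e unfolding continuous_at_eps_delta by blast
    obtain d2 where d2: "d2 > 0" "\<And>y. dist y x < d2 \<Longrightarrow> dist (F v u y) (F v u x) < \<epsilon>"
      using cont[of v u] e unfolding continuous_at_eps_delta by blast
    obtain d3 where d3: "d3 > 0" "ball x d3 \<subseteq> S"
      using S open_contains_ball by blast
    define d where "d = min d1 (min d2 d3)"
    have d: "d > 0" using d1 d2 d3 by (simp add: d_def)
    \<comment> \<open>With this \<open>h\<close> the parallelogram lies in the ball of radius
      \<open>d\<close>; the summand 1 in \<open>N\<close> only keeps the denominator
      positive.\<close>
    define N where "N = norm u + norm v + 1"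
    have N: "N > 0" by (simp add: N_def add_nonneg_pos)
    define h where "h = d / (2 * N)"
    have h: "h > 0" using d N by (simp add: h_def)
    have near: "dist (x + s *\<^sub>R a + t *\<^sub>R b) x < d"
      if "0 \<le> s" "s \<le> h" "0 \<le> t" "t \<le> h" "{a, b} = {u, v}" for s t a b
    proof -
      have "norm (s *\<^sub>R a + t *\<^sub>R b) \<le> s * norm a + t * norm b"
        using that by (intro norm_triangle_le) simp
      also have "\<dots> \<le> h * norm a + h * norm b"
        using that by (intro add_mono mult_right_mono) auto
      also have "\<dots> \<le> h * N"
        using that(5) h by (auto simp: N_def doubleton_eq_iff algebra_simps)
      also have "\<dots> = d / 2" using N by (simp add: h_def)
      also have "\<dots> < d" using d by simp
      finally show ?thesis by (simp add: dist_norm)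
    qed
    have inS: "y \<in> S" if "dist y x < d" for y
      using that d3 by (auto simp: d_def dist_commute)
    have mean: "\<exists>\<xi>. dist \<xi> x < d \<and>
        f (x + h *\<^sub>R a + h *\<^sub>R b) - f (x + h *\<^sub>R a) - f (x + h *\<^sub>R b) + f x = h * h * F a b \<xi>"
      if ab: "{a, b} = {u, v}" for a b
    proof -
      have inS': "x + s *\<^sub>R a + t *\<^sub>R b \<in> S" if "0 \<le> s" "s \<le> h" "0 \<le> t" "t \<le> h" for s t
        by (rule inS[OF near[OF that ab]])
      obtain s t where "0 < s" "s < h" "0 < t" "t < h"
        "f (x + h *\<^sub>R a + h *\<^sub>R b) - f (x + h *\<^sub>R a) - f (x + h *\<^sub>R b) + f x =
          h * h * F a b (x + s *\<^sub>R a + t *\<^sub>R b)"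
        using second_difference[OF h smooth_on_differentiable[OF f inS']
            smooth_on_differentiable[OF smooth_on_dir_deriv[OF f] inS']]
        unfolding F_def by auto
      then show ?thesis
        using near[of s t a b] ab by (intro exI[of _ "x + s *\<^sub>R a + t *\<^sub>R b"]) simp
    qed
    obtain \<xi> where 1: "dist \<xi> x < d"
      "f (x + h *\<^sub>R u + h *\<^sub>R v) - f (x + h *\<^sub>R u) - f (x + h *\<^sub>R v) + f x = h * h * F u v \<xi>"
      using mean[of u v] by auto
    obtain \<eta> where 2: "dist \<eta> x < d"
      "f (x + h *\<^sub>R v + h *\<^sub>R u) - f (x + h *\<^sub>R v) - f (x + h *\<^sub>R u) + f x = h * h * F v u \<eta>"
      using mean[of v u] by auto
    have eq: "x + h *\<^sub>R v + h *\<^sub>R u = x + h *\<^sub>R u + h *\<^sub>R v" by simp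
    have "h * h * F u v \<xi> = h * h * F v u \<eta>"
      using 1(2) 2(2)[unfolded eq] by linarith
    then have "F u v \<xi> = F v u \<eta>" using h by simp
    moreover have "\<bar>F u v \<xi> - F u v x\<bar> < \<epsilon>"
      using d1(2)[of \<xi>] 1(1) by (simp add: d_def dist_real_def)
    moreover have "\<bar>F v u \<eta> - F v u x\<bar> < \<epsilon>"
      using d2(2)[of \<eta>] 2(1) by (simp add: d_def dist_real_def)
    ultimately show ?thesis by linarith
  qed
  note bound = this
  have "\<bar>F u v x - F v u x\<bar> \<le> 0"
  proof (rule field_le_epsilon)
    fix \<epsilon> :: real assume "0 < \<epsilon>"
    then show "\<bar>F u v x - F v u x\<bar> \<le> 0 + \<epsilon>" using bound[of "\<epsilon> / 2"] by simp
  qed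
  then show ?thesis by (simp add: F_def)
qed

lemma second_derivative_symmetric:
  fixes f :: "'a::euclidean_space \<Rightarrow> 'b::euclidean_space"
  assumes S: "open S" "x \<in> S" and f: "smooth_on S f"
  shows "dir_deriv (\<lambda>y. dir_deriv f y u) x v = dir_deriv (\<lambda>y. dir_deriv f y v) x u"
proof (rule euclidean_eqI)
  fix b :: 'b
  have 1: "dir_deriv (\<lambda>y. g y \<bullet> b) y w = dir_deriv g y w \<bullet> b" if "g differentiable (at y)" for g :: "'a
        \<Rightarrow> 'b" and y w
    by (rule dir_deriv_eq) (intro has_derivative_inner_left has_derivative_dir_deriv that)
  have 2: "dir_deriv (\<lambda>y. dir_deriv (\<lambda>y. f y \<bullet> b) y u) x v = dir_deriv (\<lambda>y. dir_deriv f y u) x v \<bullet> b" for u v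
  proof -
    have "dir_deriv (\<lambda>y. dir_deriv (\<lambda>y. f y \<bullet> b) y u) x v = dir_deriv (\<lambda>y. dir_deriv f y u \<bullet> b) x v"
      by (rule dir_deriv_cong_open[OF S]) (rule 1[OF smooth_on_differentiable[OF f]])
    also have "\<dots> = dir_deriv (\<lambda>y. dir_deriv f y u) x v \<bullet> b"
      by (rule 1[OF smooth_on_differentiable[OF smooth_on_dir_deriv[OF f] S(2)]])
    finally show ?thesis .
  qed
  have "smooth_on S (\<lambda>y. f y \<bullet> b)"
    by (rule smooth_on_linear_compose[OF S(1) bounded_linear_inner_left f])
  from second_derivative_symmetric_real[OF S this, of u v]
  show "dir_deriv (\<lambda>y. dir_deriv f y u) x v \<bullet> b = dir_deriv (\<lambda>y. dir_deriv f y v) x u \<bullet> b"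
    by (simp add: 2)
qed

section \<open>The exterior derivative in coordinates\<close>

text \<open>The exterior derivative of a field of forms on an open set of the model space, such
  as one coordinate expression of a form on a manifold.\<close>

definition ext_d :: "nat \<Rightarrow> ('e::euclidean_space \<Rightarrow> 'e altform) \<Rightarrow> 'e \<Rightarrow> 'e altform" where
  "ext_d k a x v = (\<Sum>i\<le>k. (- 1) ^ i * dir_deriv (\<lambda>y. a y (\<lambda>j. if j < i then v j else v (Suc j))) x (v i))"

lemma ext_deriv_ext_d: "ext_deriv k \<alpha> c x v = ext_d k (\<alpha> c) x v"
  by (simp add: ext_deriv_def ext_d_def)

lemma ext_d_tup:
  assumes "open U" "x \<in> U" "\<And>y. y \<in> U \<Longrightarrow> alternating_form k (a y)"
  shows "ext_d k a x v = (\<Sum>i\<le>k. (- 1) ^ i *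
    dir_deriv (\<lambda>y. a y (tup (map (\<lambda>j. if j < i then v j else v (Suc j)) [0..<k]))) x (v i))"
  unfolding ext_d_def
  by (intro sum.cong refl arg_cong2[where f = "(*)"] dir_deriv_cong_open[OF assms(1,2)]
      alternating_form_tup assms(3))

lemma ext_d_2:
  assumes "open U" "x \<in> U" "\<And>y. y \<in> U \<Longrightarrow> alternating_form 2 (a y)"
  shows "ext_d 2 a x v = dir_deriv (\<lambda>y. a y (tup [v 1, v 2])) x (v 0)
    - dir_deriv (\<lambda>y. a y (tup [v 0, v 2])) x (v 1) + dir_deriv (\<lambda>y. a y (tup [v 0, v 1])) x (v 2)"
  using ext_d_tup[where v = v, OF assms] by (simp add: numeral_eq_Suc del: tup.simps)

lemma ext_d_3:
  assumes "open U" "x \<in> U" "\<And>y. y \<in> U \<Longrightarrow> alternating_form 3 (a y)"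
  shows "ext_d 3 a x v = dir_deriv (\<lambda>y. a y (tup [v 1, v 2, v 3])) x (v 0)
    - dir_deriv (\<lambda>y. a y (tup [v 0, v 2, v 3])) x (v 1) + dir_deriv (\<lambda>y. a y (tup [v 0, v 1, v 3])) x (v 2)
    - dir_deriv (\<lambda>y. a y (tup [v 0, v 1, v 2])) x (v 3)"
  using ext_d_tup[where v = v, OF assms] by (simp add: numeral_eq_Suc del: tup.simps)

text \<open>\<open>3 d\<psi> = dd\<omega> = 0\<close>: the second derivatives of
  \<open>\<omega>\<close> cancel in pairs, by their symmetry.\<close>

lemma ext_d_exact:
  fixes w p :: "'e::euclidean_space \<Rightarrow> 'e altform"
  assumes U: "open U" and x: "x \<in> U" and w: "\<And>y. y \<in> U \<Longrightarrow> alternating_form 2 (w y)"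
    and p: "\<And>y. y \<in> U \<Longrightarrow> alternating_form 3 (p y)"
    and sm: "\<And>v. smooth_on U (\<lambda>y. w y v)"
    and dw: "\<And>y v. y \<in> U \<Longrightarrow> ext_d 2 w y v = 3 * p y v"
  shows "ext_d 3 p x v = 0"
proof -
  define S where "S b c a d = dir_deriv (\<lambda>y. dir_deriv (\<lambda>z. w z (tup [b, c])) y a) x d" for a b c d
  have sym: "S b c a d = S b c d a" for a b c d
    unfolding S_def by (rule second_derivative_symmetric[OF U x sm])
  \<comment> \<open>Near \<open>x\<close> the values of \<open>p\<close> are first derivatives
    of those of \<open>w\<close>, so its derivatives are second derivatives of
    \<open>w\<close>.\<close>
  have P: "dir_deriv (\<lambda>y. p y (tup [a, b, c])) x d = (S b c a d - S a c b d + S a b c d) / 3" for a b c d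
  proof -
    have "dir_deriv (\<lambda>y. p y (tup [a, b, c])) x d =
      dir_deriv (\<lambda>y. (1 / 3) *\<^sub>R (dir_deriv (\<lambda>z. w z (tup [b, c])) y a - dir_deriv (\<lambda>z. w z (tup [a, c])) y b
         + dir_deriv (\<lambda>z. w z (tup [a, b])) y c)) x d"
    proof (rule dir_deriv_cong_open[OF U x])
      fix y assume y: "y \<in> U"
      show "p y (tup [a, b, c]) = (1 / 3) *\<^sub>R (dir_deriv (\<lambda>z. w z (tup [b, c])) y a - dir_deriv (\<lambda>z. w z (tup [a, c])) y b
         + dir_deriv (\<lambda>z. w z (tup [a, b])) y c)"
        using dw[OF y, of "tup [a, b, c]"] ext_d_2[where v = "tup [a, b, c]", OF U y w] by (simp add: numeral_eq_Suc)
    qed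
    also have "\<dots> = (1 / 3) *\<^sub>R (S b c a d - S a c b d + S a b c d)"
      unfolding S_def
      by (rule dir_deriv_eq)
        (intro has_derivative_scaleR_right has_derivative_add has_derivative_diff has_derivative_dir_deriv
          smooth_on_differentiable[OF smooth_on_dir_deriv[OF sm] x])
    finally show ?thesis by simp
  qed
  have "ext_d 3 p x v = dir_deriv (\<lambda>y. p y (tup [v 1, v 2, v 3])) x (v 0)
    - dir_deriv (\<lambda>y. p y (tup [v 0, v 2, v 3])) x (v 1) + dir_deriv (\<lambda>y. p y (tup [v 0, v 1, v 3])) x (v 2)
    - dir_deriv (\<lambda>y. p y (tup [v 0, v 1, v 2])) x (v 3)"
    by (rule ext_d_3[OF U x p])
  then show ?thesis
    using sym[of "v 2" "v 3" "v 0" "v 1"] sym[of "v 1" "v 3" "v 0" "v 2"] sym[of "v 1" "v 2" "v 0" "v 3"]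
      sym[of "v 0" "v 3" "v 1" "v 2"] sym[of "v 0" "v 2" "v 1" "v 3"] sym[of "v 0" "v 1" "v 2" "v 3"]
    unfolding P add_divide_distrib diff_divide_distrib by simp
qed

lemma alternating_2_bilinear:
  assumes "alternating_form 2 \<alpha>"
  shows "linear (\<lambda>a. \<alpha> (tup [a, b]))" "linear (\<lambda>b. \<alpha> (tup [a, b]))" "\<alpha> (tup [b, a]) = - \<alpha> (tup [a, b])"
proof -
  have eq: "(tup [0, b])(0 := a) = tup [a, b]" "(tup [a, 0])(1 := b) = tup [a, b]" for a b :: 'a
    by (auto simp: fun_eq_iff split: nat.split)
  show "linear (\<lambda>a. \<alpha> (tup [a, b]))"
    using alternating_form_linear[OF assms, of 0 "tup [0, b]"] unfolding eq by simp
  show "linear (\<lambda>b. \<alpha> (tup [a, b]))"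
    using alternating_form_linear[OF assms, of 1 "tup [a, 0]"] unfolding eq by simp
  have "\<alpha> (\<lambda>m. tup [a, b] (Transposition.transpose 0 1 m)) = \<alpha> (tup [b, a])"
    by (rule alternating_form_cong[OF assms]) (auto simp: less_Suc_eq numeral_eq_Suc Transposition.transpose_def)
  then show "\<alpha> (tup [b, a]) = - \<alpha> (tup [a, b])"
    using alternating_form_transpose[OF assms, of 0 1 "tup [a, b]"] by simp
qed

lemma alternating_2_basis_expansion:
  fixes \<alpha> :: "'e::euclidean_space altform"
  assumes "alternating_form 2 \<alpha>"
  shows "\<alpha> (tup [a, b]) = (\<Sum>p\<in>Basis. \<Sum>q\<in>Basis. (a \<bullet> p) * ((b \<bullet> q) * \<alpha> (tup [p, q])))"
proof -
  note lin = alternating_2_bilinear(1,2)[OF assms]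
  have "\<alpha> (tup [a, b]) = \<alpha> (tup [\<Sum>p\<in>Basis. (a \<bullet> p) *\<^sub>R p, b])"
    by (simp add: euclidean_representation)
  also have "\<dots> = (\<Sum>p\<in>Basis. (a \<bullet> p) * \<alpha> (tup [p, b]))"
    by (simp only: linear_sum[OF lin(1)] linear_scale[OF lin(1)] real_scaleR_def)
  also have "\<dots> = (\<Sum>p\<in>Basis. (a \<bullet> p) * (\<Sum>q\<in>Basis. (b \<bullet> q) * \<alpha> (tup [p, q])))"
  proof (intro sum.cong refl arg_cong2[where f = "(*)"])
    fix p
    have "\<alpha> (tup [p, b]) = \<alpha> (tup [p, \<Sum>q\<in>Basis. (b \<bullet> q) *\<^sub>R q])"
      by (simp add: euclidean_representation)
    then show "\<alpha> (tup [p, b]) = (\<Sum>q\<in>Basis. (b \<bullet> q) * \<alpha> (tup [p, q]))"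
      by (simp only: linear_sum[OF lin(2)] linear_scale[OF lin(2)] real_scaleR_def)
  qed
  finally show ?thesis by (simp only: sum_distrib_left)
qed

text \<open>The product rule for the value of a 2-form at a moving point on two moving vectors.
  In a fixed basis this value is a sum of products of three scalar functions.\<close>

lemma moving_form_has_derivative:
  fixes w :: "'f::euclidean_space \<Rightarrow> 'f altform" and h A B :: "'e::euclidean_space \<Rightarrow> 'f"
  assumes U: "open U" "x \<in> U" and V: "open V" "h ` U \<subseteq> V"
    and w: "\<And>z. z \<in> V \<Longrightarrow> alternating_form 2 (w z)"
    and dw: "\<And>v. (\<lambda>z. w z v) differentiable (at (h x))"
    and h: "(h has_derivative H) (at x)" and A: "(A has_derivative A') (at x)" and B: "(B has_derivative B') (at x)"
  shows "dir_deriv (\<lambda>y. w (h y) (tup [A y, B y])) x d =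
    dir_deriv (\<lambda>z. w z (tup [A x, B x])) (h x) (H d) + w (h x) (tup [A' d, B x]) + w (h x) (tup [A x, B' d])"
proof -
  note exp = alternating_2_basis_expansion[OF w]
  have hx: "h x \<in> V" using U V by auto
  have D1: "dir_deriv (\<lambda>y. w (h y) (tup [A y, B y])) x d =
    dir_deriv (\<lambda>y. \<Sum>p\<in>Basis. \<Sum>q\<in>Basis. (A y \<bullet> p) * ((B y \<bullet> q) * w (h y) (tup [p, q]))) x d"
    by (rule dir_deriv_cong_open[OF U], rule exp) (use V in auto)
  have comp: "((\<lambda>y. w (h y) v) has_derivative (\<lambda>d. dir_deriv (\<lambda>z. w z v) (h x) (H d))) (at x)" for v
    by (rule has_derivative_compose[OF h has_derivative_dir_deriv[OF dw]])
  have D2: "dir_deriv (\<lambda>y. \<Sum>p\<in>Basis. \<Sum>q\<in>Basis. (A y \<bullet> p) * ((B y \<bullet> q) * w (h y) (tup [p, q]))) x d =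
    (\<Sum>p\<in>Basis. \<Sum>q\<in>Basis. (A x \<bullet> p) * ((B x \<bullet> q) * dir_deriv (\<lambda>z. w z (tup [p, q])) (h x) (H d)
        + (B' d \<bullet> q) * w (h x) (tup [p, q])) + (A' d \<bullet> p) * ((B x \<bullet> q) * w (h x) (tup [p, q])))"
    by (rule dir_deriv_eq)
      (intro has_derivative_sum has_derivative_mult has_derivative_inner_left A B comp)
  have D3: "dir_deriv (\<lambda>z. w z (tup [A x, B x])) (h x) (H d) =
      (\<Sum>p\<in>Basis. \<Sum>q\<in>Basis. (A x \<bullet> p) * ((B x \<bullet> q) * dir_deriv (\<lambda>z. w z (tup [p, q])) (h x) (H d)))"
  proof -
    have "dir_deriv (\<lambda>z. w z (tup [A x, B x])) (h x) (H d) =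
      dir_deriv (\<lambda>z. \<Sum>p\<in>Basis. \<Sum>q\<in>Basis. (A x \<bullet> p) * ((B x \<bullet> q) * w z (tup [p, q]))) (h x) (H d)"
      by (rule dir_deriv_cong_open[OF V(1) hx], rule exp)
    also have "\<dots> = (\<Sum>p\<in>Basis. \<Sum>q\<in>Basis. (A x \<bullet> p) * ((B x \<bullet> q) * dir_deriv (\<lambda>z. w z (tup
          [p, q])) (h x) (H d)))"
      by (rule dir_deriv_eq) (intro has_derivative_sum has_derivative_mult_right has_derivative_dir_deriv dw)
    finally show ?thesis .
  qed
  show ?thesis
    unfolding D1 D2 D3 exp[OF hx, of "A' d" "B x"] exp[OF hx, of "A x" "B' d"]
    by (simp add: algebra_simps sum.distrib del: tup.simps)
qed

text \<open>\<open>d\<close> commutes with the pullback by \<open>h\<close>. Differentiating the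
  pullback also differentiates the two vectors \<open>Dh v\<close>; the resulting terms contain
  second derivatives of \<open>h\<close>, which are symmetric, in a slot of an alternating form,
  and cancel in the alternating sum.\<close>

lemma ext_d_2_pullback:
  fixes w :: "'e::euclidean_space \<Rightarrow> 'e altform" and w' :: "'f::euclidean_space \<Rightarrow> 'f altform"
  assumes U: "open U" "x \<in> U" and V: "open V" "h ` U \<subseteq> V" and h: "smooth_on U h"
    and w: "\<And>y. y \<in> U \<Longrightarrow> alternating_form 2 (w y)" and w': "\<And>z. z \<in> V \<Longrightarrow> alternating_form 2 (w' z)"
    and sm: "\<And>v. smooth_on V (\<lambda>z. w' z v)"
    and pb: "\<And>y. y \<in> U \<Longrightarrow> w y = pullback_field h w' y"
  shows "ext_d 2 w x v = ext_d 2 w' (h x) (\<lambda>i. dir_deriv h x (v i))"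
proof -
  define H where "H a b = dir_deriv (\<lambda>y. dir_deriv h y b) x a" for a b
  have sym: "H a b = H b a" for a b
    unfolding H_def by (rule second_derivative_symmetric[OF U h])
  have hx: "h x \<in> V" using U V by auto
  have D: "dir_deriv (\<lambda>y. w y (tup [b, c])) x a =
      dir_deriv (\<lambda>z. w' z (tup [dir_deriv h x b, dir_deriv h x c])) (h x) (dir_deriv h x a)
      + w' (h x) (tup [H a b, dir_deriv h x c]) + w' (h x) (tup [dir_deriv h x b, H a c])" for a b c
  proof -
    have "dir_deriv (\<lambda>y. w y (tup [b, c])) x a = dir_deriv (\<lambda>y. w' (h y) (tup [dir_deriv h y b, dir_deriv h y c])) x a"
    proof (rule dir_deriv_cong_open[OF U])
      fix y assume y: "y \<in> U"
      then have "h y \<in> V" using V by auto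
      show "w y (tup [b, c]) = w' (h y) (tup [dir_deriv h y b, dir_deriv h y c])"
        unfolding pb[OF y] pullback_field_def
        by (rule alternating_form_cong[OF w'[OF \<open>h y \<in> V\<close>]]) (auto simp: less_Suc_eq numeral_eq_Suc)
    qed
    also have "\<dots> = dir_deriv (\<lambda>z. w' z (tup [dir_deriv h x b, dir_deriv h x c])) (h x) (dir_deriv h x a)
      + w' (h x) (tup [H a b, dir_deriv h x c]) + w' (h x) (tup [dir_deriv h x b, H a c])"
      unfolding H_def
      by (rule moving_form_has_derivative[OF U V w' smooth_on_differentiable[OF sm hx]])
        (intro has_derivative_dir_deriv smooth_on_differentiable[OF h U(2)]
          smooth_on_differentiable[OF smooth_on_dir_deriv[OF h] U(2)] | assumption)+
    finally show ?thesis .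
  qed
  note anti = alternating_2_bilinear(3)[OF w'[OF hx]]
  have "ext_d 2 w x v = dir_deriv (\<lambda>y. w y (tup [v 1, v 2])) x (v 0)
    - dir_deriv (\<lambda>y. w y (tup [v 0, v 2])) x (v 1) + dir_deriv (\<lambda>y. w y (tup [v 0, v 1])) x (v 2)"
    by (rule ext_d_2[OF U w])
  moreover have "ext_d 2 w' (h x) (\<lambda>i. dir_deriv h x (v i)) =
      dir_deriv (\<lambda>y. w' y (tup [dir_deriv h x (v 1), dir_deriv h x (v 2)])) (h x) (dir_deriv h x (v 0))
    - dir_deriv (\<lambda>y. w' y (tup [dir_deriv h x (v 0), dir_deriv h x (v 2)])) (h x) (dir_deriv h x (v 1))
    + dir_deriv (\<lambda>y. w' y (tup [dir_deriv h x (v 0), dir_deriv h x (v 1)])) (h x) (dir_deriv h x (v 2))"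
    by (rule ext_d_2[OF V(1) hx w'])
  ultimately show ?thesis
    unfolding D
    using anti[of "H (v 0) (v 1)" "dir_deriv h x (v 2)"] anti[of "H (v 0) (v 2)" "dir_deriv h x (v 1)"]
      anti[of "H (v 1) (v 2)" "dir_deriv h x (v 0)"]
      sym[of "v 1" "v 0"] sym[of "v 2" "v 0"] sym[of "v 2" "v 1"]
    by (simp del: tup.simps)
qed

section \<open>Forms on a cylinder and their exterior derivatives\<close>

text \<open>In the expansion of a wedge product, surplus vectors remain behind those that a
  factor depends on; these rules remove them.\<close>

lemma alternating_form_truncate_2:
  assumes "alternating_form 2 \<alpha>"
  shows "\<alpha> (case_nat x (case_nat y (case_nat z r))) = \<alpha> (case_nat x (case_nat y (\<lambda>_. 0)))"
  by (rule alternating_form_cong[OF assms]) (auto simp: less_Suc_eq numeral_eq_Suc)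

lemma alternating_form_truncate_3:
  assumes "alternating_form 3 \<alpha>"
  shows "\<alpha> (case_nat x (case_nat y (case_nat z (case_nat u r)))) = \<alpha> (case_nat x (case_nat y (case_nat z (\<lambda>_. 0))))"
  by (rule alternating_form_cong[OF assms]) (auto simp: less_Suc_eq numeral_eq_Suc)

lemma alternating_form_truncate_4:
  assumes "alternating_form 4 \<alpha>"
  shows "\<alpha> (case_nat x (case_nat y (case_nat z (case_nat w (case_nat u r))))) =
    \<alpha> (case_nat x (case_nat y (case_nat z (case_nat w (\<lambda>_. 0)))))"
  by (rule alternating_form_cong[OF assms]) (auto simp: less_Suc_eq numeral_eq_Suc)

text \<open>The 3-form \<open>p + w \<and> dt\<close> and the 4-form
  \<open>w\<^sup>2 / 2 + m \<and> dt\<close> on the product with the real line, written out as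
  sums over shuffles so that they can be differentiated termwise.\<close>

definition cylinder_3_form :: "'e altform \<Rightarrow> 'e altform \<Rightarrow> ('e::real_vector \<times> real) altform" where
  "cylinder_3_form w p V = p (tup [fst (V 0), fst (V 1), fst (V 2)]) + snd (V 2) * w (tup [fst (V 0), fst (V 1)])
     - snd (V 1) * w (tup [fst (V 0), fst (V 2)]) + snd (V 0) * w (tup [fst (V 1), fst (V 2)])"

definition cylinder_4_form :: "'e altform \<Rightarrow> 'e altform \<Rightarrow> ('e::real_vector \<times> real) altform" where
  "cylinder_4_form w m V = w (tup [fst (V 0), fst (V 1)]) * w (tup [fst (V 2), fst (V 3)])
     - w (tup [fst (V 0), fst (V 2)]) * w (tup [fst (V 1), fst (V 3)])
     + w (tup [fst (V 0), fst (V 3)]) * w (tup [fst (V 1), fst (V 2)])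
     + snd (V 3) * m (tup [fst (V 0), fst (V 1), fst (V 2)]) - snd (V 2) * m (tup [fst (V 0), fst (V 1), fst (V 3)])
     + snd (V 1) * m (tup [fst (V 0), fst (V 2), fst (V 3)]) - snd (V 0) * m (tup [fst (V 1), fst (V 2), fst (V 3)])"

lemma has_derivative_fst_compose:
  assumes "G differentiable (at (fst z))"
  shows "((\<lambda>z. G (fst z)) has_derivative (\<lambda>X. dir_deriv G (fst z) (fst X))) (at z)"
  by (rule has_derivative_compose[where f = fst and g = G, OF _ has_derivative_dir_deriv[OF assms]])
    (rule bounded_linear_imp_has_derivative[OF bounded_linear_fst])

lemma cylinder_3_form_derivative:
  fixes w p :: "'e::euclidean_space \<Rightarrow> 'e altform"
  assumes "\<And>v. (\<lambda>y. w y v) differentiable (at (fst z))" "\<And>v. (\<lambda>y. p y v) differentiable (at (fst z))"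
  shows "dir_deriv (\<lambda>z. cylinder_3_form (w (fst z)) (p (fst z)) V) z X =
    dir_deriv (\<lambda>y. p y (tup [fst (V 0), fst (V 1), fst (V 2)])) (fst z) (fst X)
     + snd (V 2) * dir_deriv (\<lambda>y. w y (tup [fst (V 0), fst (V 1)])) (fst z) (fst X)
     - snd (V 1) * dir_deriv (\<lambda>y. w y (tup [fst (V 0), fst (V 2)])) (fst z) (fst X)
     + snd (V 0) * dir_deriv (\<lambda>y. w y (tup [fst (V 1), fst (V 2)])) (fst z) (fst X)"
  unfolding cylinder_3_form_def
  by (rule dir_deriv_eq)
    (intro has_derivative_add has_derivative_diff has_derivative_mult_right
      has_derivative_fst_compose[of "\<lambda>y. w y _"] has_derivative_fst_compose[of "\<lambda>y. p y _"] assms)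

lemma cylinder_4_form_derivative:
  fixes w m :: "'e::euclidean_space \<Rightarrow> 'e altform"
  assumes "\<And>v. (\<lambda>y. w y v) differentiable (at (fst z))" "\<And>v. (\<lambda>y. m y v) differentiable (at (fst z))"
  defines "W \<equiv> \<lambda>i j V. w (fst z) (tup [fst (V i), fst (V j)])"
    and "DW \<equiv> \<lambda>i j V X. dir_deriv (\<lambda>y. w y (tup [fst (V i), fst (V j)])) (fst z) (fst X)"
    and "DM \<equiv> \<lambda>i j k V X. dir_deriv (\<lambda>y. m y (tup [fst (V i), fst (V j), fst (V k)])) (fst z) (fst X)"
  shows "dir_deriv (\<lambda>z. cylinder_4_form (w (fst z)) (m (fst z)) V) z X =
     W 0 1 V * DW 2 3 V X + DW 0 1 V X * W 2 3 V - (W 0 2 V * DW 1 3 V X + DW 0 2 V X * W 1 3 V)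
     + (W 0 3 V * DW 1 2 V X + DW 0 3 V X * W 1 2 V)
     + snd (V 3) * DM 0 1 2 V X - snd (V 2) * DM 0 1 3 V X + snd (V 1) * DM 0 2 3 V X - snd (V 0) * DM 1 2 3 V X"
  unfolding cylinder_4_form_def W_def DW_def DM_def
  by (rule dir_deriv_eq)
    (intro has_derivative_add has_derivative_diff has_derivative_mult_right has_derivative_mult
      has_derivative_fst_compose[of "\<lambda>y. w y _"] has_derivative_fst_compose[of "\<lambda>y. m y _"] assms)

text \<open>\<open>d (p + w \<and> dt) = dw \<and> dt = 3 p \<and> dt\<close>, and
  \<open>3 dt \<and> (p + w \<and> dt) = - 3 p \<and> dt\<close>. Evaluated on four vectors,
  both sides are polynomials in the components along \<open>dt\<close>, the values of the forms
  and their first derivatives; their equality is a linear combination of the hypotheses on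
  \<open>dw\<close> and \<open>dp\<close>.\<close>

lemma ext_d_cylinder_3:
  fixes w p :: "'e::euclidean_space \<Rightarrow> 'e altform"
  assumes U: "open U" "fst z \<in> U" and w: "\<And>y. y \<in> U \<Longrightarrow> alternating_form 2 (w y)"
    and p: "\<And>y. y \<in> U \<Longrightarrow> alternating_form 3 (p y)"
    and diff: "\<And>v. (\<lambda>y. w y v) differentiable (at (fst z))" "\<And>v. (\<lambda>y. p y v) differentiable (at (fst z))"
    and dw: "\<And>v. ext_d 2 w (fst z) v = 3 * p (fst z) v" and dp: "\<And>v. ext_d 3 p (fst z) v = 0"
    and alt: "alternating_form 3 (cylinder_3_form (w (fst z)) (p (fst z)))"
  shows "ext_d 3 (\<lambda>z. cylinder_3_form (w (fst z)) (p (fst z))) z V =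
    - wedge 1 3 (\<lambda>v. 3 * snd (v 0)) (cylinder_3_form (w (fst z)) (p (fst z))) V"
proof -
  let ?f = "\<lambda>i. fst (V i)"
  let ?\<phi> = "cylinder_3_form (w (fst z)) (p (fst z))"
  have lin: "linear (\<lambda>v :: 'e \<times> real. 3 * snd v)" by (auto simp: linear_iff algebra_simps)
  have th: "alternating_form (Suc 0) (\<lambda>v :: nat \<Rightarrow> 'e \<times> real. 3 * snd (v 0))"
    by (rule alternating_form_covector[OF lin])
  have "alternating_form 4 (wedge 1 3 (\<lambda>v. 3 * snd (v 0)) ?\<phi>)"
    using alternating_form_wedge[OF th alt] by simp
  then have "wedge 1 3 (\<lambda>v. 3 * snd (v 0)) ?\<phi> V = wedge 1 3 (\<lambda>v. 3 * snd (v 0)) ?\<phi> (tup [V 0, V 1, V 2, V 3])"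
    using alternating_form_tup[of 4 _ V] by (simp add: numeral_eq_Suc)
  also have "\<dots> = 3 * (snd (V 0) * ?\<phi> (tup [V 1, V 2, V 3]) - snd (V 1) * ?\<phi> (tup [V 0, V 2, V 3])
      + snd (V 2) * ?\<phi> (tup [V 0, V 1, V 3]) - snd (V 3) * ?\<phi> (tup [V 0, V 1, V 2]))"
    using th alt alternating_form_truncate_3[OF alt]
    by (simp add: numeral_eq_Suc wedge_expand algebra_simps)
  finally have R: "wedge 1 3 (\<lambda>v. 3 * snd (v 0)) ?\<phi> V = 3 * (snd (V 0) * ?\<phi> (tup [V 1, V 2, V 3]) - snd (V 1) * ?\<phi>
        (tup [V 0, V 2, V 3])
      + snd (V 2) * ?\<phi> (tup [V 0, V 1, V 3]) - snd (V 3) * ?\<phi> (tup [V 0, V 1, V 2]))" .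
  define DW where "DW i j k = dir_deriv (\<lambda>y. w y (tup [?f i, ?f j])) (fst z) (?f k)" for i j k
  define DP where "DP i j k l = dir_deriv (\<lambda>y. p y (tup [?f i, ?f j, ?f k])) (fst z) (?f l)" for i j k l
  define P where "P i j k = p (fst z) (tup [?f i, ?f j, ?f k])" for i j k
  define W where "W i j = w (fst z) (tup [?f i, ?f j])" for i j
  have dW: "DW j k i - DW i k j + DW i j k = 3 * P i j k" for i j k
    using dw[of "tup [?f i, ?f j, ?f k]"] ext_d_2[where v = "tup [?f i, ?f j, ?f k]", OF U w]
    by (simp add: DW_def P_def numeral_eq_Suc)
  have dP: "DP 1 2 3 0 - DP 0 2 3 1 + DP 0 1 3 2 - DP 0 1 2 3 = 0"
    using dp[of ?f] ext_d_3[where v = ?f, OF U p] by (simp add: DP_def)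
  have L: "ext_d 3 (\<lambda>z. cylinder_3_form (w (fst z)) (p (fst z))) z V =
     (DP 1 2 3 0 + snd (V 3) * DW 1 2 0 - snd (V 2) * DW 1 3 0 + snd (V 1) * DW 2 3 0)
   - (DP 0 2 3 1 + snd (V 3) * DW 0 2 1 - snd (V 2) * DW 0 3 1 + snd (V 0) * DW 2 3 1)
   + (DP 0 1 3 2 + snd (V 3) * DW 0 1 2 - snd (V 1) * DW 0 3 2 + snd (V 0) * DW 1 3 2)
   - (DP 0 1 2 3 + snd (V 2) * DW 0 1 3 - snd (V 1) * DW 0 2 3 + snd (V 0) * DW 1 2 3)"
    unfolding ext_d_def cylinder_3_form_derivative[where w = w and p = p, OF diff] DW_def DP_def
    by (simp add: numeral_eq_Suc del: tup.simps)
  have F: "?\<phi> (tup [V i, V j, V k]) = P i j k + snd (V k) * W i j - snd (V j) * W i k + snd (V i) * W j k" for i j k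
    by (simp add: cylinder_3_form_def P_def W_def numeral_eq_Suc)
  show ?thesis
    unfolding L R F
    using dP dW[where i = 0 and j = 1 and k = 2] dW[where i = 0 and j = 1 and k = 3] dW[where i = 0 and j = 2 and k = 3] dW[where i = 1 and
          j = 2 and k = 3]
    by algebra
qed

text
  \<open>\<open>d (w\<^sup>2 / 2 + m \<and> dt) = w \<and> dw + dm \<and> dt = 3 w \<and> p - 2 w\<^sup>2 \<and> dt\<close>,
  where \<open>w \<and> p = 0\<close>, and
  \<open>3 dt \<and> (w\<^sup>2 / 2 + m \<and> dt) = 3/2 w\<^sup>2 \<and> dt\<close>. The factor
  -4/3 makes the two agree.\<close>

lemma ext_d_cylinder_4:
  fixes w p m :: "'e::euclidean_space \<Rightarrow> 'e altform"
  assumes U: "open U" "fst z \<in> U" and w: "\<And>y. y \<in> U \<Longrightarrow> alternating_form 2 (w y)"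
    and m: "\<And>y. y \<in> U \<Longrightarrow> alternating_form 3 (m y)"
    and diff: "\<And>v. (\<lambda>y. w y v) differentiable (at (fst z))" "\<And>v. (\<lambda>y. m y v) differentiable (at (fst z))"
    and dw: "\<And>v. ext_d 2 w (fst z) v = 3 * p (fst z) v"
    and dm: "\<And>v. ext_d 3 m (fst z) v = - 2 * wedge 2 2 (w (fst z)) (w (fst z)) v"
    and wp: "\<And>v. shuffle_2_3 (\<lambda>i j. w (fst z) (tup [v i, v j])) (\<lambda>i j k. p (fst z) (tup [v i, v j, v k])) = 0"
    and alt: "alternating_form 4 (cylinder_4_form (w (fst z)) (m (fst z)))"
  shows "ext_d 4 (\<lambda>z. cylinder_4_form (w (fst z)) (m (fst z))) z V =
    - (4 / 3) * wedge 1 4 (\<lambda>v. 3 * snd (v 0)) (cylinder_4_form (w (fst z)) (m (fst z))) V"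
proof -
  let ?f = "\<lambda>i. fst (V i)"
  let ?\<phi> = "cylinder_4_form (w (fst z)) (m (fst z))"
  have lin: "linear (\<lambda>v :: 'e \<times> real. 3 * snd v)" by (auto simp: linear_iff algebra_simps)
  have th: "alternating_form (Suc 0) (\<lambda>v :: nat \<Rightarrow> 'e \<times> real. 3 * snd (v 0))"
    by (rule alternating_form_covector[OF lin])
  have "alternating_form 5 (wedge 1 4 (\<lambda>v. 3 * snd (v 0)) ?\<phi>)"
    using alternating_form_wedge[OF th alt] by simp
  then have "wedge 1 4 (\<lambda>v. 3 * snd (v 0)) ?\<phi> V = wedge 1 4 (\<lambda>v. 3 * snd (v 0)) ?\<phi> (tup [V 0, V 1, V 2, V 3, V 4])"
    using alternating_form_tup[of 5 _ V] by (simp add: numeral_eq_Suc)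
  also have "\<dots> = 3 * (snd (V 0) * ?\<phi> (tup [V 1, V 2, V 3, V 4]) - snd (V 1) * ?\<phi> (tup [V 0, V 2, V 3, V 4])
      + snd (V 2) * ?\<phi> (tup [V 0, V 1, V 3, V 4]) - snd (V 3) * ?\<phi> (tup [V 0, V 1, V 2, V 4])
      + snd (V 4) * ?\<phi> (tup [V 0, V 1, V 2, V 3]))"
    using th alt alternating_form_truncate_4[OF alt]
    by (simp add: numeral_eq_Suc wedge_expand algebra_simps)
  finally have R: "wedge 1 4 (\<lambda>v. 3 * snd (v 0)) ?\<phi> V = 3 * (snd (V 0) * ?\<phi> (tup [V 1, V 2, V 3, V 4]) - snd (V 1) *
        ?\<phi> (tup [V 0, V 2, V 3, V 4])
      + snd (V 2) * ?\<phi> (tup [V 0, V 1, V 3, V 4]) - snd (V 3) * ?\<phi> (tup [V 0, V 1, V 2, V 4])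
      + snd (V 4) * ?\<phi> (tup [V 0, V 1, V 2, V 3]))" .
  define DW where "DW i j k = dir_deriv (\<lambda>y. w y (tup [?f i, ?f j])) (fst z) (?f k)" for i j k
  define DM where "DM i j k l = dir_deriv (\<lambda>y. m y (tup [?f i, ?f j, ?f k])) (fst z) (?f l)" for i j k l
  define P where "P i j k = p (fst z) (tup [?f i, ?f j, ?f k])" for i j k
  define M where "M i j k = m (fst z) (tup [?f i, ?f j, ?f k])" for i j k
  define W where "W i j = w (fst z) (tup [?f i, ?f j])" for i j
  have dW: "DW j k i - DW i k j + DW i j k = 3 * P i j k" for i j k
    using dw[of "tup [?f i, ?f j, ?f k]"] ext_d_2[where v = "tup [?f i, ?f j, ?f k]", OF U w]
    by (simp add: DW_def P_def numeral_eq_Suc)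
  have w2: "alternating_form (Suc (Suc 0)) (w (fst z))" using w[OF U(2)] by (simp add: numeral_eq_Suc)
  have dM: "DM j k l i - DM i k l j + DM i j l k - DM i j k l = - 4 * (W i j * W k l - W i k * W j l + W i l * W j k)" for i j k l
  proof -
    note anti = alternating_2_bilinear(3)[OF w[OF U(2)]]
    have "wedge 2 2 (w (fst z)) (w (fst z)) (tup [?f i, ?f j, ?f k, ?f l]) = 2 * (W i j * W k l - W i k * W j l + W i l * W j k)"
      using w2 alternating_form_truncate_2[OF w[OF U(2)]] by (simp add: numeral_eq_Suc wedge_expand W_def)
    then show ?thesis
      using dm[of "tup [?f i, ?f j, ?f k, ?f l]"] ext_d_3[where v = "tup [?f i, ?f j, ?f k, ?f l]", OF U m]
      by (simp add: DM_def numeral_eq_Suc)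
  qed
  have "shuffle_2_3 W (\<lambda>i j k. 3 * P i j k) = 0"
    using wp[of ?f] by (simp add: W_def P_def shuffle_2_3_def)
  then have wdw: "shuffle_2_3 W (\<lambda>i j k. DW j k i - DW i k j + DW i j k) = 0"
    unfolding dW .
  \<comment> \<open>The derivative of \<open>w\<^sup>2 / 2\<close> at the vectors
    \<open>a, b, c, d\<close> in the direction \<open>n\<close>.\<close>
  let ?T = "\<lambda>a b c d n. W a b * DW c d n + DW a b n * W c d - (W a c * DW b d n + DW a c n * W b d) + (W a d * DW b c n + DW a d n * W b c)"
  have L: "ext_d 4 (\<lambda>z. cylinder_4_form (w (fst z)) (m (fst z))) z V =
     (?T 1 2 3 4 0 + snd (V 4) * DM 1 2 3 0 - snd (V 3) * DM 1 2 4 0 + snd (V 2) * DM 1 3 4 0 - snd (V 1) * DM 2 3 4 0)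
   - (?T 0 2 3 4 1 + snd (V 4) * DM 0 2 3 1 - snd (V 3) * DM 0 2 4 1 + snd (V 2) * DM 0 3 4 1 - snd (V 0) * DM 2 3 4 1)
   + (?T 0 1 3 4 2 + snd (V 4) * DM 0 1 3 2 - snd (V 3) * DM 0 1 4 2 + snd (V 1) * DM 0 3 4 2 - snd (V 0) * DM 1 3 4 2)
   - (?T 0 1 2 4 3 + snd (V 4) * DM 0 1 2 3 - snd (V 2) * DM 0 1 4 3 + snd (V 1) * DM 0 2 4 3 - snd (V 0) * DM 1 2 4 3)
   + (?T 0 1 2 3 4 + snd (V 3) * DM 0 1 2 4 - snd (V 2) * DM 0 1 3 4 + snd (V 1) * DM 0 2 3 4 - snd (V 0) * DM 1 2 3 4)"
    unfolding ext_d_def cylinder_4_form_derivative[where w = w and m = m, OF diff] DW_def DM_def W_def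
    by (simp add: numeral_eq_Suc del: tup.simps)
  have F: "?\<phi> (tup [V i, V j, V k, V l]) = W i j * W k l - W i k * W j l + W i l * W j k
      + snd (V l) * M i j k - snd (V k) * M i j l + snd (V j) * M i k l - snd (V i) * M j k l" for i j k l
    by (simp add: cylinder_4_form_def M_def W_def numeral_eq_Suc)
  \<comment> \<open>The rational factor is cleared so that the remaining goal is a polynomial
    identity with integer coefficients.\<close>
  have q: "(a :: real) = - (4 / 3) * (3 * b) \<longleftrightarrow> a = - 4 * b" for a b by simp
  show ?thesis
    unfolding L R F q
    using wdw[unfolded shuffle_2_3_def] dM[where i = 0 and j = 1 and k = 2 and l = 3] dM[where i = 0 and j = 1 and k = 2 and l = 4]
          dM[where i = 0 and j = 1 and k = 3 and l = 4] dM[where i = 0 and j = 2 and k = 3 and l = 4] dM[where i = 1 and j = 2 and k = 3 and l = 4]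
    by algebra
qed

section \<open>The \<open>G\<^sub>2\<close>-structure of the cylinder over a nearly Kaehler manifold\<close>

definition cylinder_coframe :: "(nat \<Rightarrow> 'e \<Rightarrow> real) \<Rightarrow> nat \<Rightarrow> 'e \<times> real \<Rightarrow> real" where
  "cylinder_coframe e i V = (if i = 7 then snd V else e i (fst V))"

text \<open>With \<open>e\<^sup>7 = dt\<close>, the monomials 127, 347 and 567 of a
  \<open>G\<^sub>2\<close>-form make up \<open>\<omega> \<and> dt\<close> and the other four
  make up \<open>\<psi>\<^sub>+\<close>.\<close>

lemma cylinder_g2_adapted:
  fixes \<psi> :: "'e::euclidean_space altform"
  assumes a: "su3_adapted e \<omega> \<psi>"
  shows "g2_adapted (cylinder_coframe e) (cylinder_3_form \<omega> \<psi>)"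
proof -
  note E = su3_adapted_expand[OF a]
  let ?E = "cylinder_coframe e"
  have D: "DIM('e \<times> real) = 7" by (simp add: E(1))
  have lin: "linear (?E i)" if "1 \<le> i" "i \<le> 7" for i
  proof (cases "i = 7")
    case True
    then show ?thesis by (auto simp: linear_iff cylinder_coframe_def)
  next
    case False
    then have "linear (e i)" using E(2)[of i] that by simp
    then show ?thesis using False by (auto simp: linear_iff cylinder_coframe_def)
  qed
  have ce: "coframe e" using a by (simp add: su3_adapted_def)
  have "coframe ?E"
    unfolding coframe_def D
  proof (intro conjI ballI allI impI)
    show "linear (?E i)" if "i \<in> {1..7}" for i using lin that by simp
    fix c :: "nat \<Rightarrow> real" and i :: nat
    assume z: "\<forall>V. (\<Sum>i\<in>{1..7}. c i * ?E i V) = 0" and i: "i \<in> {1..7}"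
    have split: "(\<Sum>i\<in>{1..7}. c i * ?E i V) = (\<Sum>i\<in>{1..6}. c i * e i (fst V)) + c 7 * snd V" for V
    proof -
      have "{1..7::nat} = insert 7 {1..6}" by auto
      moreover have "(\<Sum>i\<in>{1..6}. c i * ?E i V) = (\<Sum>i\<in>{1..6}. c i * e i (fst V))"
        by (rule sum.cong) (auto simp: cylinder_coframe_def)
      ultimately show ?thesis by (simp add: cylinder_coframe_def)
    qed
    \<comment> \<open>A linear relation between the covectors is tested on
      \<open>(0, 1)\<close>, which isolates the coefficient of \<open>dt\<close>, and then on
      the vectors \<open>(x, 0)\<close>.\<close>
    have c7: "c 7 = 0"
    proof -
      have "e i 0 = 0" if "i \<in> {1..6}" for i using linear_0[OF E(2)[of i]] that by simp
      then show ?thesis using z[rule_format, of "(0, 1)"] unfolding split by simp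
    qed
    have "(\<Sum>i\<in>{1..6}. c i * e i x) = 0" for x
      using z[rule_format, of "(x, 0)"] unfolding split by simp
    then have "\<forall>i\<in>{1..6}. c i = 0"
      using ce unfolding coframe_def E(1) by blast
    moreover have "i = 7 \<or> i \<in> {1..6}" using i by auto
    ultimately show "c i = 0" using c7 by auto
  qed
  moreover have "cylinder_3_form \<omega> \<psi> V = monomial ?E [1,2,7] V + monomial ?E [3,4,7] V + monomial ?E [5,6,7] V
             + monomial ?E [1,3,5] V - monomial ?E [1,4,6] V - monomial ?E [2,3,6] V
             - monomial ?E [2,4,5] V" for V
  proof -
    have w: "\<omega> (tup [x, y]) = (e 1 x * e 2 y - e 1 y * e 2 x) + (e 3 x * e 4 y - e 3 y * e 4 x)
       + (e 5 x * e 6 y - e 5 y * e 6 x)" for x y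
      by (simp add: E(5) monomial_2 E(2) del: monomial.simps)
    have p: "\<psi> (tup [x, y, z]) = monomial e [1,3,5] (tup [x, y, z]) - monomial e [1,4,6] (tup [x, y, z])
        - monomial e [2,3,6] (tup [x, y, z]) - monomial e [2,4,5] (tup [x, y, z])" for x y z
      by (simp add: E(6))
    show ?thesis
      unfolding cylinder_3_form_def w p
      by (simp add: monomial_3 lin E(2) cylinder_coframe_def del: monomial.simps) (simp add: algebra_simps)
  qed
  ultimately show ?thesis
    unfolding g2_adapted_def D by (auto simp: fun_eq_iff simp del: monomial.simps)
qed

lemma alternating_psi_minus:
  fixes \<psi> :: "'e::euclidean_space altform"
  assumes a: "su3_adapted e \<omega> \<psi>"
  shows "alternating_form 3 (\<lambda>v. \<psi> (\<lambda>i. su3_J \<omega> \<psi> (v i)))"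
proof -
  have "alternating_form (length [i, j, k]) (monomial e [i, j, k])"
    if "i \<in> {1..6}" "j \<in> {1..6}" "k \<in> {1..6}" for i j k
    using that su3_adapted_expand(2)[OF a] by (intro alternating_form_monomial) auto
  then show ?thesis
    unfolding psi_minus_adapted(1)[OF a]
    by (intro alternating_form_add alternating_form_diff) (auto simp: numeral_3_eq_3 simp del: monomial.simps)
qed

definition det4 :: "(nat \<Rightarrow> real) \<Rightarrow> (nat \<Rightarrow> real) \<Rightarrow> (nat \<Rightarrow> real) \<Rightarrow>
      (nat \<Rightarrow> real) \<Rightarrow> real" where
  "det4 a b c d = a 0 * det3 b c d 1 2 3 - a 1 * det3 b c d 0 2 3 + a 2 * det3 b c d 0 1 3 - a 3 * det3 b c d 0 1 2"

text \<open>Expansion of the determinant along the first two rows.\<close>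

lemma det4_laplace:
  "det4 a b c d = det2 a b 0 1 * det2 c d 2 3 - det2 a b 0 2 * det2 c d 1 3 + det2 a b 0 3 * det2 c d 1 2
     + det2 a b 1 2 * det2 c d 0 3 - det2 a b 1 3 * det2 c d 0 2 + det2 a b 2 3 * det2 c d 0 1"
  unfolding det4_def det3_def det2_def by algebra

text \<open>Expansion of the determinant along the last row.\<close>

lemma det4_last:
  "det4 a b c s = s 3 * det3 a b c 0 1 2 - s 2 * det3 a b c 0 1 3 + s 1 * det3 a b c 0 2 3 - s 0 * det3 a b c 1 2 3"
  unfolding det4_def det3_def by algebra

text \<open>The Pluecker relation: a product of two covectors has square 0.\<close>

lemma det2_pluecker: "det2 a b 0 1 * det2 a b 2 3 - det2 a b 0 2 * det2 a b 1 3 + det2 a b 0 3 * det2 a b 1 2 = 0"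
  unfolding det2_def by algebra

text \<open>The monomials of \<open>*\<phi>\<close> with the factor
  \<open>e\<^sup>7 = dt\<close> make up \<open>\<psi>\<^sub>- \<and> dt\<close>. The other
  three, 1234, 1256 and 3456, are the mixed terms of \<open>\<omega>\<^sup>2 / 2\<close>, whose
  square terms vanish by the Pluecker relation.\<close>

lemma cylinder_g2_dual:
  fixes \<psi> :: "'e::euclidean_space altform"
  assumes a: "su3_adapted e \<omega> \<psi>"
  shows "g2_dual (cylinder_coframe e) = cylinder_4_form \<omega> (\<lambda>v. \<psi> (\<lambda>i. su3_J \<omega> \<psi> (v i)))"
proof
  fix V :: "nat \<Rightarrow> 'e \<times> real"
  note E = su3_adapted_expand[OF a]
  let ?E = "cylinder_coframe e"
  have lin: "linear (?E i)" if "1 \<le> i" "i \<le> 7" for i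
    using g2_adapted_expand(2)[OF cylinder_g2_adapted[OF a] that] .
  define x where "x i j = e i (fst (V j))" for i j
  define s where "s j = snd (V j)" for j
  have w: "\<omega> (tup [fst (V i), fst (V j)]) = det2 (x 1) (x 2) i j + det2 (x 3) (x 4) i j + det2 (x 5) (x 6) i j" for i j
    by (simp add: E(5) monomial_2 E(2) det2_def x_def del: monomial.simps)
  have m: "\<psi> (\<lambda>n. su3_J \<omega> \<psi> (tup [fst (V i), fst (V j), fst (V k)] n)) = det3 (x 1) (x 3) (x 6) i j k
      + det3 (x 1) (x 4) (x 5) i j k + det3 (x 2) (x 3) (x 5) i j k - det3 (x 2) (x 4) (x 6) i j k" for i j k
    unfolding psi_minus_adapted(1)[OF a] by (simp add: monomial_3 E(2) det3_def x_def del: monomial.simps)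
  have M3: "monomial ?E [a, b, c] (tup [V i, V j, V k]) = det3 (x a) (x b) (x c) i j k"
    if "1 \<le> a" "a < 7" "1 \<le> b" "b < 7" "1 \<le> c" "c < 7" for a b c i j k
    using that by (subst monomial_3) (auto simp: lin det3_def x_def cylinder_coframe_def)
  have M3': "monomial ?E [a, b, 7] (tup [V i, V j, V k]) = det3 (x a) (x b) s i j k"
    if "1 \<le> a" "a < 7" "1 \<le> b" "b < 7" for a b i j k
    using that by (subst monomial_3) (auto simp: lin det3_def x_def s_def cylinder_coframe_def)
  have M4: "monomial ?E [a, b, c, d] (tup [V 0, V (Suc 0), V 2, V 3]) = det4 (x a) (x b) (x c) (if d = 7 then s else x d)"
    if "1 \<le> a" "a < 7" "1 \<le> b" "b < 7" "1 \<le> c" "c < 7" "1 \<le> d" "d \<le> 7" for a b c d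
  proof -
    have "?E a (V j) = x a j" for j using that by (simp add: x_def cylinder_coframe_def)
    then show ?thesis
      using that by (subst monomial_4) (auto simp: lin M3 M3' det4_def simp del: monomial.simps tup.simps)
  qed
  have "g2_dual ?E V = g2_dual ?E (tup [V 0, V 1, V 2, V 3])"
    using alternating_form_tup[where v = V, OF alternating_g2_dual[where e = ?E, OF lin]] by (simp add: numeral_eq_Suc)
  also have "\<dots> = det4 (x 1) (x 2) (x 3) (x 4) + det4 (x 1) (x 2) (x 5) (x 6) + det4 (x 3) (x 4) (x 5) (x 6) + det4 (x 1) (x 3) (x 6)
        s + det4 (x 1) (x 4) (x 5) s + det4 (x 2) (x 3) (x 5) s - det4 (x 2) (x 4) (x 6) s"
    unfolding g2_dual_def by (simp add: M4 del: monomial.simps tup.simps)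
  also have "\<dots> = cylinder_4_form \<omega> (\<lambda>v. \<psi> (\<lambda>i. su3_J \<omega> \<psi> (v i))) V"
    unfolding cylinder_4_form_def w m s_def[symmetric] det4_last[of _ _ _ s] det4_laplace[of _ _ _ "x 4"] det4_laplace[of _ _ _ "x 6"]
    using det2_pluecker[of "x 1" "x 2"] det2_pluecker[of "x 3" "x 4"] det2_pluecker[of "x 5" "x 6"]
    by algebra
  finally show "g2_dual ?E V = cylinder_4_form \<omega> (\<lambda>v. \<psi> (\<lambda>i. su3_J \<omega> \<psi> (v i))) V" .
qed

lemma wedge_differentiable:
  assumes "\<And>v. (\<lambda>y. a y v) differentiable (at x)" "\<And>v. (\<lambda>y. b y v) differentiable (at x)"
  shows "(\<lambda>y. wedge k l (a y) (b y) v) differentiable (at x)"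
proof -
  have "(\<lambda>y. (1 / (fact k * fact l)) * (\<Sum>\<sigma> | \<sigma> permutes {..<k + l}.
     of_int (sign \<sigma>) * a y (\<lambda>i. v (\<sigma> i)) * b y (\<lambda>i. v (\<sigma> (k + i))))) differentiable (at x)"
    by (intro differentiable_mult differentiable_const differentiable_sum ballI assms finite_permutations) simp
  then show ?thesis by (simp add: wedge_def)
qed

text \<open>The coframes adapted to the forms at nearby points need not depend continuously on
  the point. But in a fixed frame the identity for \<open>\<xi> (J X)\<close> exhibits the
  components of \<open>J X\<close> as quotients of wedge products of \<open>\<omega>\<close> and
  \<open>\<psi>\<close>, and \<open>\<psi>\<^sub>-\<close> is linear in
  \<open>J\<close>.\<close>

lemma psi_minus_differentiable:
  fixes w p :: "'e::euclidean_space \<Rightarrow> 'e altform"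
  assumes U: "open U" "x \<in> U" and ad: "\<And>y. y \<in> U \<Longrightarrow> \<exists>e. su3_adapted e (w y) (p y)"
    and w: "\<And>v. (\<lambda>y. w y v) differentiable (at x)" and p: "\<And>v. (\<lambda>y. p y v) differentiable (at x)"
  shows "(\<lambda>y. p y (\<lambda>i. su3_J (w y) (p y) (v i))) differentiable (at x)"
proof -
  obtain e0 where e0: "su3_adapted e0 (w x) (p x)" using ad[OF U(2)] by blast
  \<comment> \<open>A frame dual to an adapted coframe at \<open>x\<close>, used at all points
    of \<open>U\<close>. Any fixed frame would serve to evaluate forms of top degree.\<close>
  obtain d where d: "frame_pair 6 (\<lambda>i. e0 (Suc i)) d" using su3_adapted_frame[OF e0] by blast
  define N where "N b y = wedge 1 5 (\<lambda>v. v 0 \<bullet> b) (wedge 2 3 (interior_product (v 0) (p y)) (p y)) d" for b y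
  define R where "R b y = N b y / (- 2 * su3_volume (w y) d)" for b y
  have vol: "su3_volume (w y) d \<noteq> 0" if y: "y \<in> U" for y
  proof
    assume z: "su3_volume (w y) d = 0"
    obtain e where e: "su3_adapted e (w y) (p y)" using ad[OF y] by blast
    obtain b where b: "frame_pair 6 (\<lambda>i. e (Suc i)) b" using su3_adapted_frame[OF e] by blast
    have "su3_volume (w y) b = 0"
      by (rule top_form_zero[OF d alternating_su3_volume[OF su3_adapted_expand(3)[OF e]] z])
    then show False using su3_volume_frame[OF e b] by simp
  qed
  have J: "su3_J (w y) (p y) (v 0) \<bullet> b = R b y" if y: "y \<in> U" for y b
  proof -
    obtain e where e: "su3_adapted e (w y) (p y)" using ad[OF y] by blast
    have lin: "linear (\<lambda>x. x \<bullet> b)" by (simp add: linear_iff inner_add_left)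
    have "N b y = - 2 * (su3_J (w y) (p y) (v 0) \<bullet> b) * su3_volume (w y) d"
      unfolding N_def
      by (rule su3_J_identity[OF e lin]) (use su3_J_rotation[OF e] in \<open>simp_all add: complex_rotation_def\<close>)
    then show ?thesis using vol[OF y] by (simp add: R_def)
  qed
  have eq: "p y (\<lambda>i. su3_J (w y) (p y) (v i)) = - (\<Sum>b\<in>Basis. R b y * p y (tup [b, v 1, v 2]))" if y: "y \<in> U" for y
  proof -
    obtain e where e: "su3_adapted e (w y) (p y)" using ad[OF y] by blast
    have "alternating_form (Suc 2) (p y)" using su3_adapted_expand(4)[OF e] by (simp add: numeral_eq_Suc)
    note lin = interior_product_linear[OF this, of "tup [v 1, v 2]"]
    have "p y (tup [su3_J (w y) (p y) (v 0), v 1, v 2]) =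
        interior_product (\<Sum>b\<in>Basis. (su3_J (w y) (p y) (v 0) \<bullet> b) *\<^sub>R b) (p y) (tup [v 1, v 2])"
      by (simp add: euclidean_representation interior_product_def)
    also have "\<dots> = (\<Sum>b\<in>Basis. (su3_J (w y) (p y) (v 0) \<bullet> b) * interior_product b (p y) (tup [v 1, v 2]))"
      by (simp only: linear_sum[OF lin] linear_scale[OF lin] real_scaleR_def)
    also have "\<dots> = (\<Sum>b\<in>Basis. R b y * p y (tup [b, v 1, v 2]))"
      by (simp add: J[OF y] interior_product_def)
    finally show ?thesis
      using psi_minus_adapted(2)[OF e, of v] by simp
  qed
  have volD: "(\<lambda>y. su3_volume (w y) d) differentiable (at x)"
  proof -
    have "(\<lambda>y. wedge 2 4 (w y) (wedge 2 2 (w y) (w y)) d * (1 / 6)) differentiable (at x)"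
      by (intro differentiable_mult differentiable_const wedge_differentiable w)
    then show ?thesis by (simp add: su3_volume_def)
  qed
  have "N b differentiable (at x)" for b
    unfolding N_def interior_product_def
    by (intro wedge_differentiable differentiable_const p)
  then have RD: "R b differentiable (at x)" for b
    unfolding R_def
    by (intro differentiable_divide differentiable_mult differentiable_const volD) (use vol[OF U(2)] in simp_all)
  have "(\<lambda>y. - (\<Sum>b\<in>Basis. R b y * p y (tup [b, v 1, v 2]))) differentiable (at x)"
    by (intro differentiable_minus differentiable_sum ballI differentiable_mult RD p) simp
  then show ?thesis
    by (rule differentiable_cong_open[OF _ U]) (simp add: eq)
qed

text \<open>Pointwise the star of \<open>\<phi>\<close> is computed in an adapted coframe, and
  the result, \<open>\<omega>\<^sup>2 / 2 + \<psi>\<^sub>- \<and> dt\<close>, does not mention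
  the coframe. It therefore holds on a neighbourhood and may be differentiated.\<close>

lemma cylinder_locally_conformal_parallel:
  fixes w p :: "'e::euclidean_space \<Rightarrow> 'e altform"
  defines "\<phi> \<equiv> \<lambda>z. cylinder_3_form (w (fst z)) (p (fst z))"
  assumes U: "open U" "fst z \<in> U" and ad: "\<And>y. y \<in> U \<Longrightarrow> \<exists>e. su3_adapted e (w y) (p y)"
    and sm: "\<And>v. smooth_on U (\<lambda>y. w y v)" "\<And>v. smooth_on U (\<lambda>y. p y v)"
    and dw: "\<And>y v. y \<in> U \<Longrightarrow> ext_d 2 w y v = 3 * p y v"
    and dm: "\<And>y v. y \<in> U \<Longrightarrow> ext_d 3 (\<lambda>y v. p y (\<lambda>i. su3_J (w y) (p y) (v i))) y v = - 2 * wedge 2 2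
          (w y) (w y) v"
  shows "ext_d 3 \<phi> z V = - wedge 1 3 (\<lambda>v. 3 * snd (v 0)) (\<phi> z) V"
    and "ext_d 4 (\<lambda>z. hodge_star (g2_metric (\<phi> z)) (g2_volume (\<phi> z)) 3 (\<phi> z)) z V =
      - (4 / 3) * wedge 1 4 (\<lambda>v. 3 * snd (v 0)) (hodge_star (g2_metric (\<phi> z)) (g2_volume (\<phi> z)) 3 (\<phi> z)) V"
proof -
  define m where "m y v = p y (\<lambda>i. su3_J (w y) (p y) (v i))" for y v
  have w2: "alternating_form 2 (w y)" and p3: "alternating_form 3 (p y)" and m3: "alternating_form 3 (m y)" if "y \<in> U" for y
    using ad[OF that] su3_adapted_expand(3,4) alternating_psi_minus unfolding m_def by blast+
  have diff: "(\<lambda>y. w y v) differentiable (at y)" "(\<lambda>y. p y v) differentiable (at y)"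
      "(\<lambda>y. m y v) differentiable (at y)" if "y \<in> U" for y v
  proof -
    show 1: "(\<lambda>y. w y v) differentiable (at y)" for v by (rule smooth_on_differentiable[OF sm(1) that])
    show 2: "(\<lambda>y. p y v) differentiable (at y)" for v by (rule smooth_on_differentiable[OF sm(2) that])
    show "(\<lambda>y. m y v) differentiable (at y)"
      unfolding m_def by (rule psi_minus_differentiable[OF U(1) that ad 1 2])
  qed
  have star: "hodge_star (g2_metric (\<phi> y)) (g2_volume (\<phi> y)) 3 (\<phi> y) = cylinder_4_form (w (fst y)) (m (fst y))"
    if y: "fst y \<in> U" for y
  proof -
    obtain e where e: "su3_adapted e (w (fst y)) (p (fst y))" using ad[OF y] by blast
    show ?thesis
      using g2_hodge_star[OF cylinder_g2_adapted[OF e]] cylinder_g2_dual[OF e]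
      by (simp add: \<phi>_def m_def[abs_def])
  qed
  obtain e where e: "su3_adapted e (w (fst z)) (p (fst z))" using ad[OF U(2)] by blast
  note ge = g2_adapted_expand[OF cylinder_g2_adapted[OF e]]
  have dp: "ext_d 3 p (fst z) v = 0" for v
    by (rule ext_d_exact[OF U w2 p3 sm(1) dw])
  show "ext_d 3 \<phi> z V = - wedge 1 3 (\<lambda>v. 3 * snd (v 0)) (\<phi> z) V"
    unfolding \<phi>_def
    by (rule ext_d_cylinder_3[OF U w2 p3 diff(1,2)[OF U(2)] dw[OF U(2)] dp ge(3)])
  have alt: "alternating_form 4 (cylinder_4_form (w (fst z)) (m (fst z)))"
    using alternating_g2_dual[of "cylinder_coframe e", OF ge(2)] cylinder_g2_dual[OF e] by (simp add: m_def[abs_def])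
  have "ext_d 4 (\<lambda>z. hodge_star (g2_metric (\<phi> z)) (g2_volume (\<phi> z)) 3 (\<phi> z)) z V =
      ext_d 4 (\<lambda>z. cylinder_4_form (w (fst z)) (m (fst z))) z V"
    unfolding ext_d_def
  proof (intro sum.cong refl arg_cong2[where f = "(*)"] dir_deriv_cong_open[where S = "U \<times> UNIV"])
    show "open (U \<times> (UNIV :: real set))" using U(1) by (simp add: open_Times)
    show "z \<in> U \<times> UNIV" using U(2) by (cases z) simp
  qed (auto simp: star)
  also have "\<dots> = - (4 / 3) * wedge 1 4 (\<lambda>v. 3 * snd (v 0)) (cylinder_4_form (w (fst z)) (m (fst z))) V"
  proof (rule ext_d_cylinder_4[where p = p, OF U w2 m3 diff(1,3)[OF U(2)] dw[OF U(2)] _ su3_omega_wedge_psi[OF e] alt])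
    show "ext_d 3 m (fst z) v = - 2 * wedge 2 2 (w (fst z)) (w (fst z)) v" for v
      unfolding m_def[abs_def] by (rule dm[OF U(2)])
  qed
  finally show "ext_d 4 (\<lambda>z. hodge_star (g2_metric (\<phi> z)) (g2_volume (\<phi> z)) 3 (\<phi> z)) z V =
      - (4 / 3) * wedge 1 4 (\<lambda>v. 3 * snd (v 0)) (hodge_star (g2_metric (\<phi> z)) (g2_volume (\<phi> z)) 3 (\<phi> z)) V"
    by (simp add: star[OF U(2)])
qed

section \<open>Coordinate expressions of maps and pullbacks of forms\<close>

abbreviation chart_inv :: "('a, 'e) chart \<Rightarrow> 'e \<Rightarrow> 'a" where
  "chart_inv c \<equiv> inv_into (fst c) (snd c)"

lemma chart_inverse:
  assumes "is_chart X c"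
  shows "p \<in> fst c \<Longrightarrow> chart_inv c (snd c p) = p"
    and "x \<in> chart_image c \<Longrightarrow> chart_inv c x \<in> fst c"
    and "x \<in> chart_image c \<Longrightarrow> snd c (chart_inv c x) = x"
proof -
  have "topspace (subtopology X (fst c)) = fst c"
    using assms openin_subset[of X "fst c"] by (auto simp: is_chart_def)
  then have "inj_on (snd c) (fst c)"
    using assms homeomorphic_imp_injective_map[of "subtopology X (fst c)" "top_of_set (chart_image c)" "snd c"]
    by (simp add: is_chart_def)
  then show "p \<in> fst c \<Longrightarrow> chart_inv c (snd c p) = p" by (rule inv_into_f_f)
  show "x \<in> chart_image c \<Longrightarrow> chart_inv c x \<in> fst c" by (rule inv_into_into)
  show "x \<in> chart_image c \<Longrightarrow> snd c (chart_inv c x) = x" by (rule f_inv_into_f)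
qed

lemma coord_domain_iff:
  assumes "is_chart X c"
  shows "x \<in> coord_domain c c' F \<longleftrightarrow> x \<in> chart_image c \<and> F (chart_inv c x) \<in> fst c'"
  using chart_inverse[OF assms] unfolding coord_domain_def by (auto 4 3)

lemma coord_map_apply: "coord_map c c' F x = snd c' (F (chart_inv c x))"
  by (simp add: coord_map_def)

lemma coord_map_in_image:
  assumes "is_chart X c" "x \<in> coord_domain c c' F"
  shows "coord_map c c' F x \<in> chart_image c'"
  using assms by (simp add: coord_domain_iff coord_map_apply)

lemma open_chart_image_of_openin:
  assumes c: "is_chart X c" and W: "openin X W"
  shows "open (snd c ` (fst c \<inter> W))"
proof -
  have "openin (subtopology X (fst c)) (fst c \<inter> W)"
    using W by (auto simp: openin_subtopology)
  then have "openin (top_of_set (chart_image c)) (snd c ` (fst c \<inter> W))"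
    using c homeomorphic_imp_open_map unfolding is_chart_def open_map_def by blast
  then show ?thesis
    using c openin_open_trans unfolding is_chart_def by blast
qed

lemma open_coord_domain:
  assumes c: "is_chart X c" and c': "is_chart X' c'" and F: "continuous_map X X' F"
  shows "open (coord_domain c c' F)"
proof -
  have "openin X {p \<in> topspace X. F p \<in> fst c'}"
    using openin_continuous_map_preimage[OF F] c' by (simp add: is_chart_def)
  from open_chart_image_of_openin[OF c this]
  have "open (snd c ` (fst c \<inter> {p \<in> topspace X. F p \<in> fst c'}))" .
  moreover have "fst c \<inter> {p \<in> topspace X. F p \<in> fst c'} = fst c \<inter> F -` fst c'"
    using c openin_subset[of X "fst c"] by (auto simp: is_chart_def)
  ultimately show ?thesis by (simp add: coord_domain_def)
qed

lemma smooth_manifold_chart: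
  assumes "smooth_manifold M" "c \<in> atlas M"
  shows "is_chart (mtop M) c"
  using assms by (simp add: smooth_manifold_def)

lemma smooth_manifold_chart_exists:
  assumes "smooth_manifold M" "p \<in> topspace (mtop M)"
  obtains c where "c \<in> atlas M" "p \<in> fst c"
  using assms unfolding smooth_manifold_def by (metis UN_E)

text \<open>Near a given point a composition can be computed through one intermediate chart,
  around the image of that point.\<close>

lemma coord_map_compose_local:
  fixes N :: "('a, 'e::euclidean_space) atlas_space"
  assumes N: "smooth_manifold N" and F: "smooth_map N N F" and G: "smooth_map N N G"
    and c: "c \<in> atlas N" "c'' \<in> atlas N" and x: "x \<in> coord_domain c c'' (G \<circ> F)"
  obtains c' T where "c' \<in> atlas N" "open T" "x \<in> T" "T \<subseteq> coord_domain c c' F"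
    "coord_map c c' F ` T \<subseteq> coord_domain c' c'' G"
    "\<And>y. y \<in> T \<Longrightarrow> coord_map c c'' (G \<circ> F) y = coord_map c' c'' G (coord_map c c' F y)"
proof -
  note ch = smooth_manifold_chart[OF N]
  have contF: "continuous_map (mtop N) (mtop N) F" and contG: "continuous_map (mtop N) (mtop N) G"
    using F G by (auto simp: smooth_map_def)
  have x1: "x \<in> chart_image c" "G (F (chart_inv c x)) \<in> fst c''"
    using x by (auto simp: coord_domain_iff[OF ch[OF c(1)]])
  have "chart_inv c x \<in> topspace (mtop N)"
    using chart_inverse(2)[OF ch[OF c(1)] x1(1)] ch[OF c(1)] openin_subset by (auto simp: is_chart_def)
  then have "F (chart_inv c x) \<in> topspace (mtop N)"
    using contF by (auto simp: continuous_map_def)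
  then obtain c' where c': "c' \<in> atlas N" "F (chart_inv c x) \<in> fst c'"
    by (rule smooth_manifold_chart_exists[OF N])
  have o1: "open (coord_domain c c' F)" and o2: "open (coord_domain c' c'' G)"
    using open_coord_domain ch c c' contF contG by blast+
  have sm: "smooth_on (coord_domain c c' F) (coord_map c c' F)"
    using F c c' by (simp add: smooth_map_def)
  define T where "T = coord_domain c c' F \<inter> coord_map c c' F -` coord_domain c' c'' G"
  have "open T"
    unfolding T_def
    using continuous_open_preimage[OF smooth_on_continuous[OF sm] o1 o2] .
  have inv: "chart_inv c' (coord_map c c' F y) = F (chart_inv c y)" if "y \<in> coord_domain c c' F" for y
    using that chart_inverse(1)[OF ch[OF c'(1)]] by (simp add: coord_domain_iff[OF ch[OF c(1)]] coord_map_apply)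
  have xF: "x \<in> coord_domain c c' F"
    using x1 c' by (simp add: coord_domain_iff[OF ch[OF c(1)]])
  have "x \<in> T"
    using xF x1(2) coord_map_in_image[OF ch[OF c(1)] xF]
    by (simp add: T_def coord_domain_iff[OF ch[OF c'(1)], of _ c'' G] inv)
  show thesis
  proof (rule that[OF c'(1) \<open>open T\<close> \<open>x \<in> T\<close>])
    show "T \<subseteq> coord_domain c c' F" "coord_map c c' F ` T \<subseteq> coord_domain c' c'' G"
      by (auto simp: T_def)
    show "coord_map c c'' (G \<circ> F) y = coord_map c' c'' G (coord_map c c' F y)" if "y \<in> T" for y
      using that inv[of y] by (simp add: T_def coord_map_apply)
  qed
qed

lemma smooth_map_compose:
  fixes N :: "('a, 'e::euclidean_space) atlas_space"
  assumes N: "smooth_manifold N" and F: "smooth_map N N F" and G: "smooth_map N N G"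
  shows "smooth_map N N (G \<circ> F)"
  unfolding smooth_map_def
proof (intro conjI ballI)
  show "continuous_map (mtop N) (mtop N) (G \<circ> F)"
    using F G continuous_map_compose by (auto simp: smooth_map_def)
  fix c c'' assume c: "c \<in> atlas N" "c'' \<in> atlas N"
  show "smooth_on (coord_domain c c'' (G \<circ> F)) (coord_map c c'' (G \<circ> F))"
  proof (rule smooth_on_local)
    fix x assume "x \<in> coord_domain c c'' (G \<circ> F)"
    then obtain c' T where T: "c' \<in> atlas N" "open T" "x \<in> T" "T \<subseteq> coord_domain c c' F"
      "coord_map c c' F ` T \<subseteq> coord_domain c' c'' G"
      "\<And>y. y \<in> T \<Longrightarrow> coord_map c c'' (G \<circ> F) y = coord_map c' c'' G (coord_map c c' F y)"
      by (rule coord_map_compose_local[OF N F G c]) blast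
    have "smooth_on (coord_domain c' c'' G) (coord_map c' c'' G)" "smooth_on T (coord_map c c' F)"
      using F G c T(1) smooth_on_subset[OF _ T(4)] by (auto simp: smooth_map_def)
    then have "smooth_on T (\<lambda>y. coord_map c' c'' G (coord_map c c' F y))"
      using smooth_on_compose[OF T(2) _ _ T(5)] by blast
    then have "smooth_on T (coord_map c c'' (G \<circ> F))"
      using smooth_on_cong[OF T(2), of "\<lambda>y. coord_map c' c'' G (coord_map c c' F y)"] T(6) by simp
    then show "\<exists>T. open T \<and> x \<in> T \<and> smooth_on T (coord_map c c'' (G \<circ> F))"
      using T by blast
  qed
qed

lemma smooth_map_differentiable:
  assumes "smooth_map M M' F" "c \<in> atlas M" "c' \<in> atlas M'" "x \<in> coord_domain c c' F"
  shows "coord_map c c' F differentiable (at x)"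
  using assms smooth_on_differentiable unfolding smooth_map_def by blast

lemma is_pullback_compose:
  fixes N :: "('a, 'e::euclidean_space) atlas_space"
  assumes N: "smooth_manifold N" and F: "smooth_map N N F" and G: "smooth_map N N G"
    and pF: "is_pullback N N F \<alpha> \<alpha>" and pG: "is_pullback N N G \<alpha> \<alpha>"
  shows "is_pullback N N (G \<circ> F) \<alpha> \<alpha>"
  unfolding is_pullback_def
proof (intro ballI)
  fix c c'' x assume c: "c \<in> atlas N" "c'' \<in> atlas N" and x: "x \<in> coord_domain c c'' (G \<circ> F)"
  obtain c' T where T: "c' \<in> atlas N" "open T" "x \<in> T" "T \<subseteq> coord_domain c c' F"
      "coord_map c c' F ` T \<subseteq> coord_domain c' c'' G"
      "\<And>y. y \<in> T \<Longrightarrow> coord_map c c'' (G \<circ> F) y = coord_map c' c'' G (coord_map c c' F y)"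
    using coord_map_compose_local[OF N F G c x] by blast
  let ?f = "coord_map c c' F" and ?g = "coord_map c' c'' G"
  have xd: "x \<in> coord_domain c c' F" "?f x \<in> coord_domain c' c'' G" using T by auto
  have df: "?f differentiable (at x)" and dg: "?g differentiable (at (?f x))"
    by (rule smooth_map_differentiable[OF F c(1) T(1) xd(1)], rule smooth_map_differentiable[OF G T(1) c(2) xd(2)])
  have D: "dir_deriv (coord_map c c'' (G \<circ> F)) x u = dir_deriv ?g (?f x) (dir_deriv ?f x u)" for u
  proof -
    have "dir_deriv (coord_map c c'' (G \<circ> F)) x u = dir_deriv (\<lambda>y. ?g (?f y)) x u"
      by (rule dir_deriv_cong_open[OF T(2,3,6)])
    also have "\<dots> = dir_deriv ?g (?f x) (dir_deriv ?f x u)"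
      by (rule dir_deriv_eq)
        (rule has_derivative_compose[OF has_derivative_dir_deriv[OF df] has_derivative_dir_deriv[OF dg]])
    finally show ?thesis .
  qed
  have "\<alpha> c x = pullback_field ?f (\<alpha> c') x" "\<alpha> c' (?f x) = pullback_field ?g (\<alpha> c'') (?f x)"
    using pF pG c T(1) xd unfolding is_pullback_def by blast+
  then show "\<alpha> c x = pullback_field (coord_map c c'' (G \<circ> F)) (\<alpha> c'') x"
    using T(6)[OF T(3)] by (simp add: pullback_field_def D fun_eq_iff)
qed

text \<open>In charts the inverse \<open>h\<close> of a coordinate expression \<open>k\<close>
  satisfies \<open>Dk (Dh u) = u\<close>, so pulling back by \<open>h\<close> undoes pulling
  back by \<open>k\<close>.\<close>

lemma is_pullback_inverse:
  fixes N :: "('a, 'e::euclidean_space) atlas_space"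
  assumes N: "smooth_manifold N" and d: "diffeomorphism N N F" and p: "is_pullback N N F \<alpha> \<alpha>"
  shows "is_pullback N N (inv_into (topspace (mtop N)) F) \<alpha> \<alpha>"
  unfolding is_pullback_def
proof (intro ballI)
  let ?T = "topspace (mtop N)"
  let ?G = "inv_into ?T F"
  fix c c' x assume c: "c \<in> atlas N" "c' \<in> atlas N" and x: "x \<in> coord_domain c c' ?G"
  note ch = smooth_manifold_chart[OF N]
  have sF: "smooth_map N N F" and sG: "smooth_map N N ?G" and bij: "bij_betw F ?T ?T"
    using d by (auto simp: diffeomorphism_def)
  have sub: "fst c \<subseteq> ?T" using ch[OF c(1)] openin_subset by (auto simp: is_chart_def)
  let ?h = "coord_map c c' ?G" and ?k = "coord_map c' c F"
  have o: "open (coord_domain c c' ?G)"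
    using open_coord_domain[OF ch[OF c(1)] ch[OF c(2)]] sG by (simp add: smooth_map_def)
  have kh: "?h y \<in> coord_domain c' c F \<and> ?k (?h y) = y" if y: "y \<in> coord_domain c c' ?G" for y
  proof -
    have y1: "y \<in> chart_image c" "?G (chart_inv c y) \<in> fst c'"
      using y by (auto simp: coord_domain_iff[OF ch[OF c(1)]])
    have inU: "chart_inv c y \<in> fst c" by (rule chart_inverse(2)[OF ch[OF c(1)] y1(1)])
    have "chart_inv c' (?h y) = ?G (chart_inv c y)"
      using chart_inverse(1)[OF ch[OF c(2)] y1(2)] by (simp add: coord_map_apply)
    moreover have "F (?G (chart_inv c y)) = chart_inv c y"
      using bij inU sub by (intro bij_betw_inv_into_right[of F ?T ?T]) auto
    ultimately have "F (chart_inv c' (?h y)) = chart_inv c y" by simp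
    then show ?thesis
      using inU coord_map_in_image[OF ch[OF c(1)] y] chart_inverse(3)[OF ch[OF c(1)] y1(1)]
      by (simp add: coord_domain_iff[OF ch[OF c(2)], of _ c F] coord_map_apply[of c' c F])
  qed
  have dh: "?h differentiable (at x)" and dk: "?k differentiable (at (?h x))"
    using smooth_map_differentiable[OF sG c x] smooth_map_differentiable[OF sF c(2,1)] kh[OF x] by auto
  have D: "dir_deriv ?k (?h x) (dir_deriv ?h x u) = u" for u
  proof -
    have "dir_deriv (\<lambda>y. ?k (?h y)) x u = dir_deriv ?k (?h x) (dir_deriv ?h x u)"
      by (rule dir_deriv_eq)
        (rule has_derivative_compose[OF has_derivative_dir_deriv[OF dh] has_derivative_dir_deriv[OF dk]])
    moreover have "dir_deriv (\<lambda>y. ?k (?h y)) x u = dir_deriv (\<lambda>y. y) x u"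
      by (rule dir_deriv_cong_open[OF o x]) (use kh in blast)
    moreover have "dir_deriv (\<lambda>y. y) x u = u"
      by (rule dir_deriv_eq) (rule has_derivative_ident)
    ultimately show ?thesis by simp
  qed
  have "\<alpha> c' (?h x) = pullback_field ?k (\<alpha> c) (?h x)"
    using p c kh[OF x] unfolding is_pullback_def by blast
  then show "\<alpha> c x = pullback_field ?h (\<alpha> c') x"
    using kh[OF x] by (simp add: pullback_field_def D)
qed

lemma diff_formD:
  assumes "diff_form M k \<alpha>" "c \<in> atlas M"
  shows "x \<in> chart_image c \<Longrightarrow> alternating_form k (\<alpha> c x)"
    and "smooth_on (chart_image c) (\<lambda>x. \<alpha> c x v)"
  using assms unfolding diff_form_def by blast+

lemma nearly_kaehler_equations:
  assumes "nearly_kaehler N \<omega> \<psi>" "c \<in> atlas N" "x \<in> chart_image c"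
  shows "ext_d 2 (\<omega> c) x v = 3 * \<psi> c x v"
    and "ext_d 3 (\<lambda>y v. \<psi> c y (\<lambda>i. su3_J (\<omega> c y) (\<psi> c y) (v i))) x v = - 2 * wedge 2 2 (\<omega> c x)
          (\<omega> c x) v"
proof -
  have "ext_deriv 2 \<omega> c x = dform_scale 3 \<psi> c x"
    "ext_deriv 3 (psi_minus \<omega> \<psi>) c x = dform_scale (- 2) (dform_wedge 2 2 \<omega> \<omega>) c x"
    using assms unfolding nearly_kaehler_def dform_eq_def by blast+
  from fun_cong[OF this(1), of v] fun_cong[OF this(2), of v]
  show "ext_d 2 (\<omega> c) x v = 3 * \<psi> c x v"
    "ext_d 3 (\<lambda>y v. \<psi> c y (\<lambda>i. su3_J (\<omega> c y) (\<psi> c y) (v i))) x v = - 2 * wedge 2 2 (\<omega> c x) (\<omega> c x) v"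
    unfolding ext_deriv_ext_d psi_minus_def dform_scale_def dform_wedge_def by simp_all
qed

text
  \<open>\<open>3 F\<^sup>*\<psi> = F\<^sup>* d\<omega> = d F\<^sup>*\<omega> = d\<omega> = 3 \<psi>\<close>.\<close>

lemma nearly_kaehler_pullback_psi:
  fixes N :: "('a, 'e::euclidean_space) atlas_space"
  assumes nk: "nearly_kaehler N \<omega> \<psi>" and F: "smooth_map N N F" and p: "is_pullback N N F \<omega> \<omega>"
  shows "is_pullback N N F \<psi> \<psi>"
  unfolding is_pullback_def
proof (intro ballI)
  fix c c' x assume c: "c \<in> atlas N" "c' \<in> atlas N" and x: "x \<in> coord_domain c c' F"
  have N: "smooth_manifold N" and w: "diff_form N 2 \<omega>"
    using nk by (auto simp: nearly_kaehler_def su3_structure_def)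
  note ch = smooth_manifold_chart[OF N]
  note dw = nearly_kaehler_equations(1)[OF nk]
  have alt: "alternating_form 2 (\<omega> d y)" if "d \<in> atlas N" "y \<in> chart_image d" for d y
    by (rule diff_formD(1)[OF w that])
  let ?U = "coord_domain c c' F" and ?h = "coord_map c c' F"
  have sub: "?U \<subseteq> chart_image c" using coord_domain_iff[OF ch[OF c(1)]] by blast
  have im: "?h ` ?U \<subseteq> chart_image c'" using coord_map_in_image[OF ch[OF c(1)]] by blast
  have oU: "open ?U" using open_coord_domain[OF ch[OF c(1)] ch[OF c(2)]] F by (simp add: smooth_map_def)
  have oV: "open (chart_image c')" using ch[OF c(2)] by (simp add: is_chart_def)
  have "ext_d 2 (\<omega> c) x v = ext_d 2 (\<omega> c') (?h x) (\<lambda>i. dir_deriv ?h x (v i))" for v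
  proof (rule ext_d_2_pullback[OF oU x oV im])
    show "smooth_on ?U ?h" using F c by (simp add: smooth_map_def)
    show "smooth_on (chart_image c') (\<lambda>z. \<omega> c' z v)" for v by (rule diff_formD(2)[OF w c(2)])
    show "\<omega> c y = pullback_field ?h (\<omega> c') y" if "y \<in> ?U" for y
      using p c that by (simp add: is_pullback_def)
    show "alternating_form 2 (\<omega> c y)" if "y \<in> ?U" for y
      using alt[OF c(1)] sub that by blast
    show "alternating_form 2 (\<omega> c' z)" if "z \<in> chart_image c'" for z
      by (rule alt[OF c(2) that])
  qed
  moreover have "x \<in> chart_image c" "?h x \<in> chart_image c'" using sub im x by auto
  ultimately have "3 * \<psi> c x v = 3 * \<psi> c' (?h x) (\<lambda>i. dir_deriv ?h x (v i))" for v
    using dw[OF c(1), of x] dw[OF c(2), of "?h x"] by metis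
  then show "\<psi> c x = pullback_field ?h (\<psi> c') x"
    by (simp add: pullback_field_def fun_eq_iff)
qed

section \<open>Integer powers of a diffeomorphism\<close>

text \<open>Integer powers of a bijection of the set \<open>T\<close>. The inverse is that of
  the restriction to \<open>T\<close>, so the laws of exponents hold at the points of
  \<open>T\<close>.\<close>

definition int_iterate :: "'a set \<Rightarrow> ('a \<Rightarrow> 'a) \<Rightarrow> int \<Rightarrow> 'a \<Rightarrow> 'a" where
  "int_iterate T f n = (if n \<ge> 0 then f ^^ nat n else inv_into T f ^^ nat (- n))"

lemma funpow_in: "(\<And>p. p \<in> T \<Longrightarrow> f p \<in> T) \<Longrightarrow> p \<in> T \<Longrightarrow> (f ^^ n) p \<in> T"
  by (induction n) auto

context
  fixes T :: "'a set" and f :: "'a \<Rightarrow> 'a"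
  assumes bij: "bij_betw f T T"
begin

lemma int_iterate_in: "p \<in> T \<Longrightarrow> int_iterate T f n p \<in> T"
  using bij bij_betw_inv_into[OF bij] unfolding int_iterate_def
  by (auto intro!: funpow_in simp: bij_betw_apply)

lemma int_iterate_0: "int_iterate T f 0 = id"
  by (simp add: int_iterate_def)

lemma int_iterate_of_nat: "int_iterate T f (int n) = f ^^ n"
  by (simp add: int_iterate_def)

lemma int_iterate_Suc:
  assumes p: "p \<in> T"
  shows "int_iterate T f (n + 1) p = f (int_iterate T f n p)"
proof (cases "n \<ge> 0")
  case True
  then have "nat (n + 1) = Suc (nat n)" by simp
  then show ?thesis using True by (simp add: int_iterate_def)
next
  case False
  define m where "m = nat (- (n + 1))"
  have n: "n = - int (Suc m)" using False by (simp add: m_def)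
  have "(inv_into T f ^^ m) p \<in> T"
    using p bij_betw_inv_into[OF bij] by (intro funpow_in) (auto simp: bij_betw_apply)
  then have "f ((inv_into T f ^^ Suc m) p) = (inv_into T f ^^ m) p"
    using bij by (simp add: bij_betw_inv_into_right)
  moreover have "int_iterate T f (n + 1) p = (inv_into T f ^^ m) p"
    by (cases "m = 0") (simp_all add: int_iterate_def n)
  moreover have "int_iterate T f n p = (inv_into T f ^^ Suc m) p"
    by (simp add: int_iterate_def n nat_add_distrib del: funpow.simps)
  ultimately show ?thesis by simp
qed

lemma int_iterate_add:
  assumes p: "p \<in> T"
  shows "int_iterate T f (m + n) p = int_iterate T f m (int_iterate T f n p)"
proof (induction m rule: int_induct[where k = 0])
  case base
  then show ?case by (simp add: int_iterate_0)
next
  case (step1 i)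
  have "int_iterate T f (i + 1 + n) p = f (int_iterate T f (i + n) p)"
    using int_iterate_Suc[OF p, of "i + n"] by (simp add: algebra_simps)
  then show ?case using step1 int_iterate_Suc[OF int_iterate_in[OF p]] by simp
next
  case (step2 i)
  have "f (int_iterate T f (i - 1 + n) p) = f (int_iterate T f (i - 1) (int_iterate T f n p))"
    using step2 int_iterate_Suc[OF p, of "i - 1 + n"] int_iterate_Suc[OF int_iterate_in[OF p], of "i - 1"]
    by (simp add: algebra_simps)
  then show ?case
    using bij int_iterate_in int_iterate_in[OF p] p by (auto simp: bij_betw_def inj_on_def)
qed

lemma int_iterate_minus:
  assumes "p \<in> T"
  shows "int_iterate T f (- n) (int_iterate T f n p) = p"
  using int_iterate_add[OF assms, of "- n" n] by (simp add: int_iterate_0)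

end

lemma smooth_map_id:
  fixes N :: "('a, 'e::euclidean_space) atlas_space"
  assumes "smooth_manifold N"
  shows "smooth_map N N id"
  using assms by (auto simp: smooth_map_def smooth_manifold_def)

lemma int_iterate_smooth_pullback:
  fixes N :: "('a, 'e::euclidean_space) atlas_space"
  assumes N: "smooth_manifold N" and d: "diffeomorphism N N F"
  shows "smooth_map N N (int_iterate (topspace (mtop N)) F n)"
    and "diff_form N k \<alpha> \<Longrightarrow> is_pullback N N F \<alpha> \<alpha> \<Longrightarrow>
      is_pullback N N (int_iterate (topspace (mtop N)) F n) \<alpha> \<alpha>"
proof -
  have pow: "smooth_map N N (G ^^ m)" if G: "smooth_map N N G" for G m
  proof (induction m)
    case 0
    then show ?case using smooth_map_id[OF N] by (simp add: id_def)
  next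
    case (Suc m)
    then show ?case using smooth_map_compose[OF N Suc G] by (simp add: o_def)
  qed
  have sF: "smooth_map N N F" and sG: "smooth_map N N (inv_into (topspace (mtop N)) F)"
    using d by (auto simp: diffeomorphism_def)
  show "smooth_map N N (int_iterate (topspace (mtop N)) F n)"
    unfolding int_iterate_def using pow sF sG by simp
  assume \<alpha>: "diff_form N k \<alpha>" and p: "is_pullback N N F \<alpha> \<alpha>"
  have powp: "is_pullback N N (G ^^ m) \<alpha> \<alpha>" if G: "smooth_map N N G" "is_pullback N N G \<alpha> \<alpha>" for G m
  proof (induction m)
    case 0
    then show ?case using \<alpha> by (simp add: diff_form_def id_def)
  next
    case (Suc m)
    then show ?case using is_pullback_compose[OF N pow[OF G(1)] G(1) Suc G(2)] by (simp add: o_def)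
  qed
  show "is_pullback N N (int_iterate (topspace (mtop N)) F n) \<alpha> \<alpha>"
    unfolding int_iterate_def using powp[OF sF p] powp[OF sG is_pullback_inverse[OF N d p]] by simp
qed

section \<open>The mapping torus as a smooth manifold\<close>

lemma second_countable_euclidean:
  "second_countable (euclidean :: 'a::second_countable_topology topology)"
proof -
  obtain B :: "'a set set" where B: "countable B" "topological_basis B"
    using ex_countable_basis by blast
  show ?thesis
    unfolding second_countable_def
  proof (intro exI[of _ B] conjI ballI allI impI)
    show "openin euclidean V" if "V \<in> B" for V
      using topological_basis_open[OF B(2) that] by simp
    fix U and x :: 'a assume "openin euclidean U \<and> x \<in> U"
    then show "\<exists>V\<in>B. x \<in> V \<and> V \<subseteq> U"
      using topological_basisE[OF B(2), of U x] by auto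
  qed (rule B)
qed

lemma second_countable_prod_topology:
  assumes "second_countable X" "second_countable Y"
  shows "second_countable (prod_topology X Y)"
proof -
  obtain A where A: "countable A" "\<forall>V\<in>A. openin X V"
    "\<forall>U x. openin X U \<and> x \<in> U \<longrightarrow> (\<exists>V\<in>A. x \<in> V \<and> V \<subseteq> U)"
    using assms(1) unfolding second_countable_def by (elim exE conjE)
  obtain B where B: "countable B" "\<forall>V\<in>B. openin Y V"
    "\<forall>U x. openin Y U \<and> x \<in> U \<longrightarrow> (\<exists>V\<in>B. x \<in> V \<and> V \<subseteq> U)"
    using assms(2) unfolding second_countable_def by (elim exE conjE)
  show ?thesis
    unfolding second_countable_def
  proof (intro exI[of _ "(\<lambda>(V, W). V \<times> W) ` (A \<times> B)"] conjI ballI allI impI)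
    show "countable ((\<lambda>(V, W). V \<times> W) ` (A \<times> B))" using A(1) B(1) by simp
    show "openin (prod_topology X Y) V" if "V \<in> (\<lambda>(V, W). V \<times> W) ` (A \<times> B)" for V
      using that A(2) B(2) by (auto simp: openin_prod_Times_iff)
    fix U z assume U: "openin (prod_topology X Y) U \<and> z \<in> U"
    obtain x y where z: "z = (x, y)" by (cases z)
    obtain V W where V: "openin X V" "openin Y W" "x \<in> V" "y \<in> W" "V \<times> W \<subseteq> U"
      using openin_prod_topology_alt[THEN iffD1, rule_format, of X Y U x y] U z by auto
    obtain V' where V': "V' \<in> A" "x \<in> V'" "V' \<subseteq> V"
      using A(3)[rule_format, OF conjI[OF V(1,3)]] by (elim bexE conjE)
    obtain W' where W': "W' \<in> B" "y \<in> W'" "W' \<subseteq> W"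
      using B(3)[rule_format, OF conjI[OF V(2,4)]] by (elim bexE conjE)
    have "V' \<times> W' \<subseteq> U" using V'(3) W'(3) V(5) by blast
    moreover have "V' \<times> W' \<in> (\<lambda>(V, W). V \<times> W) ` (A \<times> B)"
      using V'(1) W'(1) by (intro image_eqI[of _ _ "(V', W')"]) auto
    ultimately show "\<exists>V\<in>(\<lambda>(V, W). V \<times> W) ` (A \<times> B). z \<in> V \<and> V \<subseteq> U"
      using V'(2) W'(2) z by (intro bexI[of _ "V' \<times> W'"]) auto
  qed
qed

context
  fixes N :: "('a, 'e::euclidean_space) atlas_space" and \<nu> :: "'a \<Rightarrow> 'a"
  assumes N: "smooth_manifold N" and \<nu>: "diffeomorphism N N \<nu>"
begin

abbreviation "carrier_N \<equiv> topspace (mtop N)"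
abbreviation "iter \<equiv> int_iterate carrier_N \<nu>"
abbreviation "cover \<equiv> prod_topology (mtop N) euclideanreal"
abbreviation "proj \<equiv> torus_class N \<nu>"
abbreviation "torus \<equiv> quotient_topology_by cover proj"

lemma nu_bij: "bij_betw \<nu> carrier_N carrier_N"
  using \<nu> by (simp add: diffeomorphism_def)

lemma iter_continuous: "continuous_map (mtop N) (mtop N) (iter n)"
  using int_iterate_smooth_pullback(1)[OF N \<nu>] by (simp add: smooth_map_def)

text \<open>The points of the mapping torus are the orbits of the infinite cyclic group
  generated by \<open>(p, t) \<mapsto> (\<nu> p, t + 1)\<close>.\<close>

lemma torus_class_iter:
  assumes p: "p \<in> carrier_N"
  shows "proj (p, t) = range (\<lambda>n. (iter n p, t + of_int n))"
proof (intro equalityI subsetI)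
  fix y assume "y \<in> proj (p, t)"
  then obtain r s n where y: "y = (r, s)" "r \<in> carrier_N"
    and n: "r = (\<nu> ^^ n) p \<and> s = t + real n \<or> p = (\<nu> ^^ n) r \<and> t = s + real n"
    by (auto simp: torus_class_def)
  from n show "y \<in> range (\<lambda>n. (iter n p, t + of_int n))"
  proof
    assume "r = (\<nu> ^^ n) p \<and> s = t + real n"
    then have "y = (iter (int n) p, t + of_int (int n))"
      using y by (simp add: int_iterate_of_nat[OF nu_bij])
    then show ?thesis by blast
  next
    assume a: "p = (\<nu> ^^ n) r \<and> t = s + real n"
    then have "iter (- int n) p = r"
      using int_iterate_minus[OF nu_bij y(2), of "int n"] by (simp add: int_iterate_of_nat[OF nu_bij])
    then have "y = (iter (- int n) p, t + of_int (- int n))"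
      using y a by simp
    then show ?thesis by blast
  qed
next
  fix y assume "y \<in> range (\<lambda>n. (iter n p, t + of_int n))"
  then obtain n where y: "y = (iter n p, t + of_int n)" by blast
  have "\<exists>m. iter n p = (\<nu> ^^ m) p \<and> t + of_int n = t + real m \<or>
      p = (\<nu> ^^ m) (iter n p) \<and> t = t + of_int n + real m"
  proof (cases "n \<ge> 0")
    case True
    then show ?thesis
      by (intro exI[of _ "nat n"]) (simp add: int_iterate_def)
  next
    case False
    have "(\<nu> ^^ nat (- n)) (iter n p) = iter (- n) (iter n p)"
      using False by (simp add: int_iterate_def[of _ _ "- n"])
    also have "\<dots> = p" by (rule int_iterate_minus[OF nu_bij p])
    finally show ?thesis
      using False by (intro exI[of _ "nat (- n)"]) simp
  qed
  then show "y \<in> proj (p, t)"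
    using int_iterate_in[OF nu_bij p, of n] unfolding y by (simp add: torus_class_def)
qed

lemma proj_eq_iff:
  assumes p: "p \<in> carrier_N" "p' \<in> carrier_N"
  shows "proj (p, t) = proj (p', t') \<longleftrightarrow> (\<exists>n. p' = iter n p \<and> t' = t + of_int n)"
proof
  assume eq: "proj (p, t) = proj (p', t')"
  have "(iter 0 p', t' + of_int 0) \<in> proj (p', t')"
    unfolding torus_class_iter[OF p(2)] by (rule rangeI)
  then have "(p', t') \<in> range (\<lambda>n. (iter n p, t + of_int n))"
    unfolding eq[symmetric] torus_class_iter[OF p(1)] by (simp add: int_iterate_0[OF nu_bij])
  then show "\<exists>n. p' = iter n p \<and> t' = t + of_int n" by auto
next
  assume "\<exists>n. p' = iter n p \<and> t' = t + of_int n"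
  then obtain n where n: "p' = iter n p" "t' = t + of_int n" by blast
  define G where "G m = (iter m p, t + of_int m)" for m
  have "(iter m p', t' + of_int m) = G (m + n)" for m
    using int_iterate_add[OF nu_bij p(1), of m n] by (simp add: n G_def)
  then have "proj (p', t') = G ` range (\<lambda>m. m + n)"
    unfolding torus_class_iter[OF p(2)] by (simp only: image_image)
  also have "range (\<lambda>m. m + n) = UNIV"
    by (rule surjI[where f = "\<lambda>m. m - n"]) simp
  also have "range G = proj (p, t)"
    unfolding torus_class_iter[OF p(1)] by (simp add: G_def)
  finally show "proj (p, t) = proj (p', t')" ..
qed

text \<open>Every deck transformation other than the identity moves the real coordinate by at
  least 1.\<close>

lemma proj_eq_near:
  assumes "p \<in> carrier_N" "p' \<in> carrier_N" "\<bar>t - t'\<bar> < 1" "proj (p, t) = proj (p', t')"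
  shows "p' = p \<and> t' = t"
proof -
  obtain n where n: "p' = iter n p" "t' = t + of_int n"
    using proj_eq_iff[OF assms(1,2)] assms(4) by blast
  then have "n = 0" using assms(3) by simp
  then show ?thesis using n by (simp add: int_iterate_0[OF nu_bij])
qed

lemma torus_topspace: "topspace torus = proj ` (carrier_N \<times> UNIV)"
  using quotient_imp_surjective_map[OF quotient_map_quotient_topology_by[of cover proj]] by simp

lemma proj_continuous: "continuous_map cover torus proj"
  by (rule quotient_imp_continuous_map[OF quotient_map_quotient_topology_by])

text \<open>The preimage of the image of an open set \<open>W\<close> is the union of the
  translates of \<open>W\<close> by deck transformations, which are homeomorphisms.\<close>

lemma proj_open_map: "open_map cover torus proj"
  unfolding open_map_def
proof (intro allI impI)
  fix W assume W: "openin cover W"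
  have sub: "W \<subseteq> carrier_N \<times> UNIV" using openin_subset[OF W] by simp
  define deck where "deck n y = (iter n (fst y), snd y + real_of_int n)" for n :: int and y :: "'a \<times> real"
  have deck: "continuous_map cover cover (deck n)" for n
    unfolding deck_def
    by (intro continuous_map_pairedI continuous_map_compose[OF continuous_map_fst iter_continuous, unfolded o_def]
        continuous_map_add continuous_map_snd continuous_map_const[THEN iffD2]) simp
  have "{y \<in> topspace cover. proj y \<in> proj ` W} = (\<Union>n. {y \<in> topspace cover. deck n y \<in> W})"
  proof (intro equalityI subsetI)
    fix y assume "y \<in> {y \<in> topspace cover. proj y \<in> proj ` W}"
    then obtain w where y: "y \<in> topspace cover" and w: "w \<in> W" "proj y = proj w" by blast
    then have "fst y \<in> carrier_N" "fst w \<in> carrier_N" using sub by auto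
    then obtain n where "fst w = iter n (fst y)" "snd w = snd y + of_int n"
      using proj_eq_iff[of "fst y" "fst w" "snd y" "snd w"] w(2) by auto
    then have "deck n y = w" by (simp add: deck_def prod_eq_iff)
    then show "y \<in> (\<Union>n. {y \<in> topspace cover. deck n y \<in> W})" using y w by auto
  next
    fix y assume "y \<in> (\<Union>n. {y \<in> topspace cover. deck n y \<in> W})"
    then obtain n where y: "y \<in> topspace cover" "deck n y \<in> W" by blast
    have y1: "fst y \<in> carrier_N" using y(1) by auto
    have "proj (fst y, snd y) = proj (iter n (fst y), snd y + of_int n)"
      using proj_eq_iff[OF y1 int_iterate_in[OF nu_bij y1]] by blast
    then have "proj y = proj (deck n y)" by (simp add: deck_def)
    then show "y \<in> {y \<in> topspace cover. proj y \<in> proj ` W}" using y by auto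
  qed
  moreover have "openin cover (\<Union>n. {y \<in> topspace cover. deck n y \<in> W})"
    by (intro openin_Union) (use openin_continuous_map_preimage[OF deck W] in auto)
  ultimately show "openin torus (proj ` W)"
    using sub by (auto simp: openin_quotient_topology_by)
qed

lemma torus_second_countable: "second_countable torus"
proof (rule second_countable_open_map_image[OF proj_continuous proj_open_map])
  show "proj ` topspace cover = topspace torus" by (simp add: torus_topspace)
  have "second_countable (mtop N)" using N by (simp add: smooth_manifold_def)
  then show "second_countable cover"
    by (rule second_countable_prod_topology[OF _ second_countable_euclidean])
qed

text \<open>If the real coordinates of two points agree modulo 1, the points have
  representatives at the same height; these are separated in \<open>N\<close>, and over an
  interval of length 1 distinct points are not identified. Otherwise the heights have positive
  distance modulo 1, and neighbourhoods of the heights separate the points.\<close>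

lemma torus_Hausdorff: "Hausdorff_space torus"
  unfolding Hausdorff_space_def
proof (intro allI impI)
  fix P P' assume P: "P \<in> topspace torus \<and> P' \<in> topspace torus \<and> P \<noteq> P'"
  then obtain p t p' t' where p: "P = proj (p, t)" "P' = proj (p', t')" "p \<in> carrier_N" "p' \<in> carrier_N"
    by (auto simp: torus_topspace)
  have sep: "\<exists>U V. openin torus U \<and> openin torus V \<and> P \<in> U \<and> P' \<in> V \<and> disjnt U V"
    if "openin cover A" "openin cover B" "P \<in> proj ` A" "P' \<in> proj ` B" "disjnt (proj ` A) (proj ` B)" for A B
    using that proj_open_map unfolding open_map_def by blast
  show "\<exists>U V. openin torus U \<and> openin torus V \<and> P \<in> U \<and> P' \<in> V \<and> disjnt U V"
  proof (cases "\<exists>n. t' = t + real_of_int n")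
    case True
    then obtain n where n: "t' = t + real_of_int n" by blast
    define r where "r = iter (- n) p'"
    have r: "r \<in> carrier_N" using int_iterate_in[OF nu_bij p(4)] by (simp add: r_def)
    have "proj (p', t') = proj (r, t)"
      unfolding proj_eq_iff[OF p(4) r] by (intro exI[of _ "- n"]) (simp add: r_def n)
    then have P': "P' = proj (r, t)" using p by simp
    then have "p \<noteq> r" using P p by auto
    then obtain U V where UV: "openin (mtop N) U" "openin (mtop N) V" "p \<in> U" "r \<in> V" "disjnt U V"
      using N p(3) r unfolding smooth_manifold_def Hausdorff_space_def by blast
    let ?I = "{t - 1 / 2 <..< t + 1 / 2}"
    show ?thesis
    proof (rule sep[of "U \<times> ?I" "V \<times> ?I"])
      show "openin cover (U \<times> ?I)" "openin cover (V \<times> ?I)"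
        using UV by (simp_all add: openin_prod_Times_iff)
      show "P \<in> proj ` (U \<times> ?I)" "P' \<in> proj ` (V \<times> ?I)"
        using UV p(1) P' by (auto intro!: imageI)
      show "disjnt (proj ` (U \<times> ?I)) (proj ` (V \<times> ?I))"
        unfolding disjnt_iff
      proof (intro allI notI)
        fix z assume "z \<in> proj ` (U \<times> ?I) \<and> z \<in> proj ` (V \<times> ?I)"
        then obtain u s v s' where uv: "proj (u, s) = proj (v, s')" "u \<in> U" "v \<in> V" "s \<in> ?I" "s' \<in> ?I" by auto
        then have "u \<in> carrier_N" "v \<in> carrier_N" "\<bar>s - s'\<bar> < 1" using UV openin_subset by auto
        then have "v = u" using proj_eq_near uv(1) by blast
        then show False using uv UV(5) by (auto simp: disjnt_iff)
      qed
    qed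
  next
    case False
    define \<rho> where "\<rho> = frac (t' - t)"
    have \<rho>: "0 < \<rho>" "\<rho> < 1"
    proof -
      have "\<rho> \<noteq> 0" using False by (auto simp: \<rho>_def frac_eq_0_iff Ints_def algebra_simps)
      then show "0 < \<rho>" "\<rho> < 1" using frac_ge_0[of "t' - t"] frac_lt_1[of "t' - t"] by (auto simp: \<rho>_def)
    qed
    define \<epsilon> where "\<epsilon> = min \<rho> (1 - \<rho>) / 2"
    have \<epsilon>: "\<epsilon> > 0" using \<rho> by (simp add: \<epsilon>_def)
    let ?A = "carrier_N \<times> {t - \<epsilon> <..< t + \<epsilon>}" and ?B = "carrier_N \<times> {t' - \<epsilon> <..< t' + \<epsilon>}"
    show ?thesis
    proof (rule sep[of ?A ?B])
      show "openin cover ?A" "openin cover ?B" by (simp_all add: openin_prod_Times_iff)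
      show "P \<in> proj ` ?A" "P' \<in> proj ` ?B" using p \<epsilon> by (auto intro!: imageI)
      show "disjnt (proj ` ?A) (proj ` ?B)"
        unfolding disjnt_iff
      proof (intro allI notI)
        fix z assume "z \<in> proj ` ?A \<and> z \<in> proj ` ?B"
        then obtain u s v s' where uv: "proj (u, s) = proj (v, s')" "u \<in> carrier_N" "v \<in> carrier_N"
          "s \<in> {t - \<epsilon> <..< t + \<epsilon>}" "s' \<in> {t' - \<epsilon> <..< t' + \<epsilon>}" by auto
        then obtain n where n: "s' = s + real_of_int n" using proj_eq_iff by blast
        have "t' - t = of_int \<lfloor>t' - t\<rfloor> + \<rho>" by (simp add: \<rho>_def frac_def)
        then have "real_of_int (n - \<lfloor>t' - t\<rfloor>) > \<rho> - 2 * \<epsilon>" "real_of_int (n - \<lfloor>t' - t\<rfloor>) <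
              \<rho> + 2 * \<epsilon>"
          using uv(4,5) n by auto
        then have "real_of_int (n - \<lfloor>t' - t\<rfloor>) > 0" "real_of_int (n - \<lfloor>t' - t\<rfloor>) < 1"
          by (auto simp: \<epsilon>_def)
        then have "n - \<lfloor>t' - t\<rfloor> > 0" "n - \<lfloor>t' - t\<rfloor> < 1"
          unfolding of_int_0_less_iff of_int_less_1_iff .
        then show False by simp
      qed
    qed
  qed
qed

text \<open>An orbit meets the domain of a chart only once, since the interval has length
  1.\<close>

lemma torus_chart_apply:
  assumes c: "c \<in> atlas N" and y: "p \<in> fst c" "t \<in> {a <..< a + 1}"
  shows "snd (torus_chart N \<nu> c a) (proj (p, t)) = (snd c p, t)"
proof -
  have sub: "fst c \<subseteq> carrier_N"
    using smooth_manifold_chart[OF N c] openin_subset by (auto simp: is_chart_def)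
  have "(THE y. y \<in> proj (p, t) \<and> y \<in> fst c \<times> {a <..< a + 1}) = (p, t)"
  proof (rule the_equality)
    have pc: "p \<in> carrier_N" using y sub by blast
    have "(iter 0 p, t + of_int 0) \<in> proj (p, t)"
      unfolding torus_class_iter[OF pc] by (rule rangeI)
    then show "(p, t) \<in> proj (p, t) \<and> (p, t) \<in> fst c \<times> {a <..< a + 1}"
      using y by (simp add: int_iterate_0[OF nu_bij])
    fix z assume z: "z \<in> proj (p, t) \<and> z \<in> fst c \<times> {a <..< a + 1}"
    then obtain n where n: "z = (iter n p, t + of_int n)"
      unfolding torus_class_iter[OF pc] by blast
    then have "n = 0" using z y by auto
    then show "z = (p, t)" using n by (simp add: int_iterate_0[OF nu_bij])
  qed
  then show ?thesis by (simp add: torus_chart_def)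
qed

lemma torus_chart_image:
  assumes c: "c \<in> atlas N"
  shows "chart_image (torus_chart N \<nu> c a) = chart_image c \<times> {a <..< a + 1}"
proof -
  have "chart_image (torus_chart N \<nu> c a) =
      (\<lambda>y. snd (torus_chart N \<nu> c a) (proj y)) ` (fst c \<times> {a <..< a + 1})"
    by (simp add: torus_chart_def image_image)
  also have "\<dots> = (\<lambda>(p, t). (snd c p, t)) ` (fst c \<times> {a <..< a + 1})"
    by (rule image_cong) (auto simp: torus_chart_apply[OF c])
  also have "\<dots> = chart_image c \<times> {a <..< a + 1}"
    using image_paired_Times[of "snd c" "\<lambda>t. t" "fst c" "{a <..< a + 1}"] by simp
  finally show ?thesis .
qed

text \<open>The projection is open, continuous and injective on the domain, hence a
  homeomorphism onto its image; the chart is the product of \<open>c\<close> with the identity,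
  composed with the inverse of this homeomorphism.\<close>

lemma torus_is_chart:
  assumes c: "c \<in> atlas N"
  shows "is_chart torus (torus_chart N \<nu> c a)"
proof -
  let ?C = "torus_chart N \<nu> c a"
  let ?I = "{a <..< a + 1}"
  let ?W = "fst c \<times> ?I"
  note ch = smooth_manifold_chart[OF N c]
  have sub: "fst c \<subseteq> carrier_N" using ch openin_subset by (auto simp: is_chart_def)
  have W: "openin cover ?W" using ch by (simp add: openin_prod_Times_iff is_chart_def)
  have qW: "openin torus (proj ` ?W)" using proj_open_map W unfolding open_map_def by blast
  have tW: "topspace (subtopology cover ?W) = ?W" using openin_subset[OF W] by auto
  have tqW: "topspace (subtopology torus (proj ` ?W)) = proj ` ?W" using openin_subset[OF qW] by auto
  have inj: "inj_on proj ?W"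
  proof (rule inj_onI)
    fix y z assume yz: "y \<in> ?W" "z \<in> ?W" "proj y = proj z"
    then have "fst y \<in> carrier_N" "fst z \<in> carrier_N" "\<bar>snd y - snd z\<bar> < 1" using sub by auto
    from proj_eq_near[OF this] yz(3) show "y = z" by (simp add: prod_eq_iff)
  qed
  have hq: "homeomorphic_map (subtopology cover ?W) (subtopology torus (proj ` ?W)) proj"
  proof (rule bijective_open_imp_homeomorphic_map)
    show "continuous_map (subtopology cover ?W) (subtopology torus (proj ` ?W)) proj"
      using continuous_map_from_subtopology[OF proj_continuous] tW
      by (auto simp: continuous_map_in_subtopology)
    show "open_map (subtopology cover ?W) (subtopology torus (proj ` ?W)) proj"
      by (rule open_map_into_subtopology[OF open_map_from_subtopology[OF proj_open_map W]]) (use tW in auto)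
  qed (use tW tqW inj in auto)
  have hc: "homeomorphic_map (subtopology (mtop N) (fst c)) (top_of_set (chart_image c)) (snd c)"
    and oc: "open (chart_image c)" using ch by (auto simp: is_chart_def)
  obtain g where g: "homeomorphic_maps (subtopology (mtop N) (fst c)) (top_of_set (chart_image c)) (snd c) g"
    using hc homeomorphic_map_maps by blast
  have "homeomorphic_maps (top_of_set ?I) (top_of_set ?I) (\<lambda>t. t) (\<lambda>t. t)"
    by (simp add: homeomorphic_maps_def)
  with g have "homeomorphic_maps (prod_topology (subtopology (mtop N) (fst c)) (top_of_set ?I))
      (prod_topology (top_of_set (chart_image c)) (top_of_set ?I)) (\<lambda>(x, y). (snd c x, y)) (\<lambda>(x, y). (g x, y))"
    unfolding homeomorphic_maps_prod by blast
  then have hF: "homeomorphic_map (subtopology cover ?W) (top_of_set (chart_image c \<times> ?I)) (\<lambda>(x, y). (snd c x, y))"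
    using homeomorphic_map_maps by (auto simp: subtopology_Times)
  obtain q' where q': "homeomorphic_maps (subtopology cover ?W) (subtopology torus (proj ` ?W)) proj q'"
    using hq homeomorphic_map_maps by blast
  then have "homeomorphic_map (subtopology torus (proj ` ?W)) (subtopology cover ?W) q'"
    using homeomorphic_maps_sym homeomorphic_maps_imp_map by blast
  from homeomorphic_map_compose[OF this hF]
  have "homeomorphic_map (subtopology torus (proj ` ?W)) (top_of_set (chart_image c \<times> ?I)) ((\<lambda>(x, y). (snd c x, y)) \<circ> q')" .
  then have "homeomorphic_map (subtopology torus (proj ` ?W)) (top_of_set (chart_image c \<times> ?I)) (snd ?C)"
  proof (rule homeomorphic_map_eq)
    fix P assume "P \<in> topspace (subtopology torus (proj ` ?W))"
    then obtain p t where P: "P = proj (p, t)" "(p, t) \<in> ?W" unfolding tqW by auto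
    then have "q' P = (p, t)" using q' tW by (auto simp: homeomorphic_maps_def)
    then show "((\<lambda>(x, y). (snd c x, y)) \<circ> q') P = snd ?C P"
      using P torus_chart_apply[OF c, of p t a] by simp
  qed
  then show ?thesis
    unfolding is_chart_def torus_chart_image[OF c]
    using qW oc by (simp add: torus_chart_def open_Times)
qed

text \<open>The representatives of \<open>z\<close> in the two domains differ by a deck
  transformation, whose exponent \<open>n\<close> depends on \<open>z\<close>. The same
  transformation maps all points near the first representative into the second domain, so
  \<open>n\<close> serves for a whole neighbourhood.\<close>

lemma torus_transition:
  assumes c: "c \<in> atlas N" and c': "c' \<in> atlas N"
    and z: "z \<in> coord_domain (torus_chart N \<nu> c a) (torus_chart N \<nu> c' a') id"
  obtains n D where "open D" "z \<in> D" "fst ` D \<subseteq> coord_domain c c' (iter n)"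
    "\<And>y. y \<in> D \<Longrightarrow> coord_map (torus_chart N \<nu> c a) (torus_chart N \<nu> c' a') id y =
      (coord_map c c' (iter n) (fst y), snd y + of_int n)"
proof -
  let ?C = "torus_chart N \<nu> c a" and ?C' = "torus_chart N \<nu> c' a'"
  note ch = smooth_manifold_chart[OF N c] and ch' = smooth_manifold_chart[OF N c']
  have sub: "fst c \<subseteq> carrier_N" "fst c' \<subseteq> carrier_N" using ch ch' openin_subset by (auto simp: is_chart_def)
  have inv: "chart_inv ?C y = proj (chart_inv c (fst y), snd y)"
    if "fst y \<in> chart_image c" "snd y \<in> {a <..< a + 1}" for y
  proof -
    have "chart_inv c (fst y) \<in> fst c" by (rule chart_inverse(2)[OF ch that(1)])
    then have "snd ?C (proj (chart_inv c (fst y), snd y)) = y" "proj (chart_inv c (fst y), snd y) \<in> fst ?C"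
      using torus_chart_apply[OF c _ that(2)] chart_inverse(3)[OF ch that(1)] that(2)
      by (auto simp: prod_eq_iff torus_chart_def)
    then show ?thesis using chart_inverse(1)[OF torus_is_chart[OF c, of a]] by metis
  qed
  have z1: "fst z \<in> chart_image c" "snd z \<in> {a <..< a + 1}" "chart_inv ?C z \<in> fst ?C'"
    using z torus_chart_image[OF c, of a] by (auto simp: coord_domain_iff[OF torus_is_chart[OF c]])
  have gz: "chart_inv c (fst z) \<in> fst c" by (rule chart_inverse(2)[OF ch z1(1)])
  have "proj (chart_inv c (fst z), snd z) \<in> proj ` (fst c' \<times> {a' <..< a' + 1})"
    using z1(3) inv[OF z1(1,2)] by (simp add: torus_chart_def)
  then obtain p' t' where p': "proj (chart_inv c (fst z), snd z) = proj (p', t')" "p' \<in> fst c'" "t' \<in> {a' <..< a' + 1}"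
    by auto
  then obtain n where n: "p' = iter n (chart_inv c (fst z))" "t' = snd z + of_int n"
    using proj_eq_iff[of "chart_inv c (fst z)" p' "snd z" t'] gz sub by auto
  \<comment> \<open>The points whose translate by the \<open>n\<close>-th deck transformation
    lies in the domain of the second chart.\<close>
  define D where "D = coord_domain c c' (iter n) \<times> ({a <..< a + 1} \<inter> {a' - of_int n <..< a' + 1 - of_int n})"
  show thesis
  proof (rule that[of D n])
    show "open D"
      unfolding D_def by (intro open_Times open_coord_domain[OF ch ch' iter_continuous] open_Int) auto
    show "z \<in> D"
      using z1 p' n by (cases z) (auto simp: D_def coord_domain_iff[OF ch])
    show "fst ` D \<subseteq> coord_domain c c' (iter n)" by (auto simp: D_def)
    fix y assume "y \<in> D"
    then have y: "fst y \<in> chart_image c" "snd y \<in> {a <..< a + 1}" "iter n (chart_inv c (fst y)) \<in> fst c'"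
      "snd y + of_int n \<in> {a' <..< a' + 1}"
      by (auto simp: D_def coord_domain_iff[OF ch])
    have g: "chart_inv c (fst y) \<in> carrier_N" using chart_inverse(2)[OF ch y(1)] sub by blast
    have "chart_inv ?C y = proj (iter n (chart_inv c (fst y)), snd y + of_int n)"
      unfolding inv[OF y(1,2)] proj_eq_iff[OF g int_iterate_in[OF nu_bij g]] by blast
    then show "coord_map ?C ?C' id y = (coord_map c c' (iter n) (fst y), snd y + of_int n)"
      using torus_chart_apply[OF c' y(3,4)] by (simp add: coord_map_apply)
  qed
qed

lemma atlas_mapping_torus:
  "C \<in> atlas (mapping_torus N \<nu>) \<longleftrightarrow> (\<exists>c a. c \<in> atlas N \<and> C = torus_chart N \<nu> c a)"
  unfolding mapping_torus_def by (simp, blast)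

lemma mapping_torus_smooth_manifold: "smooth_manifold (mapping_torus N \<nu>)"
proof -
  have cover_charts: "(\<Union>C\<in>atlas (mapping_torus N \<nu>). fst C) = topspace torus"
  proof (intro equalityI subsetI)
    fix P assume "P \<in> (\<Union>C\<in>atlas (mapping_torus N \<nu>). fst C)"
    then obtain C where C: "C \<in> atlas (mapping_torus N \<nu>)" "P \<in> fst C" by blast
    then obtain c a where c: "c \<in> atlas N" "C = torus_chart N \<nu> c a" by (auto simp only: atlas_mapping_torus)
    have "fst C \<subseteq> topspace torus"
      unfolding c(2) using torus_is_chart[OF c(1), of a] openin_subset unfolding is_chart_def by blast
    then show "P \<in> topspace torus" using C(2) by blast
  next
    fix P assume "P \<in> topspace torus"
    then obtain p t where P: "P = proj (p, t)" "p \<in> carrier_N" by (auto simp: torus_topspace)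
    obtain c where c: "c \<in> atlas N" "p \<in> fst c" by (rule smooth_manifold_chart_exists[OF N P(2)])
    have "P \<in> fst (torus_chart N \<nu> c (t - 1 / 2))"
      using P c by (auto simp: torus_chart_def intro!: imageI)
    moreover have "torus_chart N \<nu> c (t - 1 / 2) \<in> atlas (mapping_torus N \<nu>)"
      using c(1) atlas_mapping_torus by blast
    ultimately show "P \<in> (\<Union>C\<in>atlas (mapping_torus N \<nu>). fst C)" by blast
  qed
  have smooth: "smooth_on (coord_domain (torus_chart N \<nu> c a) (torus_chart N \<nu> c' a') id)
      (coord_map (torus_chart N \<nu> c a) (torus_chart N \<nu> c' a') id)"
    if c: "c \<in> atlas N" "c' \<in> atlas N" for c c' a a'
  proof (rule smooth_on_local)
    let ?C = "torus_chart N \<nu> c a" and ?C' = "torus_chart N \<nu> c' a'"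
    fix z assume z: "z \<in> coord_domain ?C ?C' id"
    obtain n D where D: "open D" "z \<in> D" "fst ` D \<subseteq> coord_domain c c' (iter n)"
      "\<And>y. y \<in> D \<Longrightarrow> coord_map ?C ?C' id y = (coord_map c c' (iter n) (fst y), snd y + of_int n)"
      by (rule torus_transition[OF c z]) blast
    have sm: "smooth_on (coord_domain c c' (iter n)) (coord_map c c' (iter n))"
      using int_iterate_smooth_pullback(1)[OF N \<nu>] c by (simp add: smooth_map_def)
    have "smooth_on D (\<lambda>y. (coord_map c c' (iter n) (fst y), snd y + of_int n))"
      by (intro smooth_on_Pair smooth_on_compose[OF D(1) sm _ D(3)] smooth_on_add D(1) smooth_on_const
          smooth_on_bounded_linear bounded_linear_fst bounded_linear_snd)
    then have "smooth_on D (coord_map ?C ?C' id)"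
      by (rule smooth_on_cong[OF D(1), rotated]) (simp add: D(4))
    then show "\<exists>T. open T \<and> z \<in> T \<and> smooth_on T (coord_map ?C ?C' id)" using D by blast
  qed
  have top: "mtop (mapping_torus N \<nu>) = torus" by (simp add: mapping_torus_def)
  show ?thesis
    unfolding smooth_manifold_def top
  proof (intro conjI ballI)
    show "Hausdorff_space torus" by (rule torus_Hausdorff)
    show "second_countable torus" by (rule torus_second_countable)
    show "(\<Union>C\<in>atlas (mapping_torus N \<nu>). fst C) = topspace torus" by (rule cover_charts)
    fix C assume "C \<in> atlas (mapping_torus N \<nu>)"
    then obtain c a where c: "c \<in> atlas N" "C = torus_chart N \<nu> c a" by (auto simp only: atlas_mapping_torus)
    show "is_chart torus C" unfolding c(2) by (rule torus_is_chart[OF c(1)])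
    fix C' assume "C' \<in> atlas (mapping_torus N \<nu>)"
    then obtain c' a' where c': "c' \<in> atlas N" "C' = torus_chart N \<nu> c' a'" by (auto simp only: atlas_mapping_torus)
    show "smooth_on (coord_domain C C' id) (coord_map C C' id)"
      unfolding c(2) c'(2) by (rule smooth[OF c(1) c'(1)])
  qed
qed

end

section \<open>Descent to the mapping torus\<close>

text \<open>The transition maps translate the real coordinate by a locally constant amount, so
  they preserve \<open>dt\<close>, and on the factor \<open>N\<close> they act as powers of
  \<open>\<nu>\<close>.\<close>

lemma torus_transition_derivative:
  fixes N :: "('a, 'e::euclidean_space) atlas_space"
  assumes N: "smooth_manifold N" and \<nu>: "diffeomorphism N N \<nu>"
    and c: "c \<in> atlas N" "c' \<in> atlas N"
    and z: "z \<in> coord_domain (torus_chart N \<nu> c a) (torus_chart N \<nu> c' a') id"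
  obtains n where "fst z \<in> coord_domain c c' (int_iterate (topspace (mtop N)) \<nu> n)"
    "fst (coord_map (torus_chart N \<nu> c a) (torus_chart N \<nu> c' a') id z) =
      coord_map c c' (int_iterate (topspace (mtop N)) \<nu> n) (fst z)"
    "\<And>V. dir_deriv (coord_map (torus_chart N \<nu> c a) (torus_chart N \<nu> c' a') id) z V =
      (dir_deriv (coord_map c c' (int_iterate (topspace (mtop N)) \<nu> n)) (fst z) (fst V), snd V)"
proof -
  let ?i = "int_iterate (topspace (mtop N)) \<nu>"
  let ?F = "coord_map (torus_chart N \<nu> c a) (torus_chart N \<nu> c' a') id"
  obtain n D where D: "open D" "z \<in> D" "fst ` D \<subseteq> coord_domain c c' (?i n)"
    "\<And>y. y \<in> D \<Longrightarrow> ?F y = (coord_map c c' (?i n) (fst y), snd y + of_int n)"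
    by (rule torus_transition[OF N \<nu> c z]) blast
  have fz: "fst z \<in> coord_domain c c' (?i n)" using D by blast
  have d: "coord_map c c' (?i n) differentiable (at (fst z))"
    by (rule smooth_map_differentiable[OF int_iterate_smooth_pullback(1)[OF N \<nu>] c fz])
  have "dir_deriv ?F z V = (dir_deriv (coord_map c c' (?i n)) (fst z) (fst V), snd V)" for V
  proof -
    have "dir_deriv ?F z V = dir_deriv (\<lambda>y. (coord_map c c' (?i n) (fst y), snd y + real_of_int n)) z V"
      by (rule dir_deriv_cong_open[OF D(1,2,4)])
    also have "\<dots> = (dir_deriv (coord_map c c' (?i n)) (fst z) (fst V), snd V + 0)"
      by (rule dir_deriv_eq)
        (intro has_derivative_Pair has_derivative_fst_compose[OF d] has_derivative_add has_derivative_const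
          bounded_linear_imp_has_derivative bounded_linear_snd)
    finally show ?thesis by simp
  qed
  then show thesis
    using that[OF fz] D(2,4) by simp
qed

lemma cylinder_3_form_smooth:
  fixes w p :: "'e::euclidean_space \<Rightarrow> 'e altform"
  assumes U: "open U" and I: "open (I :: real set)"
    and sm: "\<And>v. smooth_on U (\<lambda>y. w y v)" "\<And>v. smooth_on U (\<lambda>y. p y v)"
  shows "smooth_on (U \<times> I) (\<lambda>z. cylinder_3_form (w (fst z)) (p (fst z)) V)"
proof -
  have o: "open (U \<times> I)" using U I by (rule open_Times)
  have fs: "smooth_on (U \<times> I) (\<lambda>z. f (fst z))" if "smooth_on U f" for f :: "'e \<Rightarrow> real"
    by (rule smooth_on_compose[OF o that smooth_on_bounded_linear[OF bounded_linear_fst]]) auto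
  have sc: "smooth_on (U \<times> I) (\<lambda>z. r * f (fst z))" if "smooth_on U f" for f :: "'e \<Rightarrow> real" and r
    by (rule smooth_on_linear_compose[OF o bounded_linear_mult_right fs[OF that]])
  have "smooth_on (U \<times> I) (\<lambda>z. p (fst z) (tup [fst (V 0), fst (V 1), fst (V 2)])
      + snd (V 2) * w (fst z) (tup [fst (V 0), fst (V 1)])
      + (- snd (V 1)) * w (fst z) (tup [fst (V 0), fst (V 2)])
      + snd (V 0) * w (fst z) (tup [fst (V 1), fst (V 2)]))"
    by (intro smooth_on_add o sc[OF sm(1)] fs[OF sm(2)])
  then show ?thesis by (simp add: cylinder_3_form_def)
qed

text \<open>\<open>p + w \<and> dt\<close> is natural for maps that preserve the product
  decomposition and \<open>dt\<close>.\<close>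

lemma cylinder_3_form_pullback:
  assumes w': "alternating_form 2 w'" and p': "alternating_form 3 p'" and L: "linear L"
  shows "cylinder_3_form (\<lambda>v. w' (\<lambda>i. L (v i))) (\<lambda>v. p' (\<lambda>i. L (v i))) V =
    cylinder_3_form w' p' (\<lambda>i. (L (fst (V i)), snd (V i)))"
proof -
  have L0: "L 0 = 0" by (rule linear_0[OF L])
  have "(\<lambda>i. L (tup [x, y] i)) = tup [L x, L y]" "(\<lambda>i. L (tup [x, y, z] i)) = tup [L x, L y, L z]" for x y z
    by (auto simp: fun_eq_iff L0 split: nat.split)
  then show ?thesis by (simp add: cylinder_3_form_def del: tup.simps)
qed

text \<open>In each chart of the mapping torus \<open>\<phi>\<close> and \<open>\<theta>\<close>
  are the forms of the cylinder over a chart of \<open>N\<close>. The coordinate expressions fit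
  together because the transition maps come from powers of \<open>\<nu>\<close>, which preserve
  \<open>\<omega>\<close> and \<open>\<psi>\<close>; the equations are local and hold on the
  cylinder.\<close>

lemma mapping_torus_locally_conformal_parallel:
  fixes N :: "('a, 'e::euclidean_space) atlas_space"
  assumes nk: "nearly_kaehler N \<omega> \<psi>" and \<nu>: "diffeomorphism N N \<nu>" and pb: "is_pullback N N \<nu> \<omega> \<omega>"
  shows "\<exists>\<phi>. locally_conformal_parallel (mapping_torus N \<nu>) \<phi>"
proof -
  have N: "smooth_manifold N" and D6: "DIM('e) = 6" and dfw: "diff_form N 2 \<omega>" and dfp: "diff_form N 3 \<psi>"
    and ad: "\<And>c x. c \<in> atlas N \<Longrightarrow> x \<in> chart_image c \<Longrightarrow> \<exists>e. su3_adapted e (\<omega> c x)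
          (\<psi> c x)"
    using nk unfolding nearly_kaehler_def su3_structure_def by blast+
  let ?M = "mapping_torus N \<nu>"
  note atlas = atlas_mapping_torus[OF N \<nu>]
  \<comment> \<open>A form has to be given as a function of the chart of the torus, so a chart
    of \<open>N\<close> from which it arises is chosen. The choice does not matter, as the
    description of the transition maps holds for any such charts of \<open>N\<close>.\<close>
  define ch where "ch C = (SOME c. c \<in> atlas N \<and> (\<exists>a. C = torus_chart N \<nu> c a))" for C
  have ch: "ch C \<in> atlas N \<and> (\<exists>a. C = torus_chart N \<nu> (ch C) a)" if "C \<in> atlas ?M" for C
    unfolding ch_def by (rule someI_ex) (use that atlas in blast)
  define \<phi> where "\<phi> C z = cylinder_3_form (\<omega> (ch C) (fst z)) (\<psi> (ch C) (fst z))" for C and z :: "'e \<times> real"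
  \<comment> \<open>The Lee form \<open>3 dt\<close>.\<close>
  define \<theta> where "\<theta> C z = (\<lambda>v :: nat \<Rightarrow> 'e \<times> real. 3 * snd (v 0))"
    for C :: "(('a \<times> real) set, 'e \<times> real) chart" and z :: "'e \<times> real"
  have \<theta>_eq: "\<theta> C z = (\<lambda>v. 3 * snd (v 0))" for C z by (simp add: \<theta>_def)
  have image: "\<exists>a. chart_image C = chart_image (ch C) \<times> {a <..< a + 1}" if C: "C \<in> atlas ?M" for C
  proof -
    obtain a where "C = torus_chart N \<nu> (ch C) a" using ch[OF C] by blast
    then show ?thesis using torus_chart_image[OF N \<nu> conjunct1[OF ch[OF C]], of a] by metis
  qed
  have base: "fst z \<in> chart_image (ch C)" if C: "C \<in> atlas ?M" and z: "z \<in> chart_image C" for C z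
  proof -
    obtain a where "chart_image C = chart_image (ch C) \<times> {a <..< a + 1}" using image[OF C] by blast
    with z have "z \<in> chart_image (ch C) \<times> {a <..< a + 1}" by (simp only:)
    then show ?thesis by (simp only: mem_Times_iff)
  qed
  have openU: "open (chart_image (ch C))" if "C \<in> atlas ?M" for C
    using smooth_manifold_chart[OF N conjunct1[OF ch[OF that]]] by (simp add: is_chart_def)
  have adapted: "\<exists>e. g2_adapted e (\<phi> C z)" if C: "C \<in> atlas ?M" and z: "z \<in> chart_image C" for C z
    using ad[OF conjunct1[OF ch[OF C]] base[OF C z]] cylinder_g2_adapted unfolding \<phi>_def by blast
  have transition: "\<exists>n. fst z \<in> coord_domain (ch C) (ch C') (int_iterate (topspace (mtop N)) \<nu> n) \<and>
      fst (coord_map C C' id z) = coord_map (ch C) (ch C') (int_iterate (topspace (mtop N)) \<nu> n) (fst z) \<and>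
      (\<forall>V. dir_deriv (coord_map C C' id) z V =
        (dir_deriv (coord_map (ch C) (ch C') (int_iterate (topspace (mtop N)) \<nu> n)) (fst z) (fst V), snd V))"
    if C: "C \<in> atlas ?M" "C' \<in> atlas ?M" and z: "z \<in> coord_domain C C' id" for C C' z
  proof -
    obtain a a' where aa: "C = torus_chart N \<nu> (ch C) a" "C' = torus_chart N \<nu> (ch C') a'"
      using ch C by blast
    have c: "ch C \<in> atlas N" "ch C' \<in> atlas N" using ch C by blast+
    have "z \<in> coord_domain (torus_chart N \<nu> (ch C) a) (torus_chart N \<nu> (ch C') a') id"
      using z aa by simp
    from torus_transition_derivative[OF N \<nu> c this]
    show ?thesis unfolding aa[symmetric] by blast
  qed
  have pb\<psi>: "is_pullback N N \<nu> \<psi> \<psi>"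
    using nearly_kaehler_pullback_psi[OF nk _ pb] \<nu> by (simp add: diffeomorphism_def)
  have df\<phi>: "diff_form ?M 3 \<phi>"
    unfolding diff_form_def
  proof (intro conjI ballI allI)
    fix C assume C: "C \<in> atlas ?M"
    show "alternating_form 3 (\<phi> C z)" if z: "z \<in> chart_image C" for z
      using adapted[OF C z] g2_adapted_expand(3) by blast
    obtain a where a: "chart_image C = chart_image (ch C) \<times> {a <..< a + 1}" using image[OF C] by blast
    show "smooth_on (chart_image C) (\<lambda>z. \<phi> C z V)" for V
      unfolding a \<phi>_def
      by (rule cylinder_3_form_smooth[OF openU[OF C] _ diff_formD(2)[OF dfw] diff_formD(2)[OF dfp]])
        (use ch[OF C] in auto)
  next
    show "is_pullback ?M ?M id \<phi> \<phi>"
      unfolding is_pullback_def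
    proof (intro ballI)
      fix C C' z assume C: "C \<in> atlas ?M" "C' \<in> atlas ?M" and z: "z \<in> coord_domain C C' id"
      have c: "ch C \<in> atlas N" "ch C' \<in> atlas N" using ch C by blast+
      obtain n where n: "fst z \<in> coord_domain (ch C) (ch C') (int_iterate (topspace (mtop N)) \<nu> n)"
        "fst (coord_map C C' id z) = coord_map (ch C) (ch C') (int_iterate (topspace (mtop N)) \<nu> n) (fst z)"
        "\<And>V. dir_deriv (coord_map C C' id) z V =
          (dir_deriv (coord_map (ch C) (ch C') (int_iterate (topspace (mtop N)) \<nu> n)) (fst z) (fst V), snd V)"
        using transition[OF C z] by blast
      let ?i = "int_iterate (topspace (mtop N)) \<nu> n"
      let ?h = "coord_map (ch C) (ch C') ?i"
      have w: "\<omega> (ch C) (fst z) = pullback_field ?h (\<omega> (ch C')) (fst z)"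
        using int_iterate_smooth_pullback(2)[OF N \<nu> dfw pb, of n] c n(1) unfolding is_pullback_def by blast
      have p: "\<psi> (ch C) (fst z) = pullback_field ?h (\<psi> (ch C')) (fst z)"
        using int_iterate_smooth_pullback(2)[OF N \<nu> dfp pb\<psi>, of n] c n(1) unfolding is_pullback_def by blast
      have hz: "?h (fst z) \<in> chart_image (ch C')"
        by (rule coord_map_in_image[OF smooth_manifold_chart[OF N c(1)] n(1)])
      have lin: "linear (dir_deriv ?h (fst z))"
        by (rule linear_frechet_derivative)
          (rule smooth_map_differentiable[OF int_iterate_smooth_pullback(1)[OF N \<nu>] c n(1)])
      show "\<phi> C z = pullback_field (coord_map C C' id) (\<phi> C') z"
        unfolding \<phi>_def w p pullback_field_def n(2,3)
        by (rule ext) (rule cylinder_3_form_pullback[OF diff_formD(1)[OF dfw c(2) hz] diff_formD(1)[OF dfp c(2) hz] lin])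
    qed
  qed
  have df\<theta>: "diff_form ?M 1 \<theta>"
    unfolding diff_form_def
  proof (intro conjI ballI allI)
    fix C z
    have "linear (\<lambda>v :: 'e \<times> real. 3 * snd v)" by (auto simp: linear_iff algebra_simps)
    from alternating_form_covector[OF this] show "alternating_form 1 (\<theta> C z)"
      by (simp add: \<theta>_eq)
    show "smooth_on (chart_image C) (\<lambda>z. \<theta> C z V)" for V
      unfolding \<theta>_eq by (rule smooth_on_const)
  next
    show "is_pullback ?M ?M id \<theta> \<theta>"
      unfolding is_pullback_def
    proof (intro ballI)
      fix C C' z assume C: "C \<in> atlas ?M" "C' \<in> atlas ?M" and z: "z \<in> coord_domain C C' id"
      have "snd (dir_deriv (coord_map C C' id) z V) = snd V" for V
        using transition[OF C z] by (metis snd_conv)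
      then show "\<theta> C z = pullback_field (coord_map C C' id) (\<theta> C') z"
        by (simp add: pullback_field_def \<theta>_eq)
    qed
  qed
  have eqs: "ext_d 3 (\<phi> C) z V = - wedge 1 3 (\<theta> C z) (\<phi> C z) V"
    "ext_d 4 (g2_star \<phi> 3 \<phi> C) z V = - (4 / 3) * wedge 1 4 (\<theta> C z) (g2_star \<phi> 3 \<phi> C z) V"
    if C: "C \<in> atlas ?M" and z: "z \<in> chart_image C" for C z V
  proof -
    have c: "ch C \<in> atlas N" using ch[OF C] by blast
    have star: "g2_star \<phi> 3 \<phi> C = (\<lambda>z. hodge_star (g2_metric (\<phi> C z)) (g2_volume (\<phi> C z)) 3 (\<phi> C z))"
      by (simp add: g2_star_def fun_eq_iff)
    note lcp = cylinder_locally_conformal_parallel[where w = "\<omega> (ch C)" and p = "\<psi> (ch C)" and z = z and V = V,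
        OF openU[OF C] base[OF C z] ad[OF c] diff_formD(2)[OF dfw c] diff_formD(2)[OF dfp c]
        nearly_kaehler_equations[OF nk c]]
    show "ext_d 3 (\<phi> C) z V = - wedge 1 3 (\<theta> C z) (\<phi> C z) V"
      unfolding \<phi>_def[abs_def] \<theta>_eq by (rule lcp(1))
    show "ext_d 4 (g2_star \<phi> 3 \<phi> C) z V = - (4 / 3) * wedge 1 4 (\<theta> C z) (g2_star \<phi> 3 \<phi> C z) V"
      unfolding star \<theta>_eq unfolding \<phi>_def[abs_def] by (rule lcp(2))
  qed
  have "g2_structure ?M \<phi>"
    unfolding g2_structure_def using mapping_torus_smooth_manifold[OF N \<nu>] D6 df\<phi> adapted by simp
  moreover have "dform_eq ?M (ext_deriv 3 \<phi>) (dform_scale (- 1) (dform_wedge 1 3 \<theta> \<phi>))"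
    unfolding dform_eq_def by (intro ballI ext) (simp add: ext_deriv_ext_d dform_scale_def dform_wedge_def eqs)
  moreover have "dform_eq ?M (ext_deriv 4 (g2_star \<phi> 3 \<phi>)) (dform_scale (- (4 / 3)) (dform_wedge 1 4 \<theta> (g2_star \<phi> 3 \<phi>)))"
    unfolding dform_eq_def by (intro ballI ext) (simp add: ext_deriv_ext_d dform_scale_def dform_wedge_def eqs)
  ultimately show ?thesis
    unfolding locally_conformal_parallel_def using df\<theta> by blast
qed

theorem proposition3p5:
  fixes N :: "('a, real ^ 6) atlas_space"
    and \<omega> \<psi> :: "('a, real ^ 6) dform"
    and \<nu> :: "'a \<Rightarrow> 'a"
  assumes "smooth_manifold N"
    and "compact_space (mtop N)"
    and "connected_space (mtop N)"
    and "nearly_kaehler N \<omega> \<psi>"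
    and "diffeomorphism N N \<nu>"
    and "is_pullback N N \<nu> \<omega> \<omega>"
  shows "\<exists>\<phi>. locally_conformal_parallel (mapping_torus N \<nu>) \<phi>"
  by (rule mapping_torus_locally_conformal_parallel[OF assms(4-6)])

end
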